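(* Let $f$ be a holomorphic function in a neighbourhood of the closed unit polydisc $\overline{\mathbb{D}^n}\subset\mathbb{C}^n$, and let $Z=\{f=0\}$. Let $$\omega=\sum_{|J|=n-q}\omega_J\,d\hat{\bar z}_J$$ be a $(0,q)$-form with $L^r$ coefficients and compact support in $\mathbb{D}^n\setminus Z$, such that $\bar\partial\omega=0$ and such that, for every $J=(j_1,\dots,j_{n-q})$ with $|J|=n-q$ and every $i=1,\dots,n-q$, $$\bar\partial_{j_{n-q}}\cdots\bar\partial_{j_i}\,\omega_J\in L^{r}(\mathbb{C}^n).$$ Then, for any $k\in\mathbb{N}$, we can find a $(0,q-1)$-form $\beta\in L^r_c(\mathbb{D}^n)$ such that $\bar\partial(f^k\beta)=\omega$. Equivalently, we can find a $(0,q-1)$-form $\eta=f^k\beta$ such that $\eta\in L^r_c(\mathbb{D}^n)$, $\eta$ is $0$ on $Z$ up to order $k$, and $\bar\partial\eta=\omega$.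
   Context: $\mathbb{D}^n$ is the open unit polydisc in $\mathbb{C}^n$. $L^r_c(\mathbb{D}^n)$ is the space of $L^r$ functions with compact support contained in $\mathbb{D}^n$; a form is said to be in $L^r_c(\mathbb{D}^n)$ if its coefficients are. Functions with compact support are regarded as functions on $\mathbb{C}^n$ by extension by zero. The sum is over multi-indices $J=(j_1<\dots<j_{n-q})$ in $\{1,\dots,n\}$, and $d\hat{\bar z}_J$ is the exterior product, in increasing order, of the $d\bar z_i$ with $i\notin J$. $\bar\partial_j=\partial/\partial\bar z_j$, and all derivatives are in the sense of distributions. "$\eta$ is $0$ on $Z$ up to order $k$" is to be read as: $\eta=f^k\beta$ with $\beta$ in $L^r_c(\mathbb{D}^n)$.
   Formalization: Stated for 1 ≤ q ≤ n−1 and 1 ≤ r ≤ ∞: for q = n the hypotheses on ω are vacuous and the claim fails (n = q = 1, f = 1, ω = χ dz̄ with ∫χ ≠ 0); for r < 1 the distributional derivatives need not be defined. *)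

theory Defs
  imports "HOL-Analysis.Analysis"
begin

definition open_polydisc :: "(complex ^ 'n) set" where
  "open_polydisc = {z. \<forall>j. norm (z $ j) < 1}"

definition closed_polydisc :: "(complex ^ 'n) set" where
  "closed_polydisc = {z. \<forall>j. norm (z $ j) \<le> 1}"

text \<open>Holomorphic functions of several complex variables: the real Frechet derivative exists
  and is complex linear.\<close>

definition holomorphic_Cn_on :: "(complex ^ 'n::finite \<Rightarrow> complex) \<Rightarrow> (complex ^ 'n) set \<Rightarrow> bool" where
  "holomorphic_Cn_on f U \<longleftrightarrow>
     open U \<and> (\<forall>z\<in>U. \<exists>D. (f has_derivative D) (at z) \<and> (\<forall>a h. D (a *s h) = a * D h))"

text \<open>Functions stand for their almost everywhere classes. Lebesgue (rather than Borel)
  measurability makes all notions below invariant under changes on null sets.\<close>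

definition Lr_fun :: "ennreal \<Rightarrow> ('a::euclidean_space \<Rightarrow> complex) set" where
  "Lr_fun r = {u. u \<in> borel_measurable lebesgue \<and>
     (if r = \<infinity> then \<exists>C. AE x in lebesgue. norm (u x) \<le> C
      else (\<integral>\<^sup>+ x. ennreal (norm (u x) powr enn2real r) \<partial>lebesgue) < \<infinity>)}"

text \<open>Functions on the whole space, extended by zero, whose (essential) support is a compact
  subset of \<open>\<Omega>\<close>.\<close>

definition Lr_comp :: "ennreal \<Rightarrow> 'a set \<Rightarrow> ('a::euclidean_space \<Rightarrow> complex) set" where
  "Lr_comp r \<Omega> = {u \<in> Lr_fun r.
     \<exists>K. compact K \<and> K \<subseteq> \<Omega> \<and> (AE x in lebesgue. x \<notin> K \<longrightarrow> u x = 0)}"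

text \<open>A function is smooth iff all its iterated directional derivatives exist and are
  (totally) differentiable.\<close>

primrec iter_deriv ::
  "'a list \<Rightarrow> ('a::euclidean_space \<Rightarrow> 'b::real_normed_vector) \<Rightarrow> 'a \<Rightarrow> 'b" where
  "iter_deriv [] \<phi> = \<phi>"
| "iter_deriv (v # vs) \<phi> = (\<lambda>x. frechet_derivative (iter_deriv vs \<phi>) (at x) v)"

definition smooth_fun :: "('a::euclidean_space \<Rightarrow> 'b::real_normed_vector) \<Rightarrow> bool" where
  "smooth_fun \<phi> \<longleftrightarrow> (\<forall>vs x. iter_deriv vs \<phi> differentiable (at x))"

definition test_fun :: "('a::euclidean_space \<Rightarrow> complex) \<Rightarrow> bool" where
  "test_fun \<phi> \<longleftrightarrow> smooth_fun \<phi> \<and> compact (closure {x. \<phi> x \<noteq> 0})"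

definition dzbar ::
  "'n::finite \<Rightarrow> (complex ^ 'n \<Rightarrow> complex) \<Rightarrow> complex ^ 'n \<Rightarrow> complex" where
  "dzbar j \<phi> z = (frechet_derivative \<phi> (at z) (axis j 1)
                 + \<i> * frechet_derivative \<phi> (at z) (axis j \<i>)) / 2"

text \<open>Distributions are functionals that only matter on test functions. All those occurring here
  are distributional derivatives of locally integrable functions, so that continuity is automatic.\<close>

type_synonym 'n distribution = "(complex ^ 'n \<Rightarrow> complex) \<Rightarrow> complex"

definition distribution_eq ::
  "'n::finite distribution \<Rightarrow> 'n distribution \<Rightarrow> bool" (infix \<open>=\<^sub>D\<close> 50) where
  "S =\<^sub>D T \<longleftrightarrow> (\<forall>\<phi>. test_fun \<phi> \<longrightarrow> S \<phi> = T \<phi>)"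

definition distribution_of :: "(complex ^ 'n::finite \<Rightarrow> complex) \<Rightarrow> 'n distribution" where
  "distribution_of u = (\<lambda>\<phi>. \<integral>z. u z * \<phi> z \<partial>lebesgue)"

definition distribution_dzbar :: "'n::finite \<Rightarrow> 'n distribution \<Rightarrow> 'n distribution" where
  "distribution_dzbar j T = (\<lambda>\<phi>. - T (dzbar j \<phi>))"

definition distribution_in_Lr :: "ennreal \<Rightarrow> 'n::finite distribution \<Rightarrow> bool" where
  "distribution_in_Lr r T \<longleftrightarrow> (\<exists>g \<in> Lr_fun r. T =\<^sub>D distribution_of g)"

text \<open>A \<open>(0,p)\<close>-form is given by its coefficients: the value at a set \<open>I\<close> with \<open>card I = p\<close> is the
  coefficient of the exterior product, in increasing order, of the \<open>d zbar_i\<close> with \<open>i \<in> I\<close>; values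
  at sets of other cardinality are irrelevant. Likewise for \<open>(0,p)\<close>-forms with distribution
  coefficients. In the notation of complementary multi-indices the coefficient \<open>\<omega>_J\<close> of a form \<open>\<omega>\<close> is
  \<open>\<omega> (- J)\<close>.\<close>

type_synonym 'n form = "'n set \<Rightarrow> complex ^ 'n \<Rightarrow> complex"
type_synonym 'n current = "'n set \<Rightarrow> 'n distribution"

definition current_of :: "'n::finite form \<Rightarrow> 'n current" where
  "current_of \<alpha> = (\<lambda>I. distribution_of (\<alpha> I))"

definition current_eq :: "nat \<Rightarrow> 'n::finite current \<Rightarrow> 'n current \<Rightarrow> bool" where
  "current_eq p S T \<longleftrightarrow> (\<forall>I. card I = p \<longrightarrow> S I =\<^sub>D T I)"

text \<open>The sign comes from moving \<open>d zbar_j\<close> to its place in \<open>d zbar_j \<and> d zbar_(K - {j})\<close>.\<close>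

definition dbar :: "'n::{finite,linorder} current \<Rightarrow> 'n current" where
  "dbar T = (\<lambda>K \<phi>. \<Sum>j\<in>K. (-1) ^ card {i\<in>K. i < j} * distribution_dzbar j (T (K - {j})) \<phi>)"

definition form_Lr_comp :: "ennreal \<Rightarrow> (complex ^ 'n) set \<Rightarrow> nat \<Rightarrow> 'n::finite form set" where
  "form_Lr_comp r \<Omega> p = {\<alpha>. \<forall>I. card I = p \<longrightarrow> \<alpha> I \<in> Lr_comp r \<Omega>}"

definition form_mult :: "(complex ^ 'n::finite \<Rightarrow> complex) \<Rightarrow> 'n form \<Rightarrow> 'n form" where
  "form_mult g \<alpha> = (\<lambda>I z. g z * \<alpha> I z)"

text \<open>\<open>\<eta>\<close> is zero on \<open>{f = 0}\<close> up to order \<open>k\<close>.\<close>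

definition zero_up_to_order ::
  "ennreal \<Rightarrow> nat \<Rightarrow> (complex ^ 'n::finite \<Rightarrow> complex) \<Rightarrow> nat \<Rightarrow> 'n form \<Rightarrow> bool" where
  "zero_up_to_order r p f k \<eta> \<longleftrightarrow>
     (\<exists>\<beta> \<in> form_Lr_comp r open_polydisc p.
        \<forall>I. card I = p \<longrightarrow> (AE z in lebesgue. \<eta> I z = form_mult (\<lambda>z. f z ^ k) \<beta> I z))"

end

theory Submission
  imports Defs "HOL-Complex_Analysis.Cauchy_Integral_Formula"
begin

text \<open>
  Since \<open>f\<close> has no zeros on the support of \<open>\<omega>\<close>, the form \<open>\<omega> / f^k\<close> is again \<open>L^r\<close>, compactly supported and
  closed, and a solution \<open>\<beta>\<close> of \<open>dbar \<beta> = \<omega> / f^k\<close> gives \<open>dbar (f^k \<beta>) = \<omega>\<close>. It remains to solve the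
  equation with compact support in degree \<open>q < n\<close>.

  Let \<open>T_j\<close> be the Cauchy transform in the variable \<open>z_j\<close> and \<open>\<theta>\<close> a cutoff function of \<open>z_j\<close> that is \<open>1\<close> near
  the support. Then \<open>K_j = \<theta> T_j\<close>, contracted with \<open>d zbar_j\<close>, satisfies \<open>id = dbar K_j + K_j dbar + P_j\<close>, where
  \<open>P_j\<close> maps a component containing \<open>d zbar_j\<close> to \<open>- (dbar_j \<theta>) T_j\<close> of it and annihilates all other
  components. All these operators preserve \<open>L^r\<close> and compact support in the polydisc. Composing over
  all \<open>j\<close>, the form \<open>\<omega>\<close> is cohomologous to \<open>P_1 ... P_n \<omega>\<close>, whose components all vanish because each
  of them misses some \<open>d zbar_j\<close>.

  All weak equations are tested against compactly supported \<open>C1\<close> functions. This class is stable under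
  \<open>T_j\<close> and under multiplication by the piecewise polynomial cutoffs used below, and mollification
  reduces it to smooth test functions.
\<close>

subsection \<open>Continuously differentiable functions and convolution\<close>

text \<open>The transform of an L^r form is never differentiated. The kernel of \<open>T_j\<close>
  is odd, so its transpose is \<open>- T_j\<close>, and every identity for \<open>\<omega>\<close>
  is obtained by testing closedness of \<open>\<omega>\<close> against \<open>T_j\<close> of a
  cutoff times \<open>\<phi>\<close>. Hence the analytic facts required of \<open>T_j\<close> are
  two: the Cauchy-Pompeiu formula for compactly supported C1 functions, and Young's inequality for
  the L^r bounds. The cutoff is forced, because \<open>T_j\<close> of a function supported in the
  polydisc generally spreads beyond it in the variable \<open>z_j\<close>. Each cutoff enlarges the
  radius of the polydisc a little; with finitely many variables it stays below 1. The error left by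
  one variable is again closed, so the step can be repeated, and zero components stay zero, so the
  gains accumulate. Division and multiplication by powers of \<open>f\<close> are also moved to the
  test function. The obstacle is that \<open>1 / f\<close> is singular inside the polydisc; it is
  replaced by a C1 function that agrees with it on the support of \<open>\<omega>\<close> and is
  holomorphic to first order there. Fubini is applied to \<open>u (x - L w)\<close>, which is why
  Lebesgue classes are first replaced by Borel representatives.\<close>

definition C1_on :: "'a::euclidean_space set \<Rightarrow> ('a \<Rightarrow> complex) \<Rightarrow> bool" where
  "C1_on S \<phi> \<longleftrightarrow> (\<forall>x\<in>S. \<phi> differentiable (at x)) \<and>
     (\<forall>v. continuous_on S (\<lambda>x. frechet_derivative \<phi> (at x) v))"

text \<open>In \<open>C1_on\<close> only the derivatives in fixed directions are required to be
  continuous; in finite dimension this amounts to continuity of the whole derivative. Compact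
  support is expressed by boundedness, since the closure of a bounded set is compact.\<close>

definition C1c :: "('a::euclidean_space \<Rightarrow> complex) \<Rightarrow> bool" where
  "C1c \<phi> \<longleftrightarrow> C1_on UNIV \<phi> \<and> bounded {x. \<phi> x \<noteq> 0}"

lemma C1_onI:
  assumes "\<And>x. x \<in> S \<Longrightarrow> (\<phi> has_derivative D x) (at x)"
    and "\<And>v. continuous_on S (\<lambda>x. D x v)"
  shows "C1_on S \<phi>"
proof -
  have "frechet_derivative \<phi> (at x) = D x" if "x \<in> S" for x
    using frechet_derivative_at[OF assms(1)[OF that]] by simp
  then show ?thesis
    using assms unfolding C1_on_def differentiable_def by (auto cong: continuous_on_cong)
qed

lemma C1_on_has_derivative:
  "C1_on S \<phi> \<Longrightarrow> x \<in> S \<Longrightarrow> (\<phi> has_derivative frechet_derivative \<phi> (at x)) (at x)"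
  unfolding C1_on_def using frechet_derivative_works by blast

lemma C1_on_continuous_on: "C1_on S \<phi> \<Longrightarrow> continuous_on S \<phi>"
  by (meson C1_on_has_derivative continuous_at_imp_continuous_on has_derivative_continuous)

lemma C1_on_continuous_frechet:
  "C1_on S \<phi> \<Longrightarrow> continuous_on S (\<lambda>x. frechet_derivative \<phi> (at x) v)"
  unfolding C1_on_def by blast

lemma C1_on_subset: "C1_on S \<phi> \<Longrightarrow> T \<subseteq> S \<Longrightarrow> C1_on T \<phi>"
  unfolding C1_on_def by (meson continuous_on_subset subsetD)

lemma C1_on_const: "C1_on S (\<lambda>x. c)"
  by (rule C1_onI[where D="\<lambda>x v. 0"]) auto

lemma C1_on_mult:
  assumes "C1_on S \<phi>" "C1_on S \<psi>"
  shows "C1_on S (\<lambda>x. \<phi> x * \<psi> x)"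
proof (rule C1_onI)
  show "((\<lambda>x. \<phi> x * \<psi> x) has_derivative
      (\<lambda>v. \<phi> x * frechet_derivative \<psi> (at x) v + frechet_derivative \<phi> (at x) v * \<psi> x)) (at x)"
    if "x \<in> S" for x
    using has_derivative_mult[OF C1_on_has_derivative[OF assms(1) that] C1_on_has_derivative[OF assms(2) that]] .
  show "continuous_on S (\<lambda>x. \<phi> x * frechet_derivative \<psi> (at x) v + frechet_derivative \<phi> (at x) v * \<psi> x)" for v
    by (intro continuous_intros C1_on_continuous_frechet C1_on_continuous_on assms)
qed

lemma C1_on_power: "C1_on S \<phi> \<Longrightarrow> C1_on S (\<lambda>x. \<phi> x ^ k)"
  by (induction k) (auto intro: C1_on_const C1_on_mult)

lemma C1_on_prod:
  "finite A \<Longrightarrow> (\<And>i. i \<in> A \<Longrightarrow> C1_on S (\<phi> i)) \<Longrightarrow> C1_on S (\<lambda>x. \<Prod>i\<in>A. \<phi> i x)"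
  by (induction A rule: finite_induct) (auto intro: C1_on_const C1_on_mult)

text \<open>Splits a direction that varies with the point into the fixed directions 1 and
  \<open>\<i>\<close>, for which \<open>C1_on\<close> provides continuity. The chain rule
  \<open>C1_on_compose\<close> evaluates the outer derivative in such a moving direction.\<close>

lemma linear_complex_decomp:
  fixes L :: "complex \<Rightarrow> complex"
  assumes "linear L"
  shows "L h = Re h *\<^sub>R L 1 + Im h *\<^sub>R L \<i>"
proof -
  have "L h = L (Re h *\<^sub>R 1 + Im h *\<^sub>R \<i>)"
    by (rule arg_cong[of _ _ L]) (simp add: complex_eq_iff)
  also have "\<dots> = Re h *\<^sub>R L 1 + Im h *\<^sub>R L \<i>"
    unfolding linear_add[OF assms] linear_scale[OF assms] ..
  finally show ?thesis .
qed

lemma C1_on_compose: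
  assumes G: "C1_on UNIV G" and f: "C1_on S f"
  shows "C1_on S (\<lambda>x. G (f x))"
proof (rule C1_onI)
  show "((\<lambda>x. G (f x)) has_derivative
      (\<lambda>v. frechet_derivative G (at (f x)) (frechet_derivative f (at x) v))) (at x)" if "x \<in> S" for x
    using diff_chain_at[OF C1_on_has_derivative[OF f that] C1_on_has_derivative[OF G]]
    by (simp add: o_def)
next
  fix v
  have "linear (frechet_derivative G (at y))" for y
    using C1_on_has_derivative[OF G] has_derivative_linear by blast
  then have *: "frechet_derivative G (at (f x)) (frechet_derivative f (at x) v) =
     Re (frechet_derivative f (at x) v) *\<^sub>R frechet_derivative G (at (f x)) 1
     + Im (frechet_derivative f (at x) v) *\<^sub>R frechet_derivative G (at (f x)) \<i>" for x
    by (rule linear_complex_decomp)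
  have c: "continuous_on S (\<lambda>x. frechet_derivative G (at (f x)) w)" for w
    by (rule continuous_on_compose2[OF C1_on_continuous_frechet[OF G] C1_on_continuous_on[OF f]]) auto
  show "continuous_on S (\<lambda>x. frechet_derivative G (at (f x)) (frechet_derivative f (at x) v))"
    unfolding * by (intro continuous_intros c C1_on_continuous_frechet f)
qed

lemma C1_on_component:
  fixes j :: "'n::finite"
  assumes "C1_on UNIV g"
  shows "C1_on S (\<lambda>z::complex^'n. g (z $ j))"
    and "frechet_derivative (\<lambda>z::complex^'n. g (z $ j)) (at z) v = frechet_derivative g (at (z $ j)) (v $ j)"
proof -
  have *: "((\<lambda>z::complex^'n. g (z $ j)) has_derivative (\<lambda>v. frechet_derivative g (at (z $ j)) (v $ j))) (at z)" for z
    using diff_chain_at[OF bounded_linear_imp_has_derivative[OF bounded_linear_vec_nth[of j]] C1_on_has_derivative[OF assms, of "z $ j"]]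
    by (simp add: o_def)
  show "frechet_derivative (\<lambda>z::complex^'n. g (z $ j)) (at z) v = frechet_derivative g (at (z $ j)) (v $ j)"
    using frechet_derivative_at[OF *] by metis
  show "C1_on S (\<lambda>z::complex^'n. g (z $ j))"
    by (rule C1_onI[OF *]) (rule continuous_on_compose2[OF C1_on_continuous_frechet[OF assms]], auto intro!: continuous_intros)
qed

section \<open>Compactly supported C1 functions\<close>

lemma C1c_has_derivative: "C1c \<phi> \<Longrightarrow> (\<phi> has_derivative frechet_derivative \<phi> (at x)) (at x)"
  unfolding C1c_def using C1_on_has_derivative by blast

lemma C1c_linear: "C1c \<phi> \<Longrightarrow> linear (frechet_derivative \<phi> (at x))"
  using C1c_has_derivative has_derivative_linear by blast

lemma C1c_continuous: "C1c \<phi> \<Longrightarrow> continuous_on S \<phi>"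
  unfolding C1c_def using C1_on_continuous_on continuous_on_subset by blast

lemma C1c_continuous_frechet: "C1c \<phi> \<Longrightarrow> continuous_on S (\<lambda>x. frechet_derivative \<phi> (at x) v)"
  unfolding C1c_def using C1_on_continuous_frechet continuous_on_subset by blast

lemma frechet_zero_outside:
  assumes "open S" "x \<in> S" "\<And>y. y \<in> S \<Longrightarrow> \<phi> y = 0"
  shows "frechet_derivative \<phi> (at x) = (\<lambda>v. 0)"
proof -
  have "(\<phi> has_derivative (\<lambda>v. 0)) (at x)"
    by (rule has_derivative_transform_within_open[OF _ assms(1,2), of "\<lambda>x. 0"]) (auto simp: assms(3))
  then show ?thesis
    by (metis frechet_derivative_at)
qed

text \<open>\<open>S\<close> and the complement of \<open>A\<close> form an open cover, and
  \<open>\<phi>\<close> vanishes on the second set. This extends by zero the product of a cutoff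
  with a function that is controlled only near the closed polydisc.\<close>

lemma C1_on_zero_outside:
  assumes "C1_on S \<phi>" "closed A" "A \<subseteq> S" "\<And>x. x \<notin> A \<Longrightarrow> \<phi> x = 0" "open S"
  shows "C1_on UNIV \<phi>"
proof -
  have o: "open (- A)" using assms(2) by auto
  have z: "frechet_derivative \<phi> (at x) = (\<lambda>v. 0)" if "x \<in> - A" for x
    by (rule frechet_zero_outside[OF o that]) (use assms(4) in auto)
  have d: "\<phi> differentiable (at x)" for x
  proof (cases "x \<in> A")
    case True then show ?thesis using assms by (auto simp: C1_on_def)
  next
    case False
    have "(\<phi> has_derivative (\<lambda>v. 0)) (at x)"
      by (rule has_derivative_transform_within_open[OF _ o, of "\<lambda>x. 0"]) (use False assms(4) in auto)
    then show ?thesis by (auto simp: differentiable_def)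
  qed
  have "continuous_on (S \<union> - A) (\<lambda>x. frechet_derivative \<phi> (at x) v)" for v
  proof (rule continuous_on_open_Un[OF \<open>open S\<close> o])
    show "continuous_on S (\<lambda>x. frechet_derivative \<phi> (at x) v)"
      using C1_on_continuous_frechet assms(1) by blast
    show "continuous_on (- A) (\<lambda>x. frechet_derivative \<phi> (at x) v)"
      by (rule continuous_on_eq[OF continuous_on_const[of _ 0]]) (use z in auto)
  qed
  moreover have "S \<union> - A = UNIV" using assms(3) by auto
  ultimately show ?thesis using d by (auto simp: C1_on_def)
qed

lemma C1c_bounded_frechet_support:
  assumes "C1c \<phi>"
  shows "bounded {x. frechet_derivative \<phi> (at x) v \<noteq> 0}"
proof (rule bounded_subset)
  show "bounded (closure {x. \<phi> x \<noteq> 0})"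
    using assms by (auto simp: C1c_def)
  show "{x. frechet_derivative \<phi> (at x) v \<noteq> 0} \<subseteq> closure {x. \<phi> x \<noteq> 0}"
  proof safe
    fix x assume *: "frechet_derivative \<phi> (at x) v \<noteq> 0"
    show "x \<in> closure {x. \<phi> x \<noteq> 0}"
    proof (rule ccontr)
      assume "x \<notin> closure {x. \<phi> x \<noteq> 0}"
      then have "frechet_derivative \<phi> (at x) = (\<lambda>v. 0)"
        by (intro frechet_zero_outside[of "- closure {x. \<phi> x \<noteq> 0}"]) (use closure_subset[of "{x. \<phi> x \<noteq> 0}"] in auto)
      then show False using * by auto
    qed
  qed
qed

lemma C1c_mult:
  assumes "C1c \<phi>" "C1_on UNIV \<psi>"
  shows "C1c (\<lambda>x. \<psi> x * \<phi> x)"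
  using assms C1_on_mult[of UNIV \<psi> \<phi>] unfolding C1c_def
  by (auto intro: bounded_subset)

lemma continuous_bounded_support_bound:
  fixes g :: "'a::euclidean_space \<Rightarrow> complex"
  assumes "continuous_on UNIV g" "bounded {x. g x \<noteq> 0}"
  obtains B where "B > 0" "\<And>x. norm (g x) \<le> B"
proof -
  have "compact (closure {x. g x \<noteq> 0})" using assms by (auto simp: compact_eq_bounded_closed)
  then have "bounded (g ` closure {x. g x \<noteq> 0})"
    by (intro compact_imp_bounded compact_continuous_image continuous_on_subset[OF assms(1)]) auto
  then obtain B where B: "B > 0" "\<And>x. x \<in> closure {x. g x \<noteq> 0} \<Longrightarrow> norm (g x) \<le> B"
    unfolding bounded_pos by auto
  have "norm (g x) \<le> B" for x
    using B closure_subset[of "{x. g x \<noteq> 0}"] by (cases "g x = 0") auto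
  with B that show thesis by blast
qed

lemma continuous_bounded_support_uniform:
  fixes g :: "'a::euclidean_space \<Rightarrow> complex"
  assumes "continuous_on UNIV g" "bounded {x. g x \<noteq> 0}" "e > 0"
  obtains d where "d > 0" "\<And>x y. dist x y < d \<Longrightarrow> norm (g x - g y) < e"
proof -
  obtain R where R: "R > 0" "\<And>x. g x \<noteq> 0 \<Longrightarrow> norm x \<le> R"
    using assms(2) unfolding bounded_pos by auto
  have "uniformly_continuous_on (cball 0 (R + 1)) g"
    by (intro compact_uniformly_continuous continuous_on_subset[OF assms(1)]) auto
  then obtain d where d: "d > 0" "\<And>x y. x \<in> cball 0 (R+1) \<Longrightarrow> y \<in> cball 0 (R+1) \<Longrightarrow> dist x y < d \<Longrightarrow> dist (g x) (g y) < e"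
    using \<open>e > 0\<close> unfolding uniformly_continuous_on_def by (metis dist_commute)
  have "norm (g x - g y) < e" if "dist x y < min d 1" for x y
  proof (cases "g x = 0 \<and> g y = 0")
    case True then show ?thesis using \<open>e > 0\<close> by auto
  next
    case False
    have "norm x \<le> norm y + 1" "norm y \<le> norm x + 1"
      using that norm_triangle_sub[of x y] norm_triangle_sub[of y x] by (auto simp: dist_norm norm_minus_commute)
    moreover have "norm x \<le> R \<or> norm y \<le> R" using R False by auto
    ultimately have "x \<in> cball 0 (R+1)" "y \<in> cball 0 (R+1)" by auto
    then show ?thesis using d that by (auto simp: dist_norm)
  qed
  then show thesis using that[of "min d 1"] d by auto
qed

text \<open>Compact support makes the partial derivatives uniformly continuous, so the mean value
  inequality gives a remainder that is uniform in \<open>x\<close>. This uniformity permits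
  differentiation under an integral and integration of difference quotients.\<close>

lemma C1c_uniform_linearization:
  fixes \<phi> :: "'a::euclidean_space \<Rightarrow> complex"
  assumes "C1c \<phi>" "e > 0"
  obtains d where "d > 0"
    "\<And>x h. norm h < d \<Longrightarrow> norm (\<phi> (x + h) - \<phi> x - frechet_derivative \<phi> (at x) h) \<le> e * norm h"
proof -
  let ?D = "\<lambda>x. frechet_derivative \<phi> (at x)"
  \<comment> \<open>Expanding \<open>h\<close> in the basis costs a factor
    \<open>DIM('a)\<close>.\<close>
  define e' where "e' = e / DIM('a)"
  have e': "e' > 0" using assms(2) by (auto simp: e'_def)
  have "\<exists>d>0. \<forall>x y. dist x y < d \<longrightarrow> norm (?D x b - ?D y b) < e'" for b
    using continuous_bounded_support_uniform[OF C1c_continuous_frechet C1c_bounded_frechet_support e'] assms(1)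
    by metis
  then obtain d where d: "\<And>b. d b > 0" "\<And>b x y. dist x y < d b \<Longrightarrow> norm (?D x b - ?D y b) < e'"
    by metis
  define \<delta> where "\<delta> = Min (d ` Basis)"
  have \<delta>: "\<delta> > 0" unfolding \<delta>_def using d(1) by (subst Min_gr_iff) auto
  have \<delta>d: "\<delta> \<le> d b" if "b \<in> Basis" for b
    unfolding \<delta>_def using that by auto
  have lin: "?D y h = (\<Sum>b\<in>Basis. (h \<bullet> b) *\<^sub>R ?D y b)" for y h
  proof -
    have "?D y h = ?D y (\<Sum>b\<in>Basis. (h \<bullet> b) *\<^sub>R b)" by (simp add: euclidean_representation)
    also have "\<dots> = (\<Sum>b\<in>Basis. (h \<bullet> b) *\<^sub>R ?D y b)"
      using C1c_linear[OF assms(1)] by (simp add: linear_sum linear_scale)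
    finally show ?thesis .
  qed
  have est: "norm (?D y h - ?D x h) \<le> e * norm h" if "dist y x < \<delta>" for x y h
  proof -
    have "?D y h - ?D x h = (\<Sum>b\<in>Basis. (h \<bullet> b) *\<^sub>R (?D y b - ?D x b))"
      by (subst (1 2) lin) (simp add: sum_subtractf scaleR_diff_right)
    also have "norm \<dots> \<le> (\<Sum>b\<in>(Basis::'a set). norm h * e')"
    proof (rule sum_norm_le)
      fix b :: 'a assume b: "b \<in> Basis"
      show "norm ((h \<bullet> b) *\<^sub>R (?D y b - ?D x b)) \<le> norm h * e'"
        unfolding norm_scaleR
        by (intro mult_mono Basis_le_norm b less_imp_le[OF d(2)]) (use that \<delta>d[OF b] in auto)
    qed
    also have "\<dots> = e * norm h" by (simp add: e'_def)
    finally show ?thesis .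
  qed
  have "norm (\<phi> (x + h) - \<phi> x - ?D x h) \<le> e * norm h" if "norm h < \<delta>" for x h
  proof -
    have "norm (\<phi> (x + h) - \<phi> x - ?D x (x + h - x)) \<le> norm (x + h - x) * e"
    proof (rule differentiable_bound_linearization[where S="ball x \<delta>" and f'="?D"])
      show "(\<phi> has_derivative ?D y) (at y within ball x \<delta>)" for y
        using C1c_has_derivative[OF assms(1)] has_derivative_at_withinI by blast
      show "x + t *\<^sub>R (x + h - x) \<in> ball x \<delta>" if t: "t \<in> {0..1}" for t
      proof -
        have "\<bar>t\<bar> * norm h \<le> norm h"
          using t mult_left_le_one_le[of "norm h" t] by auto
        then show ?thesis using \<open>norm h < \<delta>\<close> by (simp add: dist_norm)
      qed
      show "onorm (?D y - ?D x) \<le> e" if "y \<in> ball x \<delta>" for y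
        by (rule onorm_bound) (use assms(2) that est in \<open>auto simp: dist_commute\<close>)
    qed (use \<delta> in auto)
    then show ?thesis by (simp add: mult.commute)
  qed
  with \<delta> that show thesis by blast
qed

text \<open>The kernel may live on a smaller space than \<open>u\<close>: for
  \<open>L = axis j\<close> this is convolution in the single variable \<open>z_j\<close>, for the
  identity it is ordinary convolution. One theory thus serves both the Cauchy transform and
  mollification.\<close>

definition conv :: "('b::euclidean_space \<Rightarrow> complex) \<Rightarrow> ('b \<Rightarrow> 'a) \<Rightarrow> ('a::euclidean_space \<Rightarrow> complex) \<Rightarrow> 'a \<Rightarrow> complex" where
  "conv \<kappa> L u x = (LBINT w. \<kappa> w * u (x - L w))"

lemma conv_integrable:
  fixes L :: "'b::euclidean_space \<Rightarrow> 'a::euclidean_space" and g :: "'a \<Rightarrow> complex"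
  assumes "integrable lborel \<kappa>" "linear L" "continuous_on UNIV g" "bounded {x. g x \<noteq> 0}"
  shows "integrable lborel (\<lambda>w. \<kappa> w * g (x - L w))"
proof -
  obtain B where B: "B > 0" "\<And>x. norm (g x) \<le> B"
    using continuous_bounded_support_bound[OF assms(3,4)] by auto
  have L: "continuous_on UNIV L" using assms(2) linear_continuous_on linear_conv_bounded_linear by blast
  have m: "(\<lambda>w. g (x - L w)) \<in> borel_measurable borel"
    by (intro borel_measurable_continuous_onI continuous_on_compose2[OF assms(3)] continuous_intros L) auto
  have bd: "norm (\<kappa> w * g (x - L w)) \<le> norm (B * norm (\<kappa> w))" for w
    using B mult_right_mono[OF B(2)[of "x - L w"], of "norm (\<kappa> w)"] by (simp add: norm_mult mult.commute)
  show ?thesis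
  proof (rule Bochner_Integration.integrable_bound[of _ "\<lambda>w. B * norm (\<kappa> w)"])
    show "integrable lborel (\<lambda>w. B * norm (\<kappa> w))" using assms(1) by auto
    show "(\<lambda>w. \<kappa> w * g (x - L w)) \<in> borel_measurable lborel"
      using assms(1) m by (intro borel_measurable_times) auto
  qed (use bd in auto)
qed

lemma conv_continuous:
  assumes "integrable lborel \<kappa>" "linear L" "continuous_on UNIV g" "bounded {x. g x \<noteq> 0}"
  shows "continuous_on UNIV (conv \<kappa> L g)"
proof -
  obtain B where B: "B > 0" "\<And>x. norm (g x) \<le> B"
    using continuous_bounded_support_bound[OF assms(3,4)] by auto
  have "isCont (conv \<kappa> L g) x" for x
  proof (rule continuous_at_sequentiallyI)
    fix u :: "nat \<Rightarrow> 'b" assume u: "u \<longlonglongrightarrow> x"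
    show "(\<lambda>n. conv \<kappa> L g (u n)) \<longlonglongrightarrow> conv \<kappa> L g x"
      unfolding conv_def
    proof (rule integral_dominated_convergence[where w="\<lambda>w. B * norm (\<kappa> w)"])
      have "isCont g y" for y using assms(3) by (simp add: continuous_on_eq_continuous_at)
      then show "AE w in lborel. (\<lambda>n. \<kappa> w * g (u n - L w)) \<longlonglongrightarrow> \<kappa> w * g (x - L w)"
        by (intro AE_I2 tendsto_mult tendsto_const isCont_tendsto_compose[where g=g] tendsto_diff u)
      show "AE w in lborel. norm (\<kappa> w * g (u n - L w)) \<le> B * norm (\<kappa> w)" for n
        using B mult_right_mono[OF B(2), of "norm (\<kappa> w)" for w]
        by (intro AE_I2) (simp add: norm_mult mult.commute)
    qed (use assms conv_integrable[OF assms] in auto)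
  qed
  then show ?thesis by (simp add: continuous_on_eq_continuous_at)
qed

lemma conv_bounded_support:
  fixes L :: "'b::euclidean_space \<Rightarrow> 'a::euclidean_space"
  assumes "bounded {w. \<kappa> w \<noteq> 0}" "linear L" "bounded {x. g x \<noteq> 0}"
  shows "bounded {x. conv \<kappa> L g x \<noteq> 0}"
proof -
  have "bounded (\<Union>x\<in>{x. g x \<noteq> 0}. \<Union>y\<in>L ` {w. \<kappa> w \<noteq> 0}. {x + y})"
    by (intro bounded_sums assms bounded_linear_image) (use assms(2) linear_conv_bounded_linear in auto)
  moreover have "{x. conv \<kappa> L g x \<noteq> 0} \<subseteq> (\<Union>x\<in>{x. g x \<noteq> 0}. \<Union>y\<in>L ` {w. \<kappa> w \<noteq> 0}. {x + y})"
  proof safe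
    fix x assume "conv \<kappa> L g x \<noteq> 0"
    then obtain w where "\<kappa> w * g (x - L w) \<noteq> 0"
      unfolding conv_def by (metis (no_types, lifting) Bochner_Integration.integral_cong integral_zero)
    then show "x \<in> (\<Union>x\<in>{x. g x \<noteq> 0}. \<Union>y\<in>L ` {w. \<kappa> w \<noteq> 0}. {x + y})"
      by (intro UN_I[of "x - L w"] UN_I[of "L w"]) auto
  qed
  ultimately show ?thesis by (rule bounded_subset)
qed

text \<open>All derivatives fall on \<open>\<phi>\<close> and the kernel is never differentiated, so
  the singularity of the Cauchy kernel is harmless. The uniform linearization of
  \<open>\<phi>\<close> is simply integrated against \<open>\<kappa>\<close>.\<close>

lemma conv_C1c:
  fixes L :: "'b::euclidean_space \<Rightarrow> 'a::euclidean_space"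
  assumes \<kappa>: "integrable lborel \<kappa>" "bounded {w. \<kappa> w \<noteq> 0}" and L: "linear L" and \<phi>: "C1c \<phi>"
  shows "C1c (conv \<kappa> L \<phi>)"
    and "frechet_derivative (conv \<kappa> L \<phi>) (at x) v = conv \<kappa> L (\<lambda>y. frechet_derivative \<phi> (at y) v) x"
proof -
  let ?D = "\<lambda>v y. frechet_derivative \<phi> (at y) v"
  have i\<phi>: "integrable lborel (\<lambda>w. \<kappa> w * \<phi> (x - L w))" for x
    by (rule conv_integrable[OF \<kappa>(1) L C1c_continuous[OF \<phi>]]) (use \<phi> in \<open>auto simp: C1c_def\<close>)
  have iD: "integrable lborel (\<lambda>w. \<kappa> w * ?D v (x - L w))" for x v
    by (rule conv_integrable[OF \<kappa>(1) L C1c_continuous_frechet[OF \<phi>] C1c_bounded_frechet_support[OF \<phi>]])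
  have lin: "linear (\<lambda>v. conv \<kappa> L (?D v) x)" for x
  proof (rule linearI)
    show "conv \<kappa> L (?D (a + b)) x = conv \<kappa> L (?D a) x + conv \<kappa> L (?D b) x" for a b
      unfolding conv_def using iD by (simp add: linear_add[OF C1c_linear[OF \<phi>]] algebra_simps)
    show "conv \<kappa> L (?D (c *\<^sub>R b)) x = c *\<^sub>R conv \<kappa> L (?D b) x" for c b
      unfolding conv_def using iD by (simp add: linear_scale[OF C1c_linear[OF \<phi>]] algebra_simps)
  qed
  define M where "M = (LBINT w. norm (\<kappa> w))"
  have M: "M \<ge> 0" unfolding M_def by simp
  have der: "(conv \<kappa> L \<phi> has_derivative (\<lambda>v. conv \<kappa> L (?D v) x)) (at x)" for x
    unfolding has_derivative_at_alt
  proof (intro conjI allI impI)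
    show "bounded_linear (\<lambda>v. conv \<kappa> L (?D v) x)" using lin linear_conv_bounded_linear by blast
    fix e :: real assume "e > 0"
    \<comment> \<open>\<open>M + 1\<close> instead of \<open>M\<close> avoids a division by zero for
      a null kernel.\<close>
    then obtain d where d: "d > 0"
      "\<And>x h. norm h < d \<Longrightarrow> norm (\<phi> (x + h) - \<phi> x - ?D h x) \<le> e / (M + 1) * norm h"
      using C1c_uniform_linearization[OF \<phi>, of "e / (M+1)"] M by auto
    show "\<exists>d>0. \<forall>y. norm (y - x) < d \<longrightarrow>
       norm (conv \<kappa> L \<phi> y - conv \<kappa> L \<phi> x - conv \<kappa> L (?D (y - x)) x) \<le> e * norm (y - x)"
    proof (intro exI[of _ d] conjI allI impI d(1))
      fix y assume y: "norm (y - x) < d"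
      let ?R = "\<lambda>w. \<phi> (y - L w) - \<phi> (x - L w) - ?D (y - x) (x - L w)"
      have "conv \<kappa> L \<phi> y - conv \<kappa> L \<phi> x - conv \<kappa> L (?D (y - x)) x = (LBINT w. \<kappa> w * ?R w)"
        unfolding conv_def right_diff_distrib using i\<phi> iD by simp
      also have "norm \<dots> \<le> (LBINT w. norm (\<kappa> w) * (e / (M + 1) * norm (y - x)))"
      proof (rule Bochner_Integration.integral_norm_bound_integral)
        show "integrable lborel (\<lambda>w. \<kappa> w * ?R w)"
          unfolding right_diff_distrib using i\<phi> iD by simp
        show "integrable lborel (\<lambda>w. norm (\<kappa> w) * (e / (M + 1) * norm (y - x)))"
          using \<kappa>(1) by (intro integrable_mult_left integrable_norm)
        show "norm (\<kappa> w * ?R w) \<le> norm (\<kappa> w) * (e / (M + 1) * norm (y - x))" for w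
        proof -
          have "x - L w + (y - x) = y - L w" by simp
          then show ?thesis
            using mult_left_mono[OF d(2)[OF y, of "x - L w"], of "norm (\<kappa> w)"] by (simp add: norm_mult)
        qed
      qed
      also have "\<dots> = M * (e / (M + 1) * norm (y - x))"
        unfolding M_def by simp
      also have "\<dots> \<le> e * norm (y - x)"
      proof -
        have "M / (M + 1) \<le> 1" using M by simp
        then have "M / (M + 1) * (e * norm (y - x)) \<le> 1 * (e * norm (y - x))"
          using \<open>e > 0\<close> by (intro mult_right_mono) auto
        then show ?thesis by (simp add: field_simps)
      qed
      finally show "norm (conv \<kappa> L \<phi> y - conv \<kappa> L \<phi> x - conv \<kappa> L (?D (y - x)) x) \<le> e * norm (y - x)" .
    qed
  qed
  show "frechet_derivative (conv \<kappa> L \<phi>) (at x) v = conv \<kappa> L (?D v) x"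
    using frechet_derivative_at[OF der] by metis
  show "C1c (conv \<kappa> L \<phi>)"
    unfolding C1c_def
  proof
    show "C1_on UNIV (conv \<kappa> L \<phi>)"
      by (rule C1_onI[OF der])
        (rule conv_continuous[OF \<kappa>(1) L C1c_continuous_frechet[OF \<phi>] C1c_bounded_frechet_support[OF \<phi>]])
    show "bounded {x. conv \<kappa> L \<phi> x \<noteq> 0}"
      using conv_bounded_support[OF \<kappa>(2) L] \<phi> by (auto simp: C1c_def)
  qed
qed

subsection \<open>The Cauchy-Pompeiu formula\<close>

lemma lborel_integral_translate:
  fixes f :: "'a::euclidean_space \<Rightarrow> 'b::{banach,second_countable_topology}"
  assumes "f \<in> borel_measurable borel"
  shows "(LBINT x. f (c + x)) = (LBINT x. f x)"
proof -
  have "(LBINT x. f x) = (\<integral>x. f x \<partial>distr lborel borel ((+) c))"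
    by (simp add: lborel_distr_plus)
  also have "\<dots> = (LBINT x. f (c + x))"
    by (rule integral_distr) (use assms in auto)
  finally show ?thesis by simp
qed

lemma lborel_nn_integral_translate:
  fixes f :: "'a::euclidean_space \<Rightarrow> ennreal"
  assumes "f \<in> borel_measurable borel"
  shows "(\<integral>\<^sup>+x. f (c + x) \<partial>lborel) = (\<integral>\<^sup>+x. f x \<partial>lborel)"
proof -
  have "(\<integral>\<^sup>+x. f x \<partial>lborel) = (\<integral>\<^sup>+x. f x \<partial>distr lborel borel ((+) c))"
    by (simp add: lborel_distr_plus)
  also have "\<dots> = (\<integral>\<^sup>+x. f (c + x) \<partial>lborel)"
    by (rule nn_integral_distr) (use assms in auto)
  finally show ?thesis by simp
qed

lemma lborel_integral_scale:
  fixes f :: "'a::euclidean_space \<Rightarrow> 'b::{banach,second_countable_topology}"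
  assumes "f \<in> borel_measurable borel" "c \<noteq> 0"
  shows "(LBINT x. f x) = \<bar>c\<bar> ^ DIM('a) *\<^sub>R (LBINT x. f (c *\<^sub>R x))"
proof -
  have "(LBINT x. f x) = (\<integral>x. f x \<partial>density (distr lborel borel (\<lambda>x::'a. 0 + c *\<^sub>R x)) (\<lambda>_. ennreal (\<bar>c\<bar> ^ DIM('a))))"
    using lborel_affine[OF assms(2), of "0::'a"] by (simp add: ennreal_power)
  also have "\<dots> = (\<integral>x. (\<bar>c\<bar> ^ DIM('a)) *\<^sub>R f x \<partial>distr lborel borel (\<lambda>x::'a. 0 + c *\<^sub>R x))"
    by (rule integral_density) (use assms in auto)
  also have "\<dots> = (LBINT x. (\<bar>c\<bar> ^ DIM('a)) *\<^sub>R f (c *\<^sub>R x))"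
    using assms by (subst integral_distr) auto
  finally show ?thesis by simp
qed

lemma integrable_continuous_bounded_support:
  fixes g :: "'a::euclidean_space \<Rightarrow> complex"
  assumes "continuous_on UNIV g" "bounded {x. g x \<noteq> 0}"
  shows "integrable lborel g"
proof -
  have "integrable lborel (\<lambda>x. indicator (closure {x. g x \<noteq> 0}) x *\<^sub>R g x)"
    by (rule borel_integrable_compact) (use assms continuous_on_subset in \<open>auto simp: compact_eq_bounded_closed\<close>)
  also have "(\<lambda>x. indicator (closure {x. g x \<noteq> 0}) x *\<^sub>R g x) = g"
    using closure_subset[of "{x. g x \<noteq> 0}"] by (auto simp: fun_eq_iff indicator_def)
  finally show ?thesis .
qed

lemma C1c_integrable: "C1c g \<Longrightarrow> integrable lborel g"
  using integrable_continuous_bounded_support C1c_continuous by (auto simp: C1c_def)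

lemma C1c_integrable_frechet: "C1c g \<Longrightarrow> integrable lborel (\<lambda>x. frechet_derivative g (at x) v)"
  by (intro integrable_continuous_bounded_support C1c_continuous_frechet C1c_bounded_frechet_support)

text \<open>By translation invariance every difference quotient of \<open>g\<close> has integral 0,
  and the quotients converge to the derivative uniformly, with supports in one fixed ball.\<close>

lemma integral_frechet_derivative_eq_0:
  fixes g :: "'a::euclidean_space \<Rightarrow> complex"
  assumes g: "C1c g"
  shows "(LBINT x. frechet_derivative g (at x) v) = 0"
proof -
  let ?D = "\<lambda>x. frechet_derivative g (at x) v"
  have "bounded ({x. g x \<noteq> 0} \<union> {x. ?D x \<noteq> 0})"
    using g C1c_bounded_frechet_support[OF g] by (auto simp: C1c_def)
  then obtain R where R: "R > 0" "\<And>x. norm x > R \<Longrightarrow> g x = 0" "\<And>x. norm x > R \<Longrightarrow> ?D x = 0"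
    unfolding bounded_pos by (auto simp: not_less[symmetric])
  \<comment> \<open>Contains the supports of \<open>g\<close>, of its derivative and of all
    translates by \<open>t *\<^sub>R v\<close> with \<open>0 < t \<le> 1\<close>.\<close>
  define C where "C = cball (0::'a) (R + norm v)"
  have fin: "emeasure lborel C < \<infinity>" unfolding C_def by (rule emeasure_lborel_cball_finite)
  have gm: "g \<in> borel_measurable borel" using C1c_integrable[OF g] by auto
  have bound: "norm (LBINT x. ?D x) \<le> e * norm v * measure lborel C" if "e > 0" for e
  proof -
    obtain d where d: "d > 0" "\<And>x h. norm h < d \<Longrightarrow> norm (g (x + h) - g x - frechet_derivative g (at x) h) \<le> e * norm h"
      using C1c_uniform_linearization[OF g \<open>e > 0\<close>] by auto
    \<comment> \<open>\<open>t \<le> 1\<close> keeps the quotients supported in \<open>C\<close>;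
      the second bound puts \<open>t *\<^sub>R v\<close> below the threshold \<open>d\<close>, the
      summand 1 covering \<open>v = 0\<close>.\<close>
    define t where "t = min 1 (d / (norm v + 1) / 2)"
    have t: "t > 0" "t \<le> 1" using d by (auto simp: t_def add_nonneg_pos)
    have "t * norm v \<le> d / (norm v + 1) / 2 * norm v" by (intro mult_right_mono) (auto simp: t_def)
    also have "\<dots> = d * (norm v / (2 * (norm v + 1)))" by (simp add: field_simps)
    also have "\<dots> < d * 1"
    proof (rule mult_strict_left_mono[OF _ d(1)])
      have "norm v < 2 * (norm v + 1)" by (smt (verit) norm_ge_zero)
      then show "norm v / (2 * (norm v + 1)) < 1" by (smt (verit) divide_less_eq_1_pos norm_ge_zero)
    qed
    finally have tv: "norm (t *\<^sub>R v) < d" using t by simp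
    let ?F = "\<lambda>x. (1 / t) *\<^sub>R (g (t *\<^sub>R v + x) - g x)"
    have i1: "integrable lborel (\<lambda>x. g (t *\<^sub>R v + x))"
    proof -
      have "integrable (distr lborel borel ((+) (t *\<^sub>R v))) g" using C1c_integrable[OF g] by (simp add: lborel_distr_plus)
      then show ?thesis by (subst (asm) integrable_distr_eq) (use gm in auto)
    qed
    have iF: "integrable lborel ?F" using i1 C1c_integrable[OF g] by simp
    have "(LBINT x. ?F x) = 0"
      using i1 C1c_integrable[OF g] lborel_integral_translate[OF gm] by simp
    then have "norm (LBINT x. ?D x) = norm (LBINT x. ?D x - ?F x)"
      using iF C1c_integrable_frechet[OF g] by (subst Bochner_Integration.integral_diff) auto
    also have "\<dots> \<le> (LBINT x. indicator C x * (e * norm v))"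
    proof (rule Bochner_Integration.integral_norm_bound_integral)
      show "integrable lborel (\<lambda>x. ?D x - ?F x)" using iF C1c_integrable_frechet[OF g] by auto
      show "integrable lborel (\<lambda>x. indicator C x * (e * norm v))"
        by (intro integrable_mult_left integrable_real_indicator) (use fin in \<open>auto simp: C_def\<close>)
      fix x
      show "norm (?D x - ?F x) \<le> indicator C x * (e * norm v)"
      proof (cases "x \<in> C")
        case True
        have "norm (g (x + t *\<^sub>R v) - g x - t *\<^sub>R ?D x) \<le> e * norm (t *\<^sub>R v)"
          using d(2)[OF tv, of x] linear_scale[OF C1c_linear[OF g]] by metis
        then have "(1/t) * norm (g (x + t *\<^sub>R v) - g x - t *\<^sub>R ?D x) \<le> (1/t) * (e * norm (t *\<^sub>R v))"
          using t by (intro mult_left_mono) auto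
        then have *: "norm ((1/t) *\<^sub>R (g (x + t *\<^sub>R v) - g x - t *\<^sub>R ?D x)) \<le> e * norm v"
          using t by simp
        have "(1/t) *\<^sub>R (g (x + t *\<^sub>R v) - g x - t *\<^sub>R ?D x) = ?F x - ?D x"
          using t by (simp add: scaleR_diff_right add.commute)
        then show ?thesis using True * by (simp add: norm_minus_commute)
      next
        case False
        then have "norm x > R + norm v" by (auto simp: C_def)
        moreover have "norm (t *\<^sub>R v) \<le> norm v" using t by (simp add: mult_left_le_one_le)
        moreover have "norm x \<le> norm (t *\<^sub>R v + x) + norm (t *\<^sub>R v)"
          using norm_triangle_ineq4[of "t *\<^sub>R v + x" "t *\<^sub>R v"] by simp
        ultimately have "norm (t *\<^sub>R v + x) > R" "norm x > R" using norm_ge_zero[of v] by linarith+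
        then show ?thesis using R False by auto
      qed
    qed
    also have "\<dots> = e * norm v * measure lborel C" by (simp add: C_def)
    finally show ?thesis .
  qed
  define M where "M = norm v * measure lborel C"
  have "norm (LBINT x. ?D x) \<le> 0 + e" if "e > 0" for e
  proof -
    have M: "M \<ge> 0" by (simp add: M_def)
    have "norm (LBINT x. ?D x) \<le> e / (M + 1) * M"
      using bound[of "e / (M+1)"] that M add_nonneg_pos[OF M zero_less_one] unfolding M_def[symmetric] mult.assoc
      by (simp del: times_divide_eq_left)
    also have "\<dots> = e * (M / (M + 1))" by simp
    also have "\<dots> \<le> e * 1" using that M by (intro mult_left_mono) auto
    finally show ?thesis by simp
  qed
  then have "norm (LBINT x. ?D x) \<le> 0" by (rule field_le_epsilon)
  then show ?thesis by simp
qed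

text \<open>Off the origin \<open>F\<close> is dominated by the sum of \<open>a m\<close> times the
  indicators of discs of radius \<open>\<rho> m\<close>, whose areas are
  \<open>pi * (\<rho> m)\<^sup>2\<close>. Power singularities and power decay are thus reduced to
  geometric series, in place of polar coordinates.\<close>

lemma integrable_dyadic_layers:
  fixes F :: "complex \<Rightarrow> real"
  assumes m: "F \<in> borel_measurable borel" and pos: "\<And>w. F w \<ge> 0"
    and lay: "\<And>w. w \<noteq> 0 \<Longrightarrow> F w \<noteq> 0 \<Longrightarrow> \<exists>m. F w \<le> a m \<and> norm w < \<rho> m"
    and a: "\<And>m. a m \<ge> 0" "\<And>m. \<rho> m \<ge> 0" and s: "summable (\<lambda>m. a m * (\<rho> m)\<^sup>2)"
  shows "integrable lborel F"
proof (rule integrableI_bounded)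
  show "F \<in> borel_measurable lborel" using m by simp
  let ?B = "\<lambda>m. ball (0::complex) (\<rho> m)"
  have "AE w in lborel. w \<noteq> (0::complex)"
    by (rule AE_I[of _ _ "{0}"]) auto
  then have "(\<integral>\<^sup>+w. ennreal (norm (F w)) \<partial>lborel) \<le> (\<integral>\<^sup>+w. (\<Sum>m. ennreal (a m) * indicator (?B m) w) \<partial>lborel)"
  proof (intro nn_integral_mono_AE, eventually_elim)
    fix w :: complex assume "w \<noteq> 0"
    then have "\<exists>m. ennreal (norm (F w)) \<le> ennreal (a m) * indicator (?B m) w"
    proof (cases "F w = 0")
      case False
      then obtain m where "F w \<le> a m" "norm w < \<rho> m" using lay \<open>w \<noteq> 0\<close> by blast
      then show ?thesis using pos[of w] by (intro exI[of _ m]) (auto simp: ennreal_leI)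
    qed auto
    then obtain m where "ennreal (norm (F w)) \<le> ennreal (a m) * indicator (?B m) w" ..
    also have "\<dots> \<le> (\<Sum>m. ennreal (a m) * indicator (?B m) w)"
      using sum_le_suminf[of "\<lambda>m. ennreal (a m) * indicator (?B m) w" "{m}"] by (simp del: sum_mult_indicator)
    finally show "ennreal (norm (F w)) \<le> (\<Sum>m. ennreal (a m) * indicator (?B m) w)" .
  qed
  also have "\<dots> = (\<Sum>m. \<integral>\<^sup>+w. ennreal (a m) * indicator (?B m) w \<partial>lborel)"
    by (rule nn_integral_suminf) (auto intro!: borel_measurable_times_ennreal borel_measurable_indicator)
  also have "\<dots> = (\<Sum>m. ennreal (pi * (a m * (\<rho> m)\<^sup>2)))"
  proof (rule suminf_cong)
    fix m
    have "emeasure lborel (?B m) = ennreal (pi * (\<rho> m)\<^sup>2)"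
      using emeasure_ball[of "\<rho> m" "0::complex"] a(2)[of m] by (simp add: unit_ball_vol_2)
    then show "(\<integral>\<^sup>+w. ennreal (a m) * indicator (?B m) w \<partial>lborel) = ennreal (pi * (a m * (\<rho> m)\<^sup>2))"
      using a by (subst nn_integral_cmult_indicator) (auto simp: ennreal_mult[symmetric] mult_ac)
  qed
  also have "\<dots> = ennreal (\<Sum>m. pi * (a m * (\<rho> m)\<^sup>2))"
    by (rule suminf_ennreal2) (use a s in \<open>auto intro: summable_mult\<close>)
  also have "\<dots> < \<infinity>" by simp
  finally show "(\<integral>\<^sup>+w. ennreal (norm (F w)) \<partial>lborel) < \<infinity>" .
qed

lemma dyadic_bracket:
  fixes t :: real
  assumes "0 < t" "t < 2"
  shows "\<exists>m. (1/2) ^ m \<le> t \<and> t < 2 * (1/2) ^ m"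
proof -
  have ex: "\<exists>m. (1/2) ^ m \<le> t"
    using real_arch_pow_inv[of t "1/2"] assms by (auto intro: less_imp_le)
  define m where "m = (LEAST m. (1/2) ^ m \<le> t)"
  have 1: "(1/2) ^ m \<le> t" unfolding m_def by (rule LeastI_ex[OF ex])
  have "t < 2 * (1/2) ^ m"
  proof (cases m)
    case 0 then show ?thesis using assms by simp
  next
    case (Suc k)
    then have "\<not> (1/2) ^ k \<le> t" using not_less_Least[of k "\<lambda>m. (1/2) ^ m \<le> t"] by (simp add: m_def)
    then show ?thesis using Suc by simp
  qed
  with 1 show ?thesis by blast
qed

lemma dyadic_bracket_large:
  fixes t :: real
  assumes "0 \<le> t"
  shows "\<exists>m. t < 2 ^ m \<and> (m = 0 \<or> 2 ^ m \<le> 2 * t)"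
proof -
  have ex: "\<exists>m. t < 2 ^ m" using real_arch_pow[of 2 t] by auto
  define m where "m = (LEAST m. t < 2 ^ m)"
  have 1: "t < 2 ^ m" unfolding m_def by (rule LeastI_ex[OF ex])
  have "m = 0 \<or> 2 ^ m \<le> 2 * t"
  proof (cases m)
    case (Suc k)
    then have "\<not> t < 2 ^ k" using not_less_Least[of k "\<lambda>m. t < 2 ^ m"] by (simp add: m_def)
    then show ?thesis using Suc by simp
  qed auto
  with 1 show ?thesis by blast
qed

text \<open>On the layer where \<open>norm w\<close> lies between \<open>R * (1/2) ^ m / 2\<close>
  and \<open>R * (1/2) ^ m\<close> the integrand is at most \<open>2 / R * 2 ^ m\<close>; multiplied
  by the area this leaves a series of ratio 1/2.\<close>

lemma integrable_inverse_norm_ball: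
  assumes "R > 0"
  shows "integrable lborel (\<lambda>w::complex. indicator (ball 0 R) w / norm w)"
proof (rule integrable_dyadic_layers[where a="\<lambda>m. 2 / R * 2 ^ m" and \<rho>="\<lambda>m. R * (1/2) ^ m"])
  show "(\<lambda>w::complex. indicator (ball 0 R) w / norm w) \<in> borel_measurable borel"
    by (intro borel_measurable_divide borel_measurable_indicator) auto
  have "(\<lambda>m. (2 / R * 2 ^ m) * (R * (1/2) ^ m)\<^sup>2) = (\<lambda>m. 2 * R * (1/2::real) ^ m)"
    using assms by (intro ext) (simp add: power2_eq_square power_divide field_simps)
  then show "summable (\<lambda>m. (2 / R * 2 ^ m) * (R * (1/2) ^ m)\<^sup>2 :: real)"
    by (simp add: summable_mult summable_geometric)
  fix w :: complex assume w: "w \<noteq> 0" "indicator (ball 0 R) w / norm w \<noteq> 0"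
  then have w2: "norm w < R" by (auto simp: indicator_def split: if_splits)
  have "0 < 2 * norm w / R" "2 * norm w / R < 2" using w w2 assms by (auto simp: field_simps)
  then obtain m where m: "(1/2) ^ m \<le> 2 * norm w / R" "2 * norm w / R < 2 * (1/2) ^ m"
    using dyadic_bracket by blast
  have "norm w < R * (1/2) ^ m" using m(2) assms by (simp add: field_simps)
  moreover have "indicator (ball 0 R) w / norm w \<le> 2 / R * 2 ^ m"
    using m(1) w w2 assms by (simp add: field_simps power_divide)
  ultimately show "\<exists>m. indicator (ball 0 R) w / norm w \<le> 2 / R * 2 ^ m \<and> norm w < R * (1/2) ^ m" by blast
qed (use assms in auto)

text \<open>The integrand decays like the inverse fourth power of the norm, which beats the
  quadratic growth of the area. Its integral will be the mass of the regularized delta function in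
  the Cauchy-Pompeiu formula.\<close>

lemma integrable_poisson_square:
  "integrable lborel (\<lambda>w::complex. 1 / (1 + (norm w)\<^sup>2)\<^sup>2)"
\<comment> \<open>The factor 16 absorbs the loss in \<open>2 ^ m \<le> 2 * norm w\<close>; it also
  covers the layer \<open>m = 0\<close>, where the integrand is at most 1.\<close>
proof (rule integrable_dyadic_layers[where a="\<lambda>m. 16 * (1/16) ^ m" and \<rho>="\<lambda>m. 2 ^ m"])
  show "(\<lambda>w::complex. 1 / (1 + (norm w)\<^sup>2)\<^sup>2) \<in> borel_measurable borel" by measurable
  have "(\<lambda>m. ((16::real) * (1/16) ^ m) * (2 ^ m)\<^sup>2) = (\<lambda>m. 16 * (1/4) ^ m)"
  proof
    fix m :: nat
    have "(1/16::real) ^ m * (2 ^ m)\<^sup>2 = (1/16 * 2\<^sup>2) ^ m"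
      unfolding power_mult_distrib power2_eq_square by simp
    then show "((16::real) * (1/16) ^ m) * (2 ^ m)\<^sup>2 = 16 * (1/4) ^ m" by simp
  qed
  then show "summable (\<lambda>m. (16 * (1/16) ^ m) * (2 ^ m)\<^sup>2 :: real)"
    by (simp add: summable_mult summable_geometric)
  fix w :: complex
  obtain m where m: "norm w < 2 ^ m" "m = 0 \<or> 2 ^ m \<le> 2 * norm w"
    using dyadic_bracket_large[of "norm w"] by auto
  have "1 / (1 + (norm w)\<^sup>2)\<^sup>2 \<le> 16 * (1/16) ^ m"
  proof (cases "m = 0")
    case True
    have "1 / (1 + (norm w)\<^sup>2)\<^sup>2 \<le> 1"
      by (simp add: divide_le_eq_1 one_le_power)
    then show ?thesis using True by simp
  next
    case False
    then have "(2 ^ m)\<^sup>2 \<le> (2 * norm w)\<^sup>2" using m by (intro power_mono) auto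
    then have "((2 ^ m)\<^sup>2)\<^sup>2 \<le> (4 * (1 + (norm w)\<^sup>2))\<^sup>2"
      by (intro power_mono) (auto simp: power_mult_distrib)
    moreover have "((2 ^ m)\<^sup>2)\<^sup>2 = (16::real) ^ m"
      using power_mult_distrib[of "2::real" 2 m] power_mult_distrib[of "4::real" 4 m]
      by (simp add: power2_eq_square)
    ultimately have le: "16 ^ m \<le> 4\<^sup>2 * (1 + (norm w)\<^sup>2)\<^sup>2"
      unfolding power_mult_distrib by metis
    have "(1 + (norm w)\<^sup>2)\<^sup>2 > 0"
      using zero_le_power2[of "norm w"] by (smt (verit) zero_less_power)
    then show ?thesis using le by (simp add: power_divide field_simps)
  qed
  with m show "\<exists>m. 1 / (1 + (norm w)\<^sup>2)\<^sup>2 \<le> 16 * (1/16) ^ m \<and> norm w < 2 ^ m" by blast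
qed auto


text \<open>The exact value of this constant (it is \<open>\<pi>\<close>) is irrelevant.\<close>

definition cauchy_mass :: real where
  "cauchy_mass = (\<integral>w. 1 / (1 + (norm w)\<^sup>2)\<^sup>2 \<partial>(lborel :: complex measure))"

lemma cauchy_mass_pos: "cauchy_mass > 0"
proof -
  have pos: "1 / (1 + (norm w)\<^sup>2)\<^sup>2 > 0" for w :: complex
    using zero_le_power2[of "norm w"] by (smt (verit) divide_pos_pos zero_less_power)
  have "cauchy_mass \<noteq> 0"
  proof
    assume "cauchy_mass = 0"
    then have "AE w in (lborel :: complex measure). 1 / (1 + (norm w)\<^sup>2)\<^sup>2 = 0"
      unfolding cauchy_mass_def
      by (subst (asm) integral_nonneg_eq_0_iff_AE) (use integrable_poisson_square in auto)
    then have "AE w in (lborel :: complex measure). False"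
      by eventually_elim (use pos in \<open>metis less_irrefl\<close>)
    then show False
      by (simp add: AE_iff_null null_sets_def)
  qed
  moreover have "cauchy_mass \<ge> 0" unfolding cauchy_mass_def by simp
  ultimately show ?thesis by simp
qed

section \<open>The \<open>dbar\<close> operator in one variable\<close>

definition dbar1 :: "(complex \<Rightarrow> complex) \<Rightarrow> complex \<Rightarrow> complex" where
  "dbar1 \<gamma> w = (frechet_derivative \<gamma> (at w) 1 + \<i> * frechet_derivative \<gamma> (at w) \<i>) / 2"

lemma dbar1_continuous: "C1c \<gamma> \<Longrightarrow> continuous_on S (dbar1 \<gamma>)"
  unfolding dbar1_def by (intro continuous_intros C1c_continuous_frechet) auto

lemma dbar1_support: "C1c \<gamma> \<Longrightarrow> bounded {w. dbar1 \<gamma> w \<noteq> 0}"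
  by (rule bounded_subset[OF bounded_Un[THEN iffD2, OF conjI[OF C1c_bounded_frechet_support[of \<gamma> 1] C1c_bounded_frechet_support[of \<gamma> \<i>]]]])
    (auto simp: dbar1_def)

lemma integral_dbar1_eq_0: "C1c g \<Longrightarrow> (LBINT w. dbar1 g w) = 0"
  unfolding dbar1_def
  using integral_frechet_derivative_eq_0[of g] C1c_integrable_frechet[of g] by simp

text \<open>\<open>E\<close> is a C1 regularization of
  \<open>1 / w = cnj w / (norm w)\<^sup>2\<close>. Its \<open>dbar\<close> is an approximate
  identity: rescaling by \<open>\<epsilon>\<close> turns it into the fixed density whose integral is
  \<open>cauchy_mass\<close>.\<close>

lemma regularized_kernel:
  fixes \<epsilon> :: real
  assumes "\<epsilon> > 0"
  defines "E \<equiv> \<lambda>w::complex. cnj w / of_real ((norm w)\<^sup>2 + \<epsilon>\<^sup>2)"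
  shows "C1_on UNIV E" and "dbar1 E w = of_real (\<epsilon>\<^sup>2 / ((norm w)\<^sup>2 + \<epsilon>\<^sup>2)\<^sup>2)"
proof -
  define N where "N w = (norm w)\<^sup>2 + \<epsilon>\<^sup>2" for w :: complex
  have N: "N w > 0" for w using assms(1) by (simp add: N_def add_nonneg_pos)
  then have N0: "N w \<noteq> 0" for w by (metis less_irrefl)
  define D where "D w v = cnj v / of_real (N w) - cnj w * of_real (2 * (w \<bullet> v) / (N w)\<^sup>2)" for w v
  have dN: "(N has_derivative (\<lambda>v. 2 * (w \<bullet> v))) (at w)" for w
    unfolding N_def power2_norm_eq_inner
    by (auto intro!: derivative_eq_intros simp: inner_commute)
  have dI: "((\<lambda>w. inverse (N w)) has_derivative (\<lambda>v. - (2 * (w \<bullet> v) / (N w)\<^sup>2))) (at w)" for w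
    by (rule has_derivative_eq_rhs[OF Deriv.has_derivative_inverse[OF N0 dN]])
      (auto simp: power2_eq_square field_simps)
  have E: "E = (\<lambda>w. cnj w * of_real (inverse (N w)))"
    by (auto simp: E_def N_def divide_inverse)
  have dE: "(E has_derivative D w) (at w)" for w
    unfolding E D_def
    by (rule has_derivative_eq_rhs[OF has_derivative_mult[OF bounded_linear_imp_has_derivative[OF bounded_linear_cnj]
        bounded_linear.has_derivative[OF bounded_linear_of_real dI]]])
      (auto simp: divide_inverse algebra_simps)
  show "C1_on UNIV E"
  proof (rule C1_onI[OF dE])
    have "continuous_on UNIV N" unfolding N_def by (intro continuous_intros)
    then show "continuous_on UNIV (\<lambda>w. D w v)" for v
      unfolding D_def by (intro continuous_intros) (use N0 in auto)
  qed
  have fr: "frechet_derivative E (at w) = D w" using frechet_derivative_at[OF dE] by simp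
  have cw: "cnj w * (of_real (Re w) + \<i> * of_real (Im w)) = of_real ((norm w)\<^sup>2)"
    by (metis complex_eq complex_norm_square mult.commute)
  have "dbar1 E w = 1 / of_real (N w) - cnj w * (of_real (Re w) + \<i> * of_real (Im w)) / of_real ((N w)\<^sup>2)"
    unfolding dbar1_def fr D_def by (simp add: inner_complex_def field_simps add_divide_distrib)
  also have "\<dots> = of_real (1 / N w - (norm w)\<^sup>2 / (N w)\<^sup>2)"
    unfolding cw by simp
  also have "1 / N w - (norm w)\<^sup>2 / (N w)\<^sup>2 = \<epsilon>\<^sup>2 / (N w)\<^sup>2"
    using N0[of w] by (simp add: field_simps power2_eq_square) (simp add: N_def algebra_simps power2_eq_square)
  finally show "dbar1 E w = of_real (\<epsilon>\<^sup>2 / ((norm w)\<^sup>2 + \<epsilon>\<^sup>2)\<^sup>2)"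
    by (simp add: N_def)
qed

lemma dbar1_mult:
  assumes "C1_on UNIV E" "C1_on UNIV \<gamma>"
  shows "dbar1 (\<lambda>w. E w * \<gamma> w) w = E w * dbar1 \<gamma> w + dbar1 E w * \<gamma> w"
proof -
  have "frechet_derivative (\<lambda>w. E w * \<gamma> w) (at w) =
     (\<lambda>v. E w * frechet_derivative \<gamma> (at w) v + frechet_derivative E (at w) v * \<gamma> w)"
    using frechet_derivative_at[OF has_derivative_mult[OF C1_on_has_derivative[OF assms(1)] C1_on_has_derivative[OF assms(2)]]]
    by auto
  then show ?thesis by (simp add: dbar1_def field_simps)
qed

text \<open>The \<open>dbar\<close> of the product of \<open>E n\<close> and \<open>\<gamma>\<close>
  has integral 0, so by the product rule the derivative moves from \<open>\<gamma>\<close> to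
  \<open>E n\<close> at the cost of a sign. Dominated convergence then applies to both sides. The
  value of the integrand at \<open>w = 0\<close> concerns a null set only.\<close>

lemma cauchy_pompeiu:
  assumes \<gamma>: "C1c \<gamma>"
  shows "(LBINT w. dbar1 \<gamma> w / w) = - of_real cauchy_mass * \<gamma> 0"
proof -
  define \<epsilon> where "\<epsilon> n = 1 / real (Suc n)" for n
  have \<epsilon>: "\<epsilon> n > 0" for n by (simp add: \<epsilon>_def)
  have \<epsilon>0: "\<epsilon> \<longlonglongrightarrow> 0" unfolding \<epsilon>_def by (rule LIMSEQ_Suc[OF lim_1_over_n])
  define E where "E n w = cnj w / of_real ((norm w)\<^sup>2 + (\<epsilon> n)\<^sup>2)" for n and w :: complex
  define P where "P w = 1 / (1 + (norm w)\<^sup>2)\<^sup>2" for w :: complex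
  have EC: "C1_on UNIV (E n)" for n
    using regularized_kernel(1)[OF \<epsilon>[of n]] unfolding E_def .
  have Ed: "dbar1 (E n) w = of_real ((\<epsilon> n)\<^sup>2 / ((norm w)\<^sup>2 + (\<epsilon> n)\<^sup>2)\<^sup>2)" for n w
    using regularized_kernel(2)[OF \<epsilon>[of n]] unfolding E_def .
  have \<gamma>c: "continuous_on S \<gamma>" for S using C1c_continuous[OF \<gamma>] .
  have \<gamma>1: "C1_on UNIV \<gamma>" and \<gamma>b: "bounded {w. \<gamma> w \<noteq> 0}" using \<gamma> by (auto simp: C1c_def)
  have nz: "(norm w)\<^sup>2 + (\<epsilon> n)\<^sup>2 > 0" for w :: complex and n
    using \<epsilon>[of n] by (simp add: add_nonneg_pos)
  have key: "(LBINT w. E n w * dbar1 \<gamma> w) = - (LBINT w. of_real (P w) * \<gamma> (\<epsilon> n *\<^sub>R w))" for n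
  proof -
    have dEc: "continuous_on UNIV (dbar1 (E n))"
      unfolding Ed by (intro continuous_intros ballI power_not_zero) (use nz[of _ n] in \<open>metis less_irrefl\<close>)
    have i1: "integrable lborel (\<lambda>w. E n w * dbar1 \<gamma> w)"
      by (rule integrable_continuous_bounded_support)
        (auto intro!: continuous_on_mult C1_on_continuous_on[OF EC] dbar1_continuous \<gamma> bounded_subset[OF dbar1_support[OF \<gamma>]])
    have i2: "integrable lborel (\<lambda>w. dbar1 (E n) w * \<gamma> w)"
      by (rule integrable_continuous_bounded_support)
        (auto intro!: continuous_intros dEc \<gamma>c bounded_subset[OF \<gamma>b])
    have "0 = (LBINT w. dbar1 (\<lambda>w. E n w * \<gamma> w) w)"
      using integral_dbar1_eq_0[OF C1c_mult[OF \<gamma> EC]] by simp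
    also have "\<dots> = (LBINT w. E n w * dbar1 \<gamma> w) + (LBINT w. dbar1 (E n) w * \<gamma> w)"
      unfolding dbar1_mult[OF EC \<gamma>1] using i1 i2 by simp
    finally have 1: "(LBINT w. E n w * dbar1 \<gamma> w) = - (LBINT w. dbar1 (E n) w * \<gamma> w)"
      by (simp add: eq_neg_iff_add_eq_0)
    \<comment> \<open>The substitution by the factor \<open>\<epsilon> n\<close> transfers the
      concentration from the weight to the argument of \<open>\<gamma>\<close>; the Jacobian is
      \<open>(\<epsilon> n)\<^sup>2\<close> because the plane has real dimension 2.\<close>
    have "(LBINT w. dbar1 (E n) w * \<gamma> w) =
      \<bar>\<epsilon> n\<bar> ^ DIM(complex) *\<^sub>R (LBINT w. dbar1 (E n) (\<epsilon> n *\<^sub>R w) * \<gamma> (\<epsilon> n *\<^sub>R w))"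
      by (rule lborel_integral_scale) (use i2 \<epsilon>[of n] in auto)
    also have "\<dots> = (LBINT w. (\<epsilon> n)\<^sup>2 *\<^sub>R (dbar1 (E n) (\<epsilon> n *\<^sub>R w) * \<gamma> (\<epsilon> n *\<^sub>R w)))"
      by simp
    also have "\<dots> = (LBINT w. of_real (P w) * \<gamma> (\<epsilon> n *\<^sub>R w))"
    proof (rule Bochner_Integration.integral_cong[OF refl])
      fix w :: complex
      have "(norm (\<epsilon> n *\<^sub>R w))\<^sup>2 + (\<epsilon> n)\<^sup>2 = (\<epsilon> n)\<^sup>2 * (1 + (norm w)\<^sup>2)"
        by (simp add: power_mult_distrib algebra_simps)
      then have "(\<epsilon> n)\<^sup>2 * ((\<epsilon> n)\<^sup>2 / ((norm (\<epsilon> n *\<^sub>R w))\<^sup>2 + (\<epsilon> n)\<^sup>2)\<^sup>2) = P w"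
        using \<epsilon>[of n] by (simp add: P_def power_mult_distrib power2_eq_square)
      then show "(\<epsilon> n)\<^sup>2 *\<^sub>R (dbar1 (E n) (\<epsilon> n *\<^sub>R w) * \<gamma> (\<epsilon> n *\<^sub>R w)) = of_real (P w) * \<gamma> (\<epsilon> n *\<^sub>R w)"
        unfolding Ed by (metis (no_types, lifting) mult_scaleR_left of_real_def scaleR_scaleR)
    qed
    finally show ?thesis using 1 by simp
  qed
  obtain B where B: "B > 0" "\<And>w. norm (\<gamma> w) \<le> B"
    using continuous_bounded_support_bound[OF \<gamma>c \<gamma>b] by auto
  obtain B' where B': "B' > 0" "\<And>w. norm (dbar1 \<gamma> w) \<le> B'"
    using continuous_bounded_support_bound[OF dbar1_continuous[OF \<gamma>] dbar1_support[OF \<gamma>]] by auto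
  obtain R where R: "R > 0" "\<And>w. dbar1 \<gamma> w \<noteq> 0 \<Longrightarrow> norm w \<le> R"
    using dbar1_support[OF \<gamma>] unfolding bounded_pos by auto
  have P_int: "integrable lborel P" using integrable_poisson_square unfolding P_def .
  have P0: "P w \<ge> 0" for w by (simp add: P_def)
  have \<gamma>m: "(\<lambda>w. \<gamma> (c *\<^sub>R w)) \<in> borel_measurable borel" for c
    by (intro borel_measurable_continuous_onI continuous_on_compose2[OF \<gamma>c] continuous_intros) auto
  have L1: "(\<lambda>n. LBINT w. of_real (P w) * \<gamma> (\<epsilon> n *\<^sub>R w)) \<longlonglongrightarrow> (LBINT w. of_real (P w) * \<gamma> 0)"
  proof (rule integral_dominated_convergence[where w="\<lambda>w. P w * B"])
    show "(\<lambda>w. complex_of_real (P w) * \<gamma> 0) \<in> borel_measurable lborel"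
      "(\<lambda>w. complex_of_real (P w) * \<gamma> (\<epsilon> n *\<^sub>R w)) \<in> borel_measurable lborel" for n
      using P_int \<gamma>m[of "\<epsilon> n"] by (auto intro!: borel_measurable_times borel_measurable_of_real)
    show "integrable lborel (\<lambda>w. P w * B)" using P_int by auto
    have "isCont \<gamma> 0" using \<gamma>c[of UNIV] by (simp add: continuous_on_eq_continuous_at)
    moreover have "(\<lambda>n. \<epsilon> n *\<^sub>R w) \<longlonglongrightarrow> 0" for w :: complex
      using tendsto_scaleR[OF \<epsilon>0 tendsto_const[of w]] by simp
    ultimately show "AE w in lborel. (\<lambda>n. of_real (P w) * \<gamma> (\<epsilon> n *\<^sub>R w)) \<longlonglongrightarrow> of_real (P w) * \<gamma> 0"
      by (intro AE_I2 tendsto_mult tendsto_const isCont_tendsto_compose[where g=\<gamma>])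
    show "AE w in lborel. norm (of_real (P w) * \<gamma> (\<epsilon> n *\<^sub>R w)) \<le> P w * B" for n
      using B P0 by (intro AE_I2) (auto simp: norm_mult intro!: mult_left_mono)
  qed
  have dm: "dbar1 \<gamma> \<in> borel_measurable borel"
    by (intro borel_measurable_continuous_onI dbar1_continuous \<gamma>)
  have L2: "(\<lambda>n. LBINT w. E n w * dbar1 \<gamma> w) \<longlonglongrightarrow> (LBINT w. dbar1 \<gamma> w / w)"
  \<comment> \<open>The domination comes from \<open>norm (E n w) \<le> 1 / norm w\<close> for all
    \<open>n\<close>. The radius is \<open>R + 1\<close> because the ball is open while the support
    may reach \<open>norm w = R\<close>.\<close>
  proof (rule integral_dominated_convergence[where w="\<lambda>w. B' * (indicator (ball 0 (R + 1)) w / norm w)"])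
    show "(\<lambda>w. dbar1 \<gamma> w / w) \<in> borel_measurable lborel" using dm by auto
    show "(\<lambda>w. E n w * dbar1 \<gamma> w) \<in> borel_measurable lborel" for n
      using dm borel_measurable_continuous_onI[OF C1_on_continuous_on[OF EC[of n]]] by auto
    show "integrable lborel (\<lambda>w::complex. B' * (indicator (ball 0 (R + 1)) w / norm w))"
      using integrable_inverse_norm_ball[of "R + 1"] R(1) by (intro integrable_mult_right) auto
    have "AE w in lborel. w \<noteq> (0::complex)"
      by (rule AE_I[of _ _ "{0}"]) auto
    then show "AE w in lborel. (\<lambda>n. E n w * dbar1 \<gamma> w) \<longlonglongrightarrow> dbar1 \<gamma> w / w"
    proof eventually_elim
      fix w :: complex assume w: "w \<noteq> 0"
      have "(\<lambda>n. cnj w / of_real ((norm w)\<^sup>2 + (\<epsilon> n)\<^sup>2) * dbar1 \<gamma> w) \<longlonglongrightarrow> cnj w / of_real ((norm w)\<^sup>2 + 0\<^sup>2) * dbar1 \<gamma> w"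
        by (intro tendsto_intros \<epsilon>0) (use w in auto)
      also have "cnj w / of_real ((norm w)\<^sup>2 + 0\<^sup>2) = 1 / w"
        using w complex_norm_square[of w] by (simp add: field_simps)
      finally show "(\<lambda>n. E n w * dbar1 \<gamma> w) \<longlonglongrightarrow> dbar1 \<gamma> w / w"
        by (simp add: E_def)
    qed
    show "AE w in lborel. norm (E n w * dbar1 \<gamma> w) \<le> B' * (indicator (ball 0 (R + 1)) w / norm w)" for n
    proof (intro AE_I2)
      fix w :: complex
      show "norm (E n w * dbar1 \<gamma> w) \<le> B' * (indicator (ball 0 (R + 1)) w / norm w)"
      proof (cases "w = 0 \<or> dbar1 \<gamma> w = 0")
        case True then show ?thesis using B'(1) by (auto simp: E_def)
      next
        case False
        then have ind: "indicator (ball 0 (R+1)) w = (1::real)" using R(2)[of w] by simp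
        have "norm (E n w) = norm w / ((norm w)\<^sup>2 + (\<epsilon> n)\<^sup>2)"
          using nz[of w n] by (simp add: E_def norm_divide del: of_real_add of_real_power)
        also have "\<dots> \<le> norm w / (norm w)\<^sup>2" using False by (intro divide_left_mono) (auto simp: nz)
        also have "\<dots> = 1 / norm w" by (simp add: power2_eq_square)
        finally have "norm (E n w) * norm (dbar1 \<gamma> w) \<le> 1 / norm w * B'"
          by (intro mult_mono B') auto
        then show ?thesis unfolding ind by (simp add: norm_mult mult.commute)
      qed
    qed
  qed
  have "(\<lambda>n. LBINT w. E n w * dbar1 \<gamma> w) \<longlonglongrightarrow> - (LBINT w. of_real (P w) * \<gamma> 0)"
    unfolding key by (rule tendsto_minus[OF L1])
  then have "(LBINT w. dbar1 \<gamma> w / w) = - (LBINT w. of_real (P w) * \<gamma> 0)"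
    using L2 LIMSEQ_unique by blast
  also have "(LBINT w. of_real (P w) * \<gamma> 0) = of_real cauchy_mass * \<gamma> 0"
    unfolding cauchy_mass_def P_def[symmetric] by simp
  finally show ?thesis by simp
qed

subsection \<open>Convolution on \<open>L^r\<close>\<close>

lemma measurable_shift:
  fixes L :: "'b::euclidean_space \<Rightarrow> 'a::euclidean_space"
  assumes "linear L"
  shows "(\<lambda>(x, w). x - L w) \<in> borel_measurable (borel \<Otimes>\<^sub>M borel)"
    and "(\<lambda>(x, w). x + L w) \<in> borel_measurable (borel \<Otimes>\<^sub>M borel)"
proof -
  have "L \<in> borel_measurable borel"
    using assms linear_continuous_on linear_conv_bounded_linear borel_measurable_continuous_onI by blast
  note [measurable] = this
  show "(\<lambda>(x, w). x - L w) \<in> borel_measurable (borel \<Otimes>\<^sub>M borel)"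
    and "(\<lambda>(x, w). x + L w) \<in> borel_measurable (borel \<Otimes>\<^sub>M borel)"
    by measurable
qed

lemma measurable_shift_compose:
  fixes L :: "'b::euclidean_space \<Rightarrow> 'a::euclidean_space"
  assumes "linear L" "u \<in> borel_measurable borel"
  shows "(\<lambda>(x, w). u (x - L w)) \<in> borel_measurable (lborel \<Otimes>\<^sub>M lborel)"
    and "(\<lambda>(x, w). u (x + L w)) \<in> borel_measurable (lborel \<Otimes>\<^sub>M lborel)"
    and "(\<lambda>w. u (x - L w)) \<in> borel_measurable borel"
proof -
  have eq: "borel_measurable ((lborel::'a measure) \<Otimes>\<^sub>M (lborel::'b measure)) = borel_measurable (borel \<Otimes>\<^sub>M borel)"
    by (rule measurable_cong_sets) (auto intro: sets_pair_measure_cong)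
  show 1: "(\<lambda>(x, w). u (x - L w)) \<in> borel_measurable (lborel \<Otimes>\<^sub>M lborel)"
    and "(\<lambda>(x, w). u (x + L w)) \<in> borel_measurable (lborel \<Otimes>\<^sub>M lborel)"
    unfolding eq using measurable_compose[OF measurable_shift(1)[OF assms(1)] assms(2)]
      measurable_compose[OF measurable_shift(2)[OF assms(1)] assms(2)]
    by (simp_all add: case_prod_beta')
  show "(\<lambda>w. u (x - L w)) \<in> borel_measurable borel"
    using measurable_compose[OF measurable_Pair1'[of x lborel lborel] 1] by simp
qed

text \<open>Tonelli, followed by translation invariance in \<open>x\<close> for each fixed
  \<open>w\<close>; the range of \<open>L\<close> is therefore irrelevant, and \<open>axis j\<close>
  is as good as the identity.\<close>

lemma nn_integral_conv:
  fixes L :: "'b::euclidean_space \<Rightarrow> 'a::euclidean_space" and k h :: "_ \<Rightarrow> ennreal"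
  assumes "linear L" "k \<in> borel_measurable borel" "h \<in> borel_measurable borel"
  shows "(\<integral>\<^sup>+x. (\<integral>\<^sup>+w. k w * h (x - L w) \<partial>lborel) \<partial>lborel) = (\<integral>\<^sup>+w. k w \<partial>lborel) * (\<integral>\<^sup>+x. h x \<partial>lborel)"
proof -
  have m: "(\<lambda>(x, w). k w * h (x - L w)) \<in> borel_measurable (lborel \<Otimes>\<^sub>M lborel)"
  proof -
    have "(\<lambda>p. k (snd p)) \<in> borel_measurable (lborel \<Otimes>\<^sub>M lborel)"
      using assms(2) by measurable
    then show ?thesis
      using measurable_shift_compose(1)[OF assms(1,3)]
      by (auto simp: case_prod_beta' intro: borel_measurable_times_ennreal)
  qed
  have "(\<integral>\<^sup>+x. (\<integral>\<^sup>+w. k w * h (x - L w) \<partial>lborel) \<partial>lborel) = (\<integral>\<^sup>+w. (\<integral>\<^sup>+x. k w * h (x - L w) \<partial>lborel) \<partial>lborel)"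
    using lborel_pair.Fubini'[OF m] by simp
  also have "\<dots> = (\<integral>\<^sup>+w. k w * (\<integral>\<^sup>+x. h x \<partial>lborel) \<partial>lborel)"
  proof (rule nn_integral_cong)
    fix w
    have "(\<integral>\<^sup>+x. k w * h (x - L w) \<partial>lborel) = k w * (\<integral>\<^sup>+x. h (- L w + x) \<partial>lborel)"
      using assms(3) by (subst nn_integral_cmult) (auto simp: algebra_simps)
    then show "(\<integral>\<^sup>+x. k w * h (x - L w) \<partial>lborel) = k w * (\<integral>\<^sup>+x. h x \<partial>lborel)"
      using lborel_nn_integral_translate[OF assms(3), of "- L w"] by simp
  qed
  also have "\<dots> = (\<integral>\<^sup>+w. k w \<partial>lborel) * (\<integral>\<^sup>+x. h x \<partial>lborel)"
    using assms(2) by (subst nn_integral_multc) auto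
  finally show ?thesis .
qed

lemma conv_measurable:
  fixes L :: "'b::euclidean_space \<Rightarrow> 'a::euclidean_space"
  assumes "linear L" "\<kappa> \<in> borel_measurable borel" "u \<in> borel_measurable borel"
  shows "(\<lambda>(x, w). \<kappa> w * u (x - L w)) \<in> borel_measurable (lborel \<Otimes>\<^sub>M lborel)"
    and "conv \<kappa> L u \<in> borel_measurable borel"
proof -
  have "(\<lambda>p. \<kappa> (snd p)) \<in> borel_measurable (lborel \<Otimes>\<^sub>M lborel)"
    using assms(2) by measurable
  then show 1: "(\<lambda>(x, w). \<kappa> w * u (x - L w)) \<in> borel_measurable (lborel \<Otimes>\<^sub>M lborel)"
    using measurable_shift_compose(1)[OF assms(1,3)]
    by (auto simp: case_prod_beta' intro: borel_measurable_times)
  have "(\<lambda>x. LBINT w. \<kappa> w * u (x - L w)) \<in> borel_measurable lborel"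
    by (rule lborel.borel_measurable_lebesgue_integral[OF 1])
  then show "conv \<kappa> L u \<in> borel_measurable borel"
    by (simp add: conv_def[abs_def])
qed

lemma conv_pair_integrable:
  fixes L :: "'b::euclidean_space \<Rightarrow> 'a::euclidean_space"
  assumes "linear L" "integrable lborel \<kappa>" "integrable lborel u"
  shows "integrable (lborel \<Otimes>\<^sub>M lborel) (\<lambda>(x, w). \<kappa> w * u (x - L w) :: complex)"
proof (rule integrableI_bounded)
  have \<kappa>: "\<kappa> \<in> borel_measurable borel" and u: "u \<in> borel_measurable borel" using assms by auto
  note m = conv_measurable(1)[OF assms(1) \<kappa> u]
  show "(\<lambda>(x, w). \<kappa> w * u (x - L w)) \<in> borel_measurable (lborel \<Otimes>\<^sub>M lborel)" by (rule m)
  have "(\<lambda>p. ennreal (norm (case p of (x, w) \<Rightarrow> \<kappa> w * u (x - L w)))) \<in> borel_measurable (lborel \<Otimes>\<^sub>M lborel)"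
    using m by measurable
  then have "(\<integral>\<^sup>+p. ennreal (norm (case p of (x, w) \<Rightarrow> \<kappa> w * u (x - L w))) \<partial>(lborel \<Otimes>\<^sub>M lborel)) =
    (\<integral>\<^sup>+x. (\<integral>\<^sup>+w. ennreal (norm (\<kappa> w * u (x - L w))) \<partial>lborel) \<partial>lborel)"
    by (subst lborel.nn_integral_fst[symmetric]) auto
  also have "\<dots> = (\<integral>\<^sup>+x. (\<integral>\<^sup>+w. ennreal (norm (\<kappa> w)) * ennreal (norm (u (x - L w))) \<partial>lborel) \<partial>lborel)"
    by (simp add: norm_mult ennreal_mult)
  also have "\<dots> = (\<integral>\<^sup>+w. ennreal (norm (\<kappa> w)) \<partial>lborel) * (\<integral>\<^sup>+x. ennreal (norm (u x)) \<partial>lborel)"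
    by (rule nn_integral_conv[OF assms(1)]) (use \<kappa> u in auto)
  also have "\<dots> < \<infinity>"
    using assms(2,3) by (auto simp: integrable_iff_bounded ennreal_mult_less_top)
  finally show "(\<integral>\<^sup>+p. ennreal (norm (case p of (x, w) \<Rightarrow> \<kappa> w * u (x - L w))) \<partial>(lborel \<Otimes>\<^sub>M lborel)) < \<infinity>" .
qed

text \<open>Fubini and the translation by \<open>L w\<close> move the kernel to
  \<open>\<phi>\<close> in reflected form; oddness turns the reflection into the minus sign.\<close>

lemma conv_transpose:
  fixes L :: "'b::euclidean_space \<Rightarrow> 'a::euclidean_space"
  assumes L: "linear L" and \<kappa>: "integrable lborel \<kappa>" and u: "integrable lborel u"
    and \<phi>: "\<phi> \<in> borel_measurable borel" "\<And>x. norm (\<phi> x) \<le> B" and odd: "\<And>w. \<kappa> (- w) = - \<kappa> w"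
  shows "(LBINT x. conv \<kappa> L u x * \<phi> x) = - (LBINT x. u x * conv \<kappa> L \<phi> x)"
proof -
  have \<kappa>m: "\<kappa> \<in> borel_measurable borel" and um: "u \<in> borel_measurable borel" using \<kappa> u by auto
  have B: "B \<ge> 0" using \<phi>(2)[of 0] norm_ge_zero order_trans by blast
  let ?A = "\<lambda>x w. \<kappa> w * u (x - L w) * \<phi> x"
  let ?C = "\<lambda>x w. \<kappa> w * u x * \<phi> (x + L w)"
  have mfst: "(\<lambda>p. \<phi> (fst p)) \<in> borel_measurable ((lborel::'a measure) \<Otimes>\<^sub>M (lborel::'b measure))"
    using \<phi>(1) by measurable
  have iA: "integrable (lborel \<Otimes>\<^sub>M lborel) (case_prod ?A)"
  proof (rule Bochner_Integration.integrable_bound[OF integrable_mult_right[OF conv_pair_integrable[OF L \<kappa> u], of "of_real B"]])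
    show "case_prod ?A \<in> borel_measurable (lborel \<Otimes>\<^sub>M lborel)"
      using borel_measurable_times[OF conv_measurable(1)[OF L \<kappa>m um] mfst] by (simp add: case_prod_beta')
    show "AE p in lborel \<Otimes>\<^sub>M lborel. norm (case_prod ?A p) \<le> norm (of_real B * (case p of (x, w) \<Rightarrow> \<kappa> w * u (x - L w)))"
      using \<phi>(2) B by (intro AE_I2) (auto simp: norm_mult mult.commute intro!: mult_right_mono split: prod.split)
  qed
  \<comment> \<open>With the zero map in place of \<open>L\<close>,
    \<open>conv_pair_integrable\<close> yields joint integrability of
    \<open>\<kappa> w * u x\<close>.\<close>
  have L0: "linear (\<lambda>w::'b. 0::'a)" by (rule linear_zero)
  have iC: "integrable (lborel \<Otimes>\<^sub>M lborel) (case_prod ?C)"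
  proof (rule Bochner_Integration.integrable_bound[OF integrable_mult_right[OF conv_pair_integrable[OF L0 \<kappa> u], of "of_real B"]])
    show "case_prod ?C \<in> borel_measurable (lborel \<Otimes>\<^sub>M lborel)"
      using borel_measurable_times[OF conv_measurable(1)[OF L0 \<kappa>m um] measurable_shift_compose(2)[OF L \<phi>(1)]] by (simp add: case_prod_beta')
    show "AE p in lborel \<Otimes>\<^sub>M lborel. norm (case_prod ?C p) \<le> norm (of_real B * (case p of (x, w) \<Rightarrow> \<kappa> w * u (x - 0)))"
      using \<phi>(2) B by (intro AE_I2) (auto simp: norm_mult mult.commute intro!: mult_right_mono split: prod.split)
  qed
  have inner: "(LBINT w. ?C x w) = - (u x * conv \<kappa> L \<phi> x)" for x
  proof -
    have mw: "(\<lambda>w. \<kappa> w * \<phi> (x + L w)) \<in> borel_measurable borel"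
    proof -
      have "(\<lambda>w. \<phi> (x + L w)) \<in> borel_measurable borel"
        using measurable_compose[OF measurable_Pair1'[of x lborel lborel] measurable_shift_compose(2)[OF L \<phi>(1)]] by simp
      then show ?thesis using \<kappa>m by auto
    qed
    have "(LBINT w. ?C x w) = u x * (LBINT w. \<kappa> w * \<phi> (x + L w))"
      by (subst integral_mult_right_zero[symmetric]) (simp add: mult_ac)
    also have "(LBINT w. \<kappa> w * \<phi> (x + L w)) = (LBINT w. \<kappa> (-w) * \<phi> (x + L (-w)))"
      using lborel_integral_scale[OF mw, of "-1"] by simp
    also have "\<dots> = - conv \<kappa> L \<phi> x"
      unfolding conv_def odd by (simp add: linear_neg[OF L])
    finally show ?thesis by simp
  qed
  have "(LBINT x. conv \<kappa> L u x * \<phi> x) = (LBINT x. (LBINT w. ?A x w))"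
    by (simp add: conv_def)
  also have "\<dots> = (LBINT w. (LBINT x. ?A x w))"
    using lborel_pair.Fubini_integral[OF iA] by simp
  also have "\<dots> = (LBINT w. (LBINT x. ?C x w))"
  proof (rule Bochner_Integration.integral_cong[OF refl])
    fix w
    have "(\<lambda>x. ?A x w) \<in> borel_measurable borel" using um \<phi>(1) by measurable
    from lborel_integral_translate[OF this, of "L w"]
    show "(LBINT x. ?A x w) = (LBINT x. ?C x w)" by (simp add: add.commute)
  qed
  also have "\<dots> = (LBINT x. (LBINT w. ?C x w))"
    using lborel_pair.Fubini_integral[OF iC] by simp
  also have "\<dots> = - (LBINT x. u x * conv \<kappa> L \<phi> x)"
    unfolding inner by simp
  finally show ?thesis .
qed

section \<open>Young's inequality with an integrable kernel, and operations on L^r\<close>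

lemma Lr_fun_borel_iff:
  assumes "u \<in> borel_measurable borel"
  shows "u \<in> Lr_fun r \<longleftrightarrow> (if r = \<infinity> then \<exists>C. AE x in lborel. norm (u x) \<le> C
      else (\<integral>\<^sup>+ x. ennreal (norm (u x) powr enn2real r) \<partial>lborel) < \<infinity>)"
proof -
  have "u \<in> borel_measurable lebesgue" using measurable_completion[of u lborel borel] assms by simp
  then show ?thesis
    unfolding Lr_fun_def mem_Collect_eq AE_completion_iff nn_integral_completion by simp
qed

text \<open>The graph of the convex function \<open>t powr p\<close> lies above its tangent at
  \<open>m\<close>. After scaling to \<open>m = 1\<close> this is the weighted inequality between
  arithmetic and geometric mean, with weights \<open>1/p\<close> and \<open>1 - 1/p\<close>, for the
  numbers \<open>s powr p\<close> and 1.\<close>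

lemma powr_tangent_le:
  fixes t m p :: real
  assumes "p \<ge> 1" "t \<ge> 0" "m > 0"
  shows "m powr p + p * m powr (p - 1) * (t - m) \<le> t powr p"
proof -
  define s where "s = t / m"
  have s: "s \<ge> 0" "t = s * m" using assms by (auto simp: s_def)
  have "1 + p * (s - 1) \<le> s powr p"
  proof (cases "s = 0")
    case True then show ?thesis using assms by simp
  next
    case False
    have "(s powr p) powr (1/p) * 1 powr (1 - 1/p) \<le> (1/p) * s powr p + (1 - 1/p) * 1"
      by (rule Youngs_inequality_0) (use assms False in auto)
    moreover have "(s powr p) powr (1/p) = s" using s(1) assms(1) by (simp add: powr_powr)
    ultimately have "p * s \<le> p * ((1/p) * s powr p + (1 - 1/p))" using assms(1) by simp
    also have "\<dots> = s powr p + p - 1" using assms(1) by (simp add: field_simps)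
    finally show ?thesis by (simp add: algebra_simps)
  qed
  then have "m powr p * (1 + p * (s - 1)) \<le> m powr p * s powr p" by (intro mult_left_mono) auto
  also have "\<dots> = t powr p" using s assms by (simp add: powr_mult mult.commute)
  also have "m powr p * (1 + p * (s - 1)) = m powr p + p * m powr (p - 1) * (t - m)"
    using assms(3) powr_add[of m "p - 1" 1] by (simp add: s_def field_simps)
  finally show ?thesis .
qed

text \<open>Jensen's inequality for the weight \<open>norm (\<kappa> w)\<close>, obtained by
  integrating the tangent inequality at the point \<open>m\<close>. \<open>M\<close> is one larger
  than the total weight so that it never vanishes.\<close>

lemma conv_powr_le:
  fixes L :: "'b::euclidean_space \<Rightarrow> 'a::euclidean_space"
  assumes L: "linear L" and \<kappa>: "integrable lborel \<kappa>" and u: "u \<in> borel_measurable borel" and p: "p \<ge> 1"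
  defines "M \<equiv> (LBINT w. norm (\<kappa> w)) + 1"
  shows "ennreal (norm (conv \<kappa> L u x) powr p)
     \<le> ennreal (M powr p / M) * (\<integral>\<^sup>+w. ennreal (norm (\<kappa> w)) * ennreal (norm (u (x - L w)) powr p) \<partial>lborel)"
proof (cases "integrable lborel (\<lambda>w. \<kappa> w * u (x - L w))")
  case False
  \<comment> \<open>The Bochner integral of a non-integrable function is 0 by convention, so the
    left side vanishes.\<close>
  then show ?thesis by (simp add: conv_def not_integrable_integral_eq)
next
  case int: True
  have M: "M \<ge> 1" unfolding M_def by simp
  define t where "t w = norm (u (x - L w))" for w
  have \<kappa>m: "\<kappa> \<in> borel_measurable borel" using \<kappa> by auto
  have tm: "t \<in> borel_measurable borel"
    unfolding t_def[abs_def] using measurable_shift_compose(3)[OF L u] by measurable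
  have i1: "integrable lborel (\<lambda>w. norm (\<kappa> w) * t w)"
    using integrable_norm[OF int] by (simp add: norm_mult t_def)
  define m where "m = (LBINT w. norm (\<kappa> w) * t w) / M"
  have m: "m \<ge> 0" "(LBINT w. norm (\<kappa> w) * t w) = M * m"
    using M by (auto simp: m_def t_def intro!: divide_nonneg_nonneg Bochner_Integration.integral_nonneg)
  have conv: "norm (conv \<kappa> L u x) \<le> M * m"
    unfolding conv_def m(2)[symmetric] t_def norm_mult[symmetric] by (rule integral_norm_bound)
  let ?I = "\<integral>\<^sup>+w. ennreal (norm (\<kappa> w)) * ennreal (t w powr p) \<partial>lborel"
  show ?thesis
  proof (cases "?I = \<infinity>")
    case True
    then show ?thesis using M by (simp add: t_def[symmetric] ennreal_mult_top)
  next
    case False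
    have i2: "integrable lborel (\<lambda>w. norm (\<kappa> w) * t w powr p)"
      using False \<kappa>m tm
      by (intro integrableI_bounded) (auto simp: ennreal_mult less_top abs_mult)
    have Ieq: "?I = ennreal (LBINT w. norm (\<kappa> w) * t w powr p)"
      using nn_integral_eq_integral[OF i2] by (simp add: ennreal_mult)
    have key: "M * m powr p \<le> (LBINT w. norm (\<kappa> w) * t w powr p)"
    proof (cases "m = 0")
      case True
      then show ?thesis by (auto intro!: Bochner_Integration.integral_nonneg)
    next
      case False
      then have m0: "m > 0" using m by simp
      have mp: "m powr p = m * m powr (p - 1)" using powr_add[of m "p - 1" 1] m0 by simp
      \<comment> \<open>The weight has mass \<open>M - 1\<close> only. The linear term contributes
        \<open>p * m powr p\<close>, and \<open>p \<ge> 1\<close> makes this cover the missing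
        \<open>m powr p\<close>.\<close>
      have "M * m powr p \<le> (M - 1) * m powr p + p * m powr (p - 1) * (M * m - m * (M - 1))"
        unfolding mp using p m0 M by (simp add: algebra_simps)
      also have "\<dots> = (LBINT w. norm (\<kappa> w) * m powr p + p * m powr (p - 1) * (norm (\<kappa> w) * t w - m * norm (\<kappa> w)))"
        using i1 \<kappa> by (simp add: m(2) M_def)
      also have "\<dots> \<le> (LBINT w. norm (\<kappa> w) * t w powr p)"
      proof (rule integral_mono)
        show "integrable lborel (\<lambda>w. norm (\<kappa> w) * m powr p + p * m powr (p - 1) * (norm (\<kappa> w) * t w - m * norm (\<kappa> w)))"
          using i1 \<kappa> by auto
        fix w
        have "norm (\<kappa> w) * (m powr p + p * m powr (p - 1) * (t w - m)) \<le> norm (\<kappa> w) * t w powr p"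
          by (intro mult_left_mono powr_tangent_le p m0) (auto simp: t_def)
        then show "norm (\<kappa> w) * m powr p + p * m powr (p - 1) * (norm (\<kappa> w) * t w - m * norm (\<kappa> w)) \<le> norm (\<kappa> w) * t w powr p"
          by (simp add: algebra_simps)
      qed (use i2 in auto)
      finally show ?thesis .
    qed
    have "norm (conv \<kappa> L u x) powr p \<le> (M * m) powr p" using conv p by (intro powr_mono2) auto
    also have "\<dots> = M powr p / M * (M * m powr p)" using M m by (simp add: powr_mult)
    also have "\<dots> \<le> M powr p / M * (LBINT w. norm (\<kappa> w) * t w powr p)"
      using key M by (intro mult_left_mono) auto
    finally have "ennreal (norm (conv \<kappa> L u x) powr p) \<le> ennreal (M powr p / M * (LBINT w. norm (\<kappa> w) * t w powr p))"
      by (rule ennreal_leI)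
    also have "\<dots> = ennreal (M powr p / M) * ?I"
      unfolding Ieq using M by (intro ennreal_mult) (auto intro!: Bochner_Integration.integral_nonneg)
    finally show ?thesis by (simp add: t_def)
  qed
qed

lemma enn2real_ge_1: "1 \<le> r \<Longrightarrow> r \<noteq> \<infinity> \<Longrightarrow> 1 \<le> enn2real r"
  by (metis enn2real_1 enn2real_mono infinity_ennreal_def less_top)

text \<open>For finite exponents the pointwise bound is integrated by Tonelli. For
  \<open>r = \<infinity>\<close> the difficulty is that the essential bound of \<open>u\<close> may
  fail on a large part of a translate of the range of \<open>L\<close>; this happens only for a null
  set of \<open>x\<close>.\<close>

lemma conv_Lr:
  fixes L :: "'b::euclidean_space \<Rightarrow> 'a::euclidean_space"
  assumes L: "linear L" and \<kappa>: "integrable lborel \<kappa>" and u: "u \<in> borel_measurable borel" "u \<in> Lr_fun r"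
    and r: "1 \<le> r"
  shows "conv \<kappa> L u \<in> Lr_fun r"
proof (cases "r = \<infinity>")
  case True
  have \<kappa>m: "\<kappa> \<in> borel_measurable borel" using \<kappa> by auto
  obtain C where C: "AE x in lborel. norm (u x) \<le> C" using u True by (auto simp: Lr_fun_borel_iff)
  define N where "N = {x. \<not> norm (u x) \<le> C}"
  have N: "N \<in> sets borel" unfolding N_def using u(1) by measurable
  have N0: "emeasure lborel N = 0"
    using C N by (subst (asm) AE_iff_measurable[OF _ refl]) (auto simp: N_def)
  \<comment> \<open>Tonelli with the constant kernel 1: its integral is infinite, but
    \<open>\<infinity> * 0 = 0\<close> in \<open>ennreal\<close>. Hence for almost every
    \<open>x\<close> almost no \<open>w\<close> sends \<open>x - L w\<close> into
    \<open>N\<close>.\<close>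
  have "(\<integral>\<^sup>+x. (\<integral>\<^sup>+w. 1 * indicator N (x - L w) \<partial>(lborel::'b measure)) \<partial>lborel) = 0"
    using nn_integral_conv[OF L, of "\<lambda>w. 1" "indicator N"] N N0 by simp
  moreover have "(\<lambda>x. \<integral>\<^sup>+w. 1 * indicator N (x - L w) \<partial>(lborel::'b measure)) \<in> borel_measurable lborel"
    by (rule lborel.borel_measurable_nn_integral)
      (use measurable_shift_compose(1)[OF L, of "indicator N :: 'a \<Rightarrow> ennreal"] N in simp)
  ultimately have "AE x in lborel. (\<integral>\<^sup>+w. 1 * indicator N (x - L w) \<partial>(lborel::'b measure)) = 0"
    by (subst (asm) nn_integral_0_iff_AE)
  then have "AE x in lborel. norm (conv \<kappa> L u x) \<le> (LBINT w. norm (\<kappa> w) * C)"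
  proof eventually_elim
    fix x assume "(\<integral>\<^sup>+w. 1 * indicator N (x - L w) \<partial>(lborel::'b measure)) = 0"
    moreover have "(\<lambda>w. 1 * indicator N (x - L w) :: ennreal) \<in> borel_measurable lborel"
      using measurable_shift_compose(3)[OF L, of "indicator N :: 'a \<Rightarrow> ennreal"] N by simp
    ultimately have "AE w in (lborel::'b measure). 1 * indicator N (x - L w) = (0::ennreal)"
      by (subst (asm) nn_integral_0_iff_AE)
    then have AE: "AE w in lborel. norm (\<kappa> w * u (x - L w)) \<le> norm (\<kappa> w) * C"
      by eventually_elim (auto simp: N_def norm_mult indicator_def intro!: mult_left_mono split: if_splits)
    show "norm (conv \<kappa> L u x) \<le> (LBINT w. norm (\<kappa> w) * C)"
    proof -
      have "norm (LBINT w. \<kappa> w * u (x - L w)) \<le> (LBINT w. norm (\<kappa> w * u (x - L w)))"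
        by (rule integral_norm_bound)
      also have "\<dots> \<le> (LBINT w. norm (\<kappa> w) * C)"
      proof (rule integral_mono_AE'[OF _ AE])
        show "AE w in lborel. 0 \<le> norm (\<kappa> w) * C" using AE by eventually_elim (rule order_trans[OF norm_ge_zero])
      qed (use \<kappa> in auto)
      finally show ?thesis unfolding conv_def .
    qed
  qed
  then show ?thesis using True conv_measurable(2)[OF L \<kappa>m u(1)] by (auto simp: Lr_fun_borel_iff)
next
  case False
  define p where "p = enn2real r"
  have p: "p \<ge> 1" using enn2real_ge_1[OF r False] by (simp add: p_def)
  have \<kappa>m: "\<kappa> \<in> borel_measurable borel" using \<kappa> by auto
  define M where "M = (LBINT w. norm (\<kappa> w)) + 1"
  have "(\<integral>\<^sup>+x. ennreal (norm (conv \<kappa> L u x) powr p) \<partial>lborel)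
    \<le> (\<integral>\<^sup>+x. ennreal (M powr p / M) * (\<integral>\<^sup>+w. ennreal (norm (\<kappa> w)) * ennreal (norm (u (x - L w)) powr p) \<partial>lborel) \<partial>lborel)"
    unfolding M_def by (intro nn_integral_mono conv_powr_le L \<kappa> u p)
  also have "\<dots> = ennreal (M powr p / M) * (\<integral>\<^sup>+x. (\<integral>\<^sup>+w. ennreal (norm (\<kappa> w)) * ennreal (norm (u (x - L w)) powr p) \<partial>lborel) \<partial>lborel)"
  proof (rule nn_integral_cmult)
    have "(\<lambda>p. ennreal (norm (\<kappa> (snd p)))) \<in> borel_measurable ((lborel::'a measure) \<Otimes>\<^sub>M (lborel::'b measure))"
      using \<kappa>m by measurable
    then show "(\<lambda>x. \<integral>\<^sup>+w. ennreal (norm (\<kappa> w)) * ennreal (norm (u (x - L w)) powr p) \<partial>lborel) \<in> borel_measurable lborel"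
      using measurable_shift_compose(1)[OF L, of "\<lambda>y. ennreal (norm (u y) powr p)"] u(1)
      by (intro lborel.borel_measurable_nn_integral) (auto simp: case_prod_beta' intro!: borel_measurable_times_ennreal)
  qed
  also have "\<dots> = ennreal (M powr p / M) * ((\<integral>\<^sup>+w. ennreal (norm (\<kappa> w)) \<partial>lborel) * (\<integral>\<^sup>+x. ennreal (norm (u x) powr p) \<partial>lborel))"
    by (subst nn_integral_conv[OF L]) (use u \<kappa>m in auto)
  also have "\<dots> < \<infinity>"
    using u False \<kappa> by (auto simp: Lr_fun_borel_iff p_def integrable_iff_bounded ennreal_mult_less_top)
  finally show ?thesis
    using False conv_measurable(2)[OF L \<kappa>m u(1)] by (simp add: Lr_fun_borel_iff p_def)
qed

text \<open>Only finiteness is at stake, so the crude constant \<open>2 powr p\<close>, obtained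
  from the maximum of the two norms, replaces Minkowski's inequality.\<close>

lemma Lr_fun_add:
  assumes "u \<in> Lr_fun r" "v \<in> Lr_fun r"
  shows "(\<lambda>x. u x + v x) \<in> Lr_fun r"
proof (cases "r = \<infinity>")
  case True
  from assms obtain C D where "AE x in lebesgue. norm (u x) \<le> C" "AE x in lebesgue. norm (v x) \<le> D"
    unfolding Lr_fun_def using True by auto
  then have "AE x in lebesgue. norm (u x + v x) \<le> C + D"
    by eventually_elim (rule norm_triangle_mono)
  then show ?thesis using assms True by (auto simp: Lr_fun_def)
next
  case False
  define p where "p = enn2real r"
  have p: "p \<ge> 0" by (simp add: p_def)
  have m: "u \<in> borel_measurable lebesgue" "v \<in> borel_measurable lebesgue" using assms by (auto simp: Lr_fun_def)
  have pt: "norm (u x + v x) powr p \<le> 2 powr p * (norm (u x) powr p + norm (v x) powr p)" for x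
  proof -
    have "norm (u x + v x) powr p \<le> (2 * max (norm (u x)) (norm (v x))) powr p"
      by (rule powr_mono2[OF p]) (use norm_triangle_ineq[of "u x" "v x"] in auto)
    also have "\<dots> = 2 powr p * max (norm (u x)) (norm (v x)) powr p" by (simp add: powr_mult)
    also have "\<dots> \<le> 2 powr p * (norm (u x) powr p + norm (v x) powr p)"
      by (intro mult_left_mono) (auto simp: max_def)
    finally show ?thesis .
  qed
  have "(\<integral>\<^sup>+x. ennreal (norm (u x + v x) powr p) \<partial>lebesgue) \<le>
    (\<integral>\<^sup>+x. ennreal (2 powr p) * (ennreal (norm (u x) powr p) + ennreal (norm (v x) powr p)) \<partial>lebesgue)"
    using pt by (intro nn_integral_mono) (simp add: ennreal_mult[symmetric] ennreal_plus[symmetric] ennreal_leI del: ennreal_plus)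
  also have "\<dots> = ennreal (2 powr p) * ((\<integral>\<^sup>+x. ennreal (norm (u x) powr p) \<partial>lebesgue) + (\<integral>\<^sup>+x. ennreal (norm (v x) powr p) \<partial>lebesgue))"
    using m by (subst nn_integral_cmult) (auto simp: nn_integral_add)
  also have "\<dots> < \<infinity>" using assms False by (auto simp: Lr_fun_def p_def ennreal_mult_less_top)
  finally show ?thesis using m False by (simp add: Lr_fun_def p_def)
qed

lemma Lr_fun_mult_bounded:
  assumes "u \<in> Lr_fun r" "g \<in> borel_measurable lebesgue" "\<And>x. u x \<noteq> 0 \<Longrightarrow> norm (g x) \<le> B"
  shows "(\<lambda>x. g x * u x) \<in> Lr_fun r"
proof -
  \<comment> \<open>\<open>B\<close> may be negative when \<open>u\<close> vanishes
    identically.\<close>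
  define B' where "B' = max 0 B"
  have le: "norm (g x * u x) \<le> B' * norm (u x)" for x
    using assms(3)[of x] by (cases "u x = 0") (auto simp: norm_mult B'_def intro!: mult_right_mono)
  have B': "B' \<ge> 0" by (simp add: B'_def)
  have m: "u \<in> borel_measurable lebesgue" using assms by (auto simp: Lr_fun_def)
  show ?thesis
  proof (cases "r = \<infinity>")
    case True
    from assms obtain C where "AE x in lebesgue. norm (u x) \<le> C"
      unfolding Lr_fun_def using True by auto
    then have "AE x in lebesgue. norm (g x * u x) \<le> B' * C"
      by eventually_elim (use le B' in \<open>meson mult_left_mono order_trans\<close>)
    then show ?thesis using assms m True by (auto simp: Lr_fun_def)
  next
    case False
    define p where "p = enn2real r"
    have p: "p \<ge> 0" by (simp add: p_def)
    have "(\<integral>\<^sup>+x. ennreal (norm (g x * u x) powr p) \<partial>lebesgue) \<le> (\<integral>\<^sup>+x. ennreal (B' powr p) * ennreal (norm (u x) powr p) \<partial>lebesgue)"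
    proof (intro nn_integral_mono)
      fix x
      have "norm (g x * u x) powr p \<le> (B' * norm (u x)) powr p" using le p by (intro powr_mono2) auto
      also have "\<dots> = B' powr p * norm (u x) powr p" using B' by (simp add: powr_mult)
      finally show "ennreal (norm (g x * u x) powr p) \<le> ennreal (B' powr p) * ennreal (norm (u x) powr p)"
        by (simp add: ennreal_mult[symmetric] ennreal_leI)
    qed
    also have "\<dots> = ennreal (B' powr p) * (\<integral>\<^sup>+x. ennreal (norm (u x) powr p) \<partial>lebesgue)"
      using m by (intro nn_integral_cmult) auto
    also have "\<dots> < \<infinity>" using assms False by (auto simp: Lr_fun_def p_def ennreal_mult_less_top)
    finally show ?thesis using assms m False by (simp add: Lr_fun_def p_def)
  qed
qed

text \<open>On a bounded support the inequality \<open>t \<le> 1 + t powr p\<close> does the work of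
  Hoelder's inequality.\<close>

lemma Lr_fun_integrable:
  fixes u :: "'a::euclidean_space \<Rightarrow> complex"
  assumes "u \<in> borel_measurable borel" "u \<in> Lr_fun r" "1 \<le> r" "bounded {x. u x \<noteq> 0}"
  shows "integrable lborel u"
proof -
  obtain R where R: "\<And>x. u x \<noteq> 0 \<Longrightarrow> norm x \<le> R" using assms(4) by (auto simp: bounded_iff)
  let ?C = "cball (0::'a) R"
  have fin: "emeasure lborel ?C < \<infinity>" by (rule emeasure_lborel_cball_finite)
  show ?thesis
  proof (rule integrableI_bounded)
    show "(\<integral>\<^sup>+x. ennreal (norm (u x)) \<partial>lborel) < \<infinity>"
    proof (cases "r = \<infinity>")
      case True
      then obtain C where C: "AE x in lborel. norm (u x) \<le> C" using assms by (auto simp: Lr_fun_borel_iff)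
      have "(\<integral>\<^sup>+x. ennreal (norm (u x)) \<partial>lborel) \<le> (\<integral>\<^sup>+x. ennreal C * indicator ?C x \<partial>lborel)"
      proof (rule nn_integral_mono_AE, use C in eventually_elim)
        fix x assume "norm (u x) \<le> C"
        then show "ennreal (norm (u x)) \<le> ennreal C * indicator ?C x"
          using R[of x] by (cases "u x = 0") (auto simp: ennreal_leI)
      qed
      also have "\<dots> < \<infinity>" using fin by (subst nn_integral_cmult_indicator) (auto simp: ennreal_mult_less_top)
      finally show ?thesis .
    next
      case False
      define p where "p = enn2real r"
      have p: "p \<ge> 1" using enn2real_ge_1[OF assms(3) False] by (simp add: p_def)
      have "(\<integral>\<^sup>+x. ennreal (norm (u x)) \<partial>lborel) \<le> (\<integral>\<^sup>+x. indicator ?C x + ennreal (norm (u x) powr p) \<partial>lborel)"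
      proof (rule nn_integral_mono)
        fix x
        have "norm (u x) \<le> 1 + norm (u x) powr p"
        proof (cases "norm (u x) \<le> 1")
          case False
          then have "norm (u x) powr 1 \<le> norm (u x) powr p" using p by (intro powr_mono) auto
          then show ?thesis using False by simp
        qed (simp add: add_increasing2)
        then have "ennreal (norm (u x)) \<le> 1 + ennreal (norm (u x) powr p)"
          by (metis ennreal_1 ennreal_leI ennreal_plus powr_ge_zero zero_le_one)
        then show "ennreal (norm (u x)) \<le> indicator ?C x + ennreal (norm (u x) powr p)"
          using R[of x] by (cases "u x = 0") auto
      qed
      also have "\<dots> < \<infinity>"
        using fin assms False by (subst nn_integral_add) (auto simp: Lr_fun_borel_iff p_def intro!: borel_measurable_indicator)
      finally show ?thesis .
    qed
  qed (use assms in auto)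
qed

subsection \<open>The Cauchy transform in one variable\<close>

text \<open>At 0 the difference quotient is bounded by a lower positive power, which still tends to
  0. The exponents 2 and 3 furnish piecewise polynomial cutoffs of finite smoothness.\<close>

lemma DERIV_max_power:
  "((\<lambda>x::real. (max 0 x) ^ Suc (Suc n)) has_real_derivative real (Suc (Suc n)) * (max 0 x) ^ Suc n) (at x)"
proof -
  consider "x < 0" | "x > 0" | "x = 0" by linarith
  then show ?thesis
  proof cases
    case 1
    have "((\<lambda>x. 0) has_real_derivative 0) (at x)" by simp
    then have "((\<lambda>x::real. (max 0 x) ^ Suc (Suc n)) has_real_derivative 0) (at x)"
      by (rule has_field_derivative_transform_within_open[of _ _ _ "{..<0}"]) (use 1 in auto)
    then show ?thesis using 1 by simp
  next
    case 2
    have "((\<lambda>x. x ^ Suc (Suc n)) has_real_derivative real (Suc (Suc n)) * x ^ Suc n) (at x)"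
      using DERIV_pow[of "Suc (Suc n)" x] by simp
    then have "((\<lambda>x::real. (max 0 x) ^ Suc (Suc n)) has_real_derivative real (Suc (Suc n)) * x ^ Suc n) (at x)"
      by (rule has_field_derivative_transform_within_open[of _ _ _ "{0<..}"]) (use 2 in auto)
    then show ?thesis using 2 by simp
  next
    case 3
    have "((\<lambda>h::real. (max 0 h) ^ Suc (Suc n) / h) \<longlongrightarrow> 0) (at 0)"
    proof (rule tendsto_0_le[where f="\<lambda>h::real. (max 0 h) ^ Suc n" and K=1])
      have "((\<lambda>h::real. (max 0 h) ^ Suc n) \<longlongrightarrow> (max 0 0) ^ Suc n) (at 0)"
        by (intro tendsto_intros)
      then show "((\<lambda>h::real. (max 0 h) ^ Suc n) \<longlongrightarrow> 0) (at 0)" by simp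
      show "\<forall>\<^sub>F h in at 0. norm ((max 0 h) ^ Suc (Suc n) / h) \<le> norm ((max 0 h) ^ Suc n :: real) * 1"
        by (intro always_eventually allI) (auto simp: max_def abs_mult)
    qed
    then show ?thesis using 3 by (simp add: DERIV_def)
  qed
qed

text \<open>Using the squared norm keeps the function differentiable at the origin, and the
  \<open>dbar\<close> derivative of \<open>(norm w)\<^sup>2\<close> is \<open>w\<close>.\<close>

lemma C1_on_radial:
  assumes "\<And>s. (p has_real_derivative p' s) (at s)" "continuous_on UNIV p'"
  shows "C1_on UNIV (\<lambda>w::complex. of_real (p ((norm w)\<^sup>2)))"
    and "dbar1 (\<lambda>w::complex. of_real (p ((norm w)\<^sup>2))) w = of_real (p' ((norm w)\<^sup>2)) * w"
proof -
  have N: "((\<lambda>w::complex. (norm w)\<^sup>2) has_derivative (\<lambda>v. 2 * (w \<bullet> v))) (at w)" for w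
    unfolding power2_norm_eq_inner by (auto intro!: derivative_eq_intros simp: inner_commute)
  have "((\<lambda>w::complex. p ((norm w)\<^sup>2)) has_derivative (\<lambda>v. p' ((norm w)\<^sup>2) * (2 * (w \<bullet> v)))) (at w)" for w
    using diff_chain_at[OF N assms(1)[unfolded has_field_derivative_def]] by (simp add: o_def)
  then have D: "((\<lambda>w::complex. complex_of_real (p ((norm w)\<^sup>2))) has_derivative
      (\<lambda>v. of_real (p' ((norm w)\<^sup>2) * (2 * (w \<bullet> v))))) (at w)" for w
    by (rule bounded_linear.has_derivative[OF bounded_linear_of_real])
  show "C1_on UNIV (\<lambda>w::complex. of_real (p ((norm w)\<^sup>2)))"
    by (rule C1_onI[OF D]) (intro continuous_intros continuous_on_compose2[OF assms(2)], auto)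
  show "dbar1 (\<lambda>w::complex. of_real (p ((norm w)\<^sup>2))) w = of_real (p' ((norm w)\<^sup>2)) * w"
    unfolding dbar1_def frechet_derivative_at[OF D, symmetric]
    by (simp add: inner_complex_def complex_eq_iff)
qed

text \<open>Two derivatives are required because \<open>dbar1 \<theta>\<close> will itself multiply
  test functions in the error term of the homotopy formula, and the product must be C1.\<close>

lemma C2_cutoff_exists:
  fixes a b :: real
  assumes "0 \<le> a" "a < b"
  obtains \<theta> :: "complex \<Rightarrow> complex" where "C1_on UNIV \<theta>" "C1_on UNIV (dbar1 \<theta>)"
    "\<And>w. norm w \<le> a \<Longrightarrow> \<theta> w = 1" "\<And>w. norm w \<le> a \<Longrightarrow> dbar1 \<theta> w = 0"
    "\<And>w. norm w \<ge> b \<Longrightarrow> \<theta> w = 0" "\<And>w. norm w \<ge> b \<Longrightarrow> dbar1 \<theta> w = 0"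
proof -
  define A B where "A = a\<^sup>2" and "B = b\<^sup>2"
  have AB: "A < B" unfolding A_def B_def using assms by (intro power_strict_mono) auto
  \<comment> \<open>\<open>X\<close> below is affine with \<open>X A = 1\<close> and
    \<open>X B = 0\<close>. Taking positive parts at both levels of \<open>1 - (1 - X^3)^3\<close>
    makes \<open>p\<close> equal to 1 up to \<open>A\<close> and to 0 from \<open>B\<close> on; the
    cubes keep the second derivative continuous.\<close>
  define h where "h = 1 / (B - A)"
  have h: "h > 0" using AB by (simp add: h_def)
  define X where "X s = (B - s) * h" for s
  define Y where "Y s = 1 - (max 0 (X s)) ^ 3" for s
  define p where "p s = 1 - (max 0 (Y s)) ^ 3" for s
  define p' where "p' s = - 9 * h * (max 0 (Y s))\<^sup>2 * (max 0 (X s))\<^sup>2" for s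
  have m3: "((\<lambda>x::real. (max 0 x) ^ 3) has_real_derivative 3 * (max 0 x)\<^sup>2) (at x)" for x
    using DERIV_max_power[of 1 x] by (simp add: numeral_eq_Suc)
  have m2: "((\<lambda>x::real. (max 0 x)\<^sup>2) has_real_derivative 2 * max 0 x) (at x)" for x
    using DERIV_max_power[of 0 x] by (simp add: numeral_eq_Suc)
  have dX: "(X has_real_derivative - h) (at s)" for s
    unfolding X_def by (auto intro!: derivative_eq_intros)
  have dY: "(Y has_real_derivative 3 * h * (max 0 (X s))\<^sup>2) (at s)" for s
    unfolding Y_def by (rule DERIV_cong[OF DERIV_diff[OF DERIV_const DERIV_chain2[OF m3 dX]]]) simp
  have dp: "(p has_real_derivative p' s) (at s)" for s
    unfolding p_def p'_def by (rule DERIV_cong[OF DERIV_diff[OF DERIV_const DERIV_chain2[OF m3 dY]]]) simp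
  define p'' where "p'' s = - 9 * h * ((2 * max 0 (Y s) * (3 * h * (max 0 (X s))\<^sup>2)) * (max 0 (X s))\<^sup>2
       + (max 0 (Y s))\<^sup>2 * (2 * max 0 (X s) * - h))" for s
  have dp': "(p' has_real_derivative p'' s) (at s)" for s
    unfolding p'_def p''_def mult.assoc[of "- 9 * h"]
    by (rule DERIV_cong[OF DERIV_cmult[OF DERIV_mult[OF DERIV_chain2[OF m2 dY] DERIV_chain2[OF m2 dX]]]])
      (simp add: algebra_simps)
  have cX: "continuous_on UNIV X" and cY: "continuous_on UNIV Y"
    unfolding Y_def X_def by (intro continuous_intros)+
  have cp': "continuous_on UNIV p'" and cp'': "continuous_on UNIV p''"
    unfolding p'_def p''_def by (intro continuous_intros cX cY)+
  define \<theta> where "\<theta> = (\<lambda>w::complex. complex_of_real (p ((norm w)\<^sup>2)))"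
  have d\<theta>: "dbar1 \<theta> = (\<lambda>w. of_real (p' ((norm w)\<^sup>2)) * w)"
    using C1_on_radial(2)[OF dp cp'] by (auto simp: \<theta>_def)
  have id: "C1_on UNIV (\<lambda>w::complex. w)"
    by (rule C1_onI[where D="\<lambda>w v. v"]) auto
  have small: "X s \<ge> 1" if "s \<le> A" for s
    using that AB by (auto simp: X_def h_def field_simps)
  have small': "Y s \<le> 0" if "s \<le> A" for s
    using one_le_power[OF small[OF that], of 3] small[OF that] by (simp add: Y_def)
  have large: "X s \<le> 0" if "s \<ge> B" for s
    using that h by (auto simp: X_def mult_nonpos_nonneg)
  show thesis
  proof (rule that[of \<theta>])
    show "C1_on UNIV \<theta>" unfolding \<theta>_def by (rule C1_on_radial(1)[OF dp cp'])
    show "C1_on UNIV (dbar1 \<theta>)" unfolding d\<theta> by (intro C1_on_mult C1_on_radial(1)[OF dp' cp''] id)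
    fix w :: complex
    { assume "norm w \<le> a"
      then have "(norm w)\<^sup>2 \<le> A" unfolding A_def by (intro power_mono) auto
      from small'[OF this] show "\<theta> w = 1" "dbar1 \<theta> w = 0"
        unfolding d\<theta> by (auto simp: \<theta>_def p_def p'_def) }
    { assume "norm w \<ge> b"
      then have "(norm w)\<^sup>2 \<ge> B" unfolding B_def using assms by (intro power_mono) auto
      from large[OF this] show "\<theta> w = 0" "dbar1 \<theta> w = 0"
        unfolding d\<theta> by (auto simp: \<theta>_def p_def p'_def Y_def) }
  qed
qed

text \<open>Truncating the Cauchy kernel makes it integrable; the truncation is invisible as long as all
  functions live over the unit disc in the variable of integration.\<close>

definition cauchy_ker :: "complex \<Rightarrow> complex" where
  "cauchy_ker w = (if norm w < 2 then 1 / (of_real cauchy_mass * w) else 0)"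

lemma cauchy_ker_odd: "cauchy_ker (- w) = - cauchy_ker w"
  by (simp add: cauchy_ker_def)

lemma cauchy_ker_support: "bounded {w. cauchy_ker w \<noteq> 0}"
  by (rule bounded_subset[OF bounded_ball[of 0 2]]) (auto simp: cauchy_ker_def)

lemma cauchy_ker_integrable: "integrable lborel cauchy_ker"
proof (rule Bochner_Integration.integrable_bound[OF integrable_mult_right[OF integrable_inverse_norm_ball[of 2], of "1 / cauchy_mass"]])
  show "cauchy_ker \<in> borel_measurable lborel"
    unfolding cauchy_ker_def[abs_def] by measurable
  show "AE w in lborel. norm (cauchy_ker w) \<le> norm (1 / cauchy_mass * (indicator (ball 0 2) w / norm w))"
    using cauchy_mass_pos by (intro AE_I2) (auto simp: cauchy_ker_def norm_divide norm_mult indicator_def)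
qed auto

definition cauchy_T :: "'n::finite \<Rightarrow> (complex ^ 'n \<Rightarrow> complex) \<Rightarrow> complex ^ 'n \<Rightarrow> complex" where
  "cauchy_T j = conv cauchy_ker (axis j)"

lemma linear_axis: "linear (axis j :: complex \<Rightarrow> complex ^ 'n::finite)"
  by (rule linearI) (auto simp: axis_def vec_eq_iff)

lemma dzbar_continuous: "C1c \<phi> \<Longrightarrow> continuous_on S (dzbar j \<phi>)"
  unfolding dzbar_def[abs_def] by (intro continuous_intros C1c_continuous_frechet) auto

lemma dzbar_support:
  fixes \<phi> :: "complex ^ 'n::finite \<Rightarrow> complex"
  assumes "C1c \<phi>"
  shows "bounded {w. dzbar j \<phi> w \<noteq> 0}"
proof (rule bounded_subset)
  show "bounded ({x. frechet_derivative \<phi> (at x) (axis j 1) \<noteq> 0} \<union> {x. frechet_derivative \<phi> (at x) (axis j \<i>) \<noteq> 0})"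
    using C1c_bounded_frechet_support[OF assms] by simp
qed (auto simp: dzbar_def)

lemma dzbar_measurable: "C1c \<phi> \<Longrightarrow> dzbar j \<phi> \<in> borel_measurable borel"
  by (intro borel_measurable_continuous_onI dzbar_continuous)

lemma dzbar_mult:
  assumes "a differentiable (at z)" "\<phi> differentiable (at z)"
  shows "dzbar i (\<lambda>z. a z * \<phi> z) z = a z * dzbar i \<phi> z + dzbar i a z * \<phi> z"
proof -
  have "frechet_derivative (\<lambda>w. a w * \<phi> w) (at z) =
     (\<lambda>v. a z * frechet_derivative \<phi> (at z) v + frechet_derivative a (at z) v * \<phi> z)"
    using frechet_derivative_at[OF has_derivative_mult[OF assms[unfolded frechet_derivative_works]]] by simp
  then show ?thesis by (simp add: dzbar_def field_simps)
qed

lemma dzbar_component: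
  fixes j :: "'n::finite"
  assumes "C1_on UNIV g"
  shows "dzbar j (\<lambda>z::complex^'n. g (z $ j)) z = dbar1 g (z $ j)"
    and "i \<noteq> j \<Longrightarrow> dzbar i (\<lambda>z::complex^'n. g (z $ j)) z = 0"
proof -
  have "frechet_derivative g (at (z $ j)) 0 = 0"
    using C1_on_has_derivative[OF assms, of "z $ j"] has_derivative_linear linear_0 by blast
  then show "dzbar j (\<lambda>z::complex^'n. g (z $ j)) z = dbar1 g (z $ j)"
    and "i \<noteq> j \<Longrightarrow> dzbar i (\<lambda>z::complex^'n. g (z $ j)) z = 0"
    unfolding dzbar_def dbar1_def C1_on_component(2)[OF assms] by (simp_all add: axis_def)
qed

lemma cauchy_T_C1c: "C1c \<phi> \<Longrightarrow> C1c (cauchy_T j \<phi>)"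
  unfolding cauchy_T_def by (intro conv_C1c cauchy_ker_integrable cauchy_ker_support linear_axis)

lemma dzbar_conv:
  fixes \<phi> :: "complex ^ 'n::finite \<Rightarrow> complex"
  assumes "C1c \<phi>" "integrable lborel \<kappa>" "bounded {w. \<kappa> w \<noteq> 0}" "linear L"
  shows "dzbar i (conv \<kappa> L \<phi>) z = conv \<kappa> L (dzbar i \<phi>) z"
proof -
  have D: "frechet_derivative (conv \<kappa> L \<phi>) (at z) v = (LBINT w. \<kappa> w * frechet_derivative \<phi> (at (z - L w)) v)" for v
    unfolding conv_C1c(2)[OF assms(2-4) assms(1)] by (simp add: conv_def)
  have "integrable lborel (\<lambda>w. \<kappa> w * frechet_derivative \<phi> (at (z - L w)) v)" for v
    by (rule conv_integrable[OF assms(2) assms(4) C1c_continuous_frechet[OF assms(1)] C1c_bounded_frechet_support[OF assms(1)]])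
  then show ?thesis
    unfolding dzbar_def[of i "conv \<kappa> L \<phi>" z] D
    unfolding conv_def dzbar_def by (simp add: field_simps)
qed

lemma dzbar_cauchy_T: "C1c \<phi> \<Longrightarrow> dzbar i (cauchy_T j \<phi>) = cauchy_T j (dzbar i \<phi>)"
  unfolding cauchy_T_def
  by (rule ext) (intro dzbar_conv cauchy_ker_integrable cauchy_ker_support linear_axis)

text \<open>On the complex line through \<open>z\<close> in direction \<open>j\<close> this is the
  Cauchy-Pompeiu formula. The reflected parametrization \<open>z - axis j w\<close> produces a minus
  sign that cancels the one in \<open>cauchy_pompeiu\<close>.\<close>

lemma cauchy_T_dzbar:
  fixes g :: "complex ^ 'a::finite \<Rightarrow> complex" and z :: "complex ^ 'a"
  assumes g: "C1c g" and supp: "\<And>z. g z \<noteq> 0 \<Longrightarrow> norm (z $ j) < 1" and z: "norm (z $ j) < 1"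
  shows "cauchy_T j (dzbar j g) z = g z"
proof -
  define \<gamma> where "\<gamma> w = g (z - axis j w)" for w
  let ?D = "\<lambda>w v. - frechet_derivative g (at (z - axis j w)) (axis j v)"
  have bl: "bounded_linear (axis j :: complex \<Rightarrow> complex ^ 'a)" using linear_axis linear_conv_bounded_linear by blast
  have aff: "((\<lambda>w. z - axis j w) has_derivative (\<lambda>v. - axis j v)) (at w)" for w
    by (auto intro!: derivative_eq_intros bounded_linear_imp_has_derivative bl)
  have ng: "frechet_derivative g (at y) (- v) = - frechet_derivative g (at y) v" for y v
    using linear_neg[OF C1c_linear[OF g]] .
  have D: "(\<gamma> has_derivative ?D w) (at w)" for w
    using diff_chain_at[OF aff C1c_has_derivative[OF g]] by (simp add: o_def \<gamma>_def[abs_def] ng)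
  have \<gamma>0: "\<gamma> w = 0" if "norm w > 1 + norm (z $ j)" for w
  proof (rule ccontr)
    assume "\<gamma> w \<noteq> 0"
    then have "norm (z $ j - w) < 1" using supp[of "z - axis j w"] by (simp add: \<gamma>_def axis_def)
    then show False using that norm_triangle_ineq2[of w "z $ j"] by (simp add: norm_minus_commute)
  qed
  have \<gamma>: "C1c \<gamma>"
    unfolding C1c_def
  proof
    show "C1_on UNIV \<gamma>"
      by (rule C1_onI[OF D]) (intro continuous_intros continuous_on_compose2[OF C1c_continuous_frechet[OF g, of UNIV]]
        linear_continuous_on bl, auto)
    show "bounded {w. \<gamma> w \<noteq> 0}"
      using \<gamma>0 by (intro boundedI[of _ "1 + norm (z $ j)"]) (auto simp: not_less[symmetric])
  qed
  have db: "dbar1 \<gamma> w = - dzbar j g (z - axis j w)" for w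
    unfolding dbar1_def frechet_derivative_at[OF D, symmetric] dzbar_def by (simp add: field_simps)
  \<comment> \<open>\<open>\<gamma>\<close> vanishes beyond the radius
    \<open>1 + norm (z $ j)\<close>, which is strictly below 2, so the truncation of the kernel
    loses nothing, even on the circle of radius 2.\<close>
  have dz: "dbar1 \<gamma> w = 0" if "norm w \<ge> 2" for w
  proof -
    have "frechet_derivative \<gamma> (at w) = (\<lambda>v. 0)"
      by (rule frechet_zero_outside[of "- cball 0 (1 + norm (z $ j))"]) (use that z \<gamma>0 in auto)
    then show ?thesis by (simp add: dbar1_def)
  qed
  have "cauchy_T j (dzbar j g) z = (LBINT w. - (1 / of_real cauchy_mass) * (dbar1 \<gamma> w / w))"
    unfolding cauchy_T_def conv_def
  proof (rule Bochner_Integration.integral_cong[OF refl])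
    fix w
    show "cauchy_ker w * dzbar j g (z - axis j w) = - (1 / of_real cauchy_mass) * (dbar1 \<gamma> w / w)"
      using db[of w] dz[of w] by (cases "norm w < 2") (auto simp: cauchy_ker_def)
  qed
  also have "\<dots> = - (1 / of_real cauchy_mass) * (- of_real cauchy_mass * \<gamma> 0)"
    unfolding cauchy_pompeiu[OF \<gamma>, symmetric] by (rule integral_mult_right_zero)
  also have "\<dots> = \<gamma> 0" using cauchy_mass_pos by simp
  also have "\<gamma> 0 = g (z - 0)" unfolding \<gamma>_def by (rule arg_cong[of _ _ "\<lambda>y. g (z - y)"]) simp
  also have "\<dots> = g z" by simp
  finally show ?thesis .
qed

subsection \<open>The homotopy formula\<close>

text \<open>The working substitute for \<open>Lr_comp r open_polydisc\<close>: Borel instead of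
  Lebesgue measurability, and vanishing everywhere, not just almost everywhere, outside a closed
  polydisc. Supports can then be used pointwise under integrals, and the radius can be
  tracked.\<close>

definition Lr_polydisc :: "ennreal \<Rightarrow> real \<Rightarrow> (complex ^ 'n::finite \<Rightarrow> complex) \<Rightarrow> bool" where
  "Lr_polydisc r \<rho> u \<longleftrightarrow> u \<in> borel_measurable borel \<and> u \<in> Lr_fun r \<and> (\<forall>z. u z \<noteq> 0 \<longrightarrow> (\<forall>i. norm (z $ i) \<le> \<rho>))"

lemma polydisc_bounded: "bounded {z::complex ^ 'n::finite. \<forall>i. norm (z $ i) \<le> \<rho>}"
proof (rule boundedI)
  fix z :: "complex ^ 'n" assume "z \<in> {z. \<forall>i. norm (z $ i) \<le> \<rho>}"
  then have "norm z \<le> (\<Sum>i\<in>(UNIV::'n set). \<rho>)"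
    unfolding norm_vec_def by (intro order_trans[OF L2_set_le_sum] sum_mono) auto
  then show "norm z \<le> real CARD('n) * \<rho>" by simp
qed

lemma Lr_polydisc_integrable:
  assumes "Lr_polydisc r \<rho> u" "1 \<le> r"
  shows "integrable lborel u"
proof -
  have "bounded {z. u z \<noteq> 0}"
    by (rule bounded_subset[OF polydisc_bounded[of \<rho>]]) (use assms(1) in \<open>auto simp: Lr_polydisc_def\<close>)
  then show ?thesis
    using assms by (intro Lr_fun_integrable[of u r]) (simp_all add: Lr_polydisc_def)
qed

lemma Lr_polydisc_zero: "Lr_polydisc r \<rho> (\<lambda>z. 0)"
proof -
  have "(\<lambda>z. 0) \<in> Lr_fun r"
    by (subst Lr_fun_borel_iff) (auto intro!: exI[of _ 0])
  then show ?thesis by (simp add: Lr_polydisc_def)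
qed

lemma Lr_polydisc_add:
  assumes "Lr_polydisc r \<rho> u" "Lr_polydisc r \<rho> v"
  shows "Lr_polydisc r \<rho> (\<lambda>z. u z + v z)"
  unfolding Lr_polydisc_def
proof (intro conjI allI impI)
  show "(\<lambda>z. u z + v z) \<in> borel_measurable borel"
    using assms by (intro borel_measurable_add) (simp_all add: Lr_polydisc_def)
  show "(\<lambda>z. u z + v z) \<in> Lr_fun r" using assms by (intro Lr_fun_add) (simp_all add: Lr_polydisc_def)
  fix z :: "(complex, 'a) vec" and i assume "u z + v z \<noteq> 0"
  then have "u z \<noteq> 0 \<or> v z \<noteq> 0" by auto
  then show "norm (z $ i) \<le> \<rho>" using assms by (auto simp: Lr_polydisc_def)
qed

lemma Lr_polydisc_mono: "Lr_polydisc r \<rho> u \<Longrightarrow> \<rho> \<le> \<rho>' \<Longrightarrow> Lr_polydisc r \<rho>' u"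
  unfolding Lr_polydisc_def by (auto intro: order_trans)

lemma Lr_polydisc_mult:
  assumes "Lr_polydisc r \<rho> u" "g \<in> borel_measurable borel" "\<And>z. u z \<noteq> 0 \<Longrightarrow> norm (g z) \<le> B"
  shows "Lr_polydisc r \<rho> (\<lambda>z. g z * u z)"
proof -
  have "g \<in> borel_measurable lebesgue" using assms(2) by (intro measurable_completion) simp
  then have "(\<lambda>z. g z * u z) \<in> Lr_fun r"
    using assms by (intro Lr_fun_mult_bounded) (simp_all add: Lr_polydisc_def)
  moreover have "(\<lambda>z. g z * u z) \<in> borel_measurable borel"
    using assms by (intro borel_measurable_times) (simp_all add: Lr_polydisc_def)
  ultimately show ?thesis using assms(1) by (simp add: Lr_polydisc_def)
qed

lemma Lr_polydisc_cmult: "Lr_polydisc r \<rho> u \<Longrightarrow> Lr_polydisc r \<rho> (\<lambda>z. c * u z)"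
  by (rule Lr_polydisc_mult[of _ _ _ "\<lambda>z. c" "norm c"]) auto

text \<open>\<open>cauchy_T j\<close> shifts only the coordinate \<open>j\<close>, so in the other
  coordinates the support keeps its radius \<open>\<rho>\<close>; in coordinate \<open>j\<close> the
  factor \<open>a\<close> confines it to \<open>\<rho>'\<close>.\<close>

lemma Lr_polydisc_cauchy_T:
  fixes u :: "complex ^ 'n::finite \<Rightarrow> complex"
  assumes u: "Lr_polydisc r \<rho> u" and r: "1 \<le> r" and \<rho>: "\<rho> \<le> \<rho>'"
    and a: "continuous_on UNIV a" "\<And>w. norm w \<ge> \<rho>' \<Longrightarrow> a w = 0"
  shows "Lr_polydisc r \<rho>' (\<lambda>z. a (z $ j) * cauchy_T j u z)"
proof -
  have um: "u \<in> borel_measurable borel" "u \<in> Lr_fun r" using u by (auto simp: Lr_polydisc_def)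
  have "bounded {w. a w \<noteq> 0}"
    using a(2) by (intro boundedI[of _ \<rho>']) (metis linear mem_Collect_eq)
  then obtain B where B: "\<And>w. norm (a w) \<le> B"
    using continuous_bounded_support_bound[OF a(1)] by metis
  have Tm: "cauchy_T j u \<in> borel_measurable borel" "cauchy_T j u \<in> Lr_fun r"
    unfolding cauchy_T_def
    by (rule conv_measurable(2)[OF linear_axis _ um(1)], use cauchy_ker_integrable in auto)
      (rule conv_Lr[OF linear_axis cauchy_ker_integrable um r])
  have am: "(\<lambda>z::complex ^ 'n. a (z $ j)) \<in> borel_measurable borel"
    by (intro borel_measurable_continuous_onI continuous_on_compose2[OF a(1)] continuous_intros) auto
  then have am': "(\<lambda>z::complex ^ 'n. a (z $ j)) \<in> borel_measurable lebesgue"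
    by (intro measurable_completion) simp
  have supp: "norm (z $ i) \<le> \<rho>'" if z: "a (z $ j) * cauchy_T j u z \<noteq> 0" for z :: "complex ^ 'n" and i
  proof (cases "i = j")
    case True
    then show ?thesis using z a(2)[of "z $ j"] by force
  next
    case False
    have "cauchy_T j u z \<noteq> 0" using z by auto
    then obtain w where "cauchy_ker w * u (z - axis j w) \<noteq> 0"
      unfolding cauchy_T_def conv_def by (metis (no_types, lifting) Bochner_Integration.integral_cong integral_zero)
    then have "norm ((z - axis j w) $ i) \<le> \<rho>" using u by (auto simp: Lr_polydisc_def)
    then show ?thesis using False \<rho> by (simp add: axis_def)
  qed
  show ?thesis
    unfolding Lr_polydisc_def
  proof (intro conjI allI impI)
    show "(\<lambda>z. a (z $ j) * cauchy_T j u z) \<in> borel_measurable borel" using am Tm by auto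
    show "(\<lambda>z. a (z $ j) * cauchy_T j u z) \<in> Lr_fun r"
      by (rule Lr_fun_mult_bounded[OF Tm(2) am', where B=B]) (rule B)
  qed (rule supp)
qed

text \<open>The sign with which \<open>d zbar_i \<and> d zbar_(K - {i})\<close> equals \<open>d zbar_K\<close>.\<close>

abbreviation sg :: "'n::linorder \<Rightarrow> 'n set \<Rightarrow> complex" where
  "sg i K \<equiv> (-1) ^ card {l\<in>K. l < i}"

lemma sg_square: "sg i K * sg i K = 1"
  by (rule minus_one_mult_self)

text \<open>This is the rule, read on coefficients, that wedging with \<open>d zbar_i\<close>
  anticommutes with contraction by \<open>d zbar_j\<close> for distinct \<open>i\<close> and
  \<open>j\<close>. If \<open>i < j\<close>, deleting \<open>i\<close> moves \<open>j\<close> by one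
  place; otherwise inserting \<open>j\<close> moves \<open>i\<close> by one place.\<close>

lemma sg_swap:
  fixes i j :: "'n::{finite,linorder}"
  assumes "i \<in> I" "j \<notin> I"
  shows "sg i I * sg j (insert j (I - {i})) = - (sg j (insert j I) * sg i (insert j I))"
proof -
  have ij: "i \<noteq> j" using assms by auto
  show ?thesis
  proof (cases "i < j")
    case True
    have "{l\<in>insert j I. l < i} = {l\<in>I. l < i}" using True by auto
    moreover have "{l\<in>insert j I. l < j} = insert i {l\<in>insert j (I - {i}). l < j}" using True assms by auto
    moreover have "card (insert i {l\<in>insert j (I - {i}). l < j}) = Suc (card {l\<in>insert j (I - {i}). l < j})"
      by (rule card_insert_disjoint) (use ij in auto)
    ultimately show ?thesis by simp
  next
    case False
    have "{l\<in>insert j I. l < i} = insert j {l\<in>I. l < i}" using False ij by auto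
    moreover have "card (insert j {l\<in>I. l < i}) = Suc (card {l\<in>I. l < i})"
      by (rule card_insert_disjoint) (use assms in auto)
    moreover have "{l\<in>insert j I. l < j} = {l\<in>insert j (I - {i}). l < j}" using False by auto
    ultimately show ?thesis by simp
  qed
qed

definition closed_form :: "nat \<Rightarrow> 'n::{finite,linorder} form \<Rightarrow> bool" where
  "closed_form q \<omega> \<longleftrightarrow> (\<forall>K \<phi>. card K = q + 1 \<longrightarrow> C1c \<phi> \<longrightarrow>
     (\<Sum>i\<in>K. sg i K * (LBINT z. \<omega> (K - {i}) z * dzbar i \<phi> z)) = 0)"

text \<open>The pairing of the \<open>I\<close>-component of \<open>dbar\<close> of
  \<open>\<beta>\<close> with \<open>\<phi>\<close>; the leading minus sign is that of
  \<open>distribution_dzbar\<close>. In \<open>closed_form\<close> it is dropped because the right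
  side is 0.\<close>

definition dbar_pair :: "'n::{finite,linorder} form \<Rightarrow> 'n set \<Rightarrow> ((complex, 'n) vec \<Rightarrow> complex) \<Rightarrow> complex" where
  "dbar_pair \<beta> I \<phi> = - (\<Sum>i\<in>I. sg i I * (LBINT z. \<beta> (I - {i}) z * dzbar i \<phi> z))"

lemma cauchy_T_pairing:
  assumes u: "integrable lborel u" and a: "continuous_on UNIV a" and \<phi>: "continuous_on UNIV \<phi>" "bounded {z. \<phi> z \<noteq> 0}"
  shows "(LBINT z. a z * cauchy_T j u z * \<phi> z) = - (LBINT z. u z * cauchy_T j (\<lambda>z. a z * \<phi> z) z)"
proof -
  have c: "continuous_on UNIV (\<lambda>z. a z * \<phi> z)" by (intro continuous_intros a \<phi>)
  have "bounded {z. a z * \<phi> z \<noteq> 0}" by (rule bounded_subset[OF \<phi>(2)]) auto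
  then obtain B where B: "\<And>z. norm (a z * \<phi> z) \<le> B"
    using continuous_bounded_support_bound[OF c] by metis
  have "(LBINT z. cauchy_T j u z * (a z * \<phi> z)) = - (LBINT z. u z * cauchy_T j (\<lambda>z. a z * \<phi> z) z)"
    unfolding cauchy_T_def
    by (rule conv_transpose[OF linear_axis cauchy_ker_integrable u borel_measurable_continuous_onI[OF c] B cauchy_ker_odd])
  then show ?thesis by (simp add: mult_ac)
qed

lemma integrable_mult_continuous:
  fixes \<psi> :: "'a::euclidean_space \<Rightarrow> complex"
  assumes "integrable lborel u" "continuous_on UNIV \<psi>" "bounded {z. \<psi> z \<noteq> 0}"
  shows "integrable lborel (\<lambda>z. u z * \<psi> z)"
proof -
  obtain B where B: "\<And>z. norm (\<psi> z) \<le> B"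
    using continuous_bounded_support_bound[OF assms(2,3)] by metis
  show ?thesis
  proof (rule Bochner_Integration.integrable_bound[OF integrable_mult_right[OF assms(1), of "of_real B"]])
    show "(\<lambda>z. u z * \<psi> z) \<in> borel_measurable lborel"
      using assms(1) borel_measurable_continuous_onI[OF assms(2)] by (intro borel_measurable_times) auto
    have "norm (u z * \<psi> z) \<le> norm (of_real B * u z)" for z
      using mult_left_mono[OF B[of z], of "norm (u z)"] order_trans[OF norm_ge_zero B[of z]] by (simp add: norm_mult mult.commute)
    then show "AE z in lborel. norm (u z * \<psi> z) \<le> norm (of_real B * u z)" by simp
  qed
qed

lemma integrable_mult_C1c: "integrable lborel u \<Longrightarrow> C1c \<psi> \<Longrightarrow> integrable lborel (\<lambda>z. u z * \<psi> z)"
  by (rule integrable_mult_continuous[OF _ C1c_continuous]) (simp_all add: C1c_def)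

text \<open>As far as \<open>dzbar\<close> can see, \<open>a\<close> depends on \<open>z_j\<close>
  alone, so it commutes with every other \<open>dzbar i\<close>. \<open>\<psi>\<close> is the test
  function into which the equations for \<open>\<omega>\<close> are later fed, once for the cutoff
  itself and once for its \<open>dbar\<close> derivative.\<close>

lemma cauchy_T_cutoff:
  fixes a \<phi> :: "complex ^ 'n::finite \<Rightarrow> complex" and j :: 'n
  assumes a: "C1_on UNIV a" "\<forall>z. norm (z $ j) \<ge> 1 \<longrightarrow> a z = 0" "\<forall>i z. i \<noteq> j \<longrightarrow> dzbar i a z = 0"
    and \<phi>: "C1c \<phi>"
  defines "\<psi> \<equiv> cauchy_T j (\<lambda>z. a z * \<phi> z)"
  shows "C1c \<psi>"
    and "integrable lborel u \<Longrightarrow> i \<noteq> j \<Longrightarrow>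
      (LBINT z. a z * cauchy_T j u z * dzbar i \<phi> z) = - (LBINT z. u z * dzbar i \<psi> z)"
    and "norm (z $ j) < 1 \<Longrightarrow> dzbar j \<psi> z = a z * \<phi> z"
proof -
  have a\<phi>: "C1c (\<lambda>z. a z * \<phi> z)" by (rule C1c_mult[OF \<phi> a(1)])
  then show "C1c \<psi>" unfolding \<psi>_def by (rule cauchy_T_C1c)
  have da: "a differentiable (at z)" and d\<phi>: "\<phi> differentiable (at z)" for z
    using a(1) \<phi> by (auto simp: C1_on_def C1c_def)
  show "(LBINT z. a z * cauchy_T j u z * dzbar i \<phi> z) = - (LBINT z. u z * dzbar i \<psi> z)"
    if u: "integrable lborel u" and i: "i \<noteq> j"
  proof -
    have "(\<lambda>z. a z * dzbar i \<phi> z) = dzbar i (\<lambda>z. a z * \<phi> z)"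
      using dzbar_mult[OF da d\<phi>] a(3) i by (simp add: fun_eq_iff)
    moreover have "(LBINT z. a z * cauchy_T j u z * dzbar i \<phi> z) = - (LBINT z. u z * cauchy_T j (\<lambda>z. a z * dzbar i \<phi> z) z)"
      by (rule cauchy_T_pairing[OF u C1_on_continuous_on[OF a(1)] dzbar_continuous[OF \<phi>] dzbar_support[OF \<phi>]])
    ultimately show ?thesis
      by (simp add: \<psi>_def dzbar_cauchy_T[OF a\<phi>])
  qed
  show "dzbar j \<psi> z = a z * \<phi> z" if "norm (z $ j) < 1"
    unfolding \<psi>_def dzbar_cauchy_T[OF a\<phi>]
    by (rule cauchy_T_dzbar[OF a\<phi> _ that]) (use a(2) in \<open>force simp: not_le[symmetric]\<close>)
qed

text \<open>The form \<open>\<omega>'\<close> is the error made by cutting off the Cauchy transform of \<open>\<omega>\<close>.\<close>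

lemma dbar_homotopy_step:
  fixes \<omega> :: "'n::{finite,linorder} form" and j :: 'n
  assumes r: "1 \<le> r" and \<rho>: "0 \<le> \<rho>" "\<rho> < \<rho>'" "\<rho>' < 1" and q: "1 \<le> q"
    and g: "\<And>I. card I = q \<Longrightarrow> Lr_polydisc r \<rho> (\<omega> I)" and cl: "closed_form q \<omega>"
  shows "\<exists>\<beta> \<omega>'. (\<forall>I. card I = q - 1 \<longrightarrow> Lr_polydisc r \<rho>' (\<beta> I)) \<and>
    (\<forall>I. card I = q \<longrightarrow> Lr_polydisc r \<rho>' (\<omega>' I)) \<and> closed_form q \<omega>' \<and>
    (\<forall>I. j \<notin> I \<or> \<omega> I = (\<lambda>z. 0) \<longrightarrow> \<omega>' I = (\<lambda>z. 0)) \<and>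
    (\<forall>I \<phi>. card I = q \<longrightarrow> C1c \<phi> \<longrightarrow>
       dbar_pair \<beta> I \<phi> = (LBINT z. \<omega> I z * \<phi> z) - (LBINT z. \<omega>' I z * \<phi> z))"
proof -
  obtain \<theta> where \<theta>: "C1_on UNIV \<theta>" "C1_on UNIV (dbar1 \<theta>)"
    "\<And>w. norm w \<le> \<rho> \<Longrightarrow> \<theta> w = 1" "\<And>w. norm w \<le> \<rho> \<Longrightarrow> dbar1 \<theta> w = 0"
    "\<And>w. norm w \<ge> \<rho>' \<Longrightarrow> \<theta> w = 0" "\<And>w. norm w \<ge> \<rho>' \<Longrightarrow> dbar1 \<theta> w = 0"
    using C2_cutoff_exists[OF \<rho>(1,2)] by metis
  \<comment> \<open>\<open>X\<close> is the cutoff in \<open>z_j\<close> and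
    \<open>\<Lambda>\<close> below is its \<open>dbar\<close> derivative; \<open>X = 1\<close> and
    \<open>\<Lambda> = 0\<close> wherever the components of degree \<open>q\<close> of
    \<open>\<omega>\<close> live.\<close>
  define X where "X = (\<lambda>z::(complex, 'n) vec. \<theta> (z $ j))"
  define \<Lambda> where "\<Lambda> = (\<lambda>z::(complex, 'n) vec. dbar1 \<theta> (z $ j))"
  have X1: "C1_on UNIV X" and \<Lambda>1: "C1_on UNIV \<Lambda>"
    unfolding X_def \<Lambda>_def by (intro C1_on_component \<theta>)+
  have dXj: "\<And>z. dzbar j X z = \<Lambda> z" and dXi: "\<forall>i z. i \<noteq> j \<longrightarrow> dzbar i X z = 0"
    and d\<Lambda>i: "\<forall>i z. i \<noteq> j \<longrightarrow> dzbar i \<Lambda> z = 0"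
    unfolding X_def \<Lambda>_def using dzbar_component[OF \<theta>(1)] dzbar_component[OF \<theta>(2)] by auto
  have X0: "\<forall>z. norm (z $ j) \<ge> 1 \<longrightarrow> X z = 0" and \<Lambda>0: "\<forall>z. norm (z $ j) \<ge> 1 \<longrightarrow> \<Lambda> z = 0"
    unfolding X_def \<Lambda>_def using \<theta>(5,6) \<rho> by auto
  note XT = cauchy_T_cutoff[OF X1 X0 dXi] and \<Lambda>T = cauchy_T_cutoff[OF \<Lambda>1 \<Lambda>0 d\<Lambda>i]
  have int: "integrable lborel (\<omega> I)" if "card I = q" for I using Lr_polydisc_integrable[OF g[OF that] r] .
  have supp: "norm (z $ j) \<le> \<rho>" if "card I = q" "\<omega> I z \<noteq> 0" for I z
    using g[OF that(1)] that(2) by (auto simp: Lr_polydisc_def)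
  \<comment> \<open>The sign brings \<open>d zbar_j\<close> to the front before the contraction
    removes it.\<close>
  define \<beta> where "\<beta> I = (\<lambda>z. if j \<in> I then 0 else sg j (insert j I) * (X z * cauchy_T j (\<omega> (insert j I)) z))" for I
  define \<omega>' where "\<omega>' I = (\<lambda>z. if j \<in> I then - 1 * (\<Lambda> z * cauchy_T j (\<omega> I) z) else 0)" for I
  have T0: "cauchy_T j (\<lambda>z. 0) z = 0" for z by (simp add: cauchy_T_def conv_def)
  show ?thesis
  proof (rule exI[of _ \<beta>], rule exI[of _ \<omega>'], intro conjI allI impI)
    show "Lr_polydisc r \<rho>' (\<beta> I)" if "card I = q - 1" for I
    proof (cases "j \<in> I")
      case True then show ?thesis by (simp add: \<beta>_def Lr_polydisc_zero)
    next
      case False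
      then have "card (insert j I) = q" using that q by simp
      from Lr_polydisc_cauchy_T[OF g[OF this] r _ C1_on_continuous_on[OF \<theta>(1)] \<theta>(5), where j=j]
      show ?thesis using False \<rho> by (simp add: \<beta>_def X_def Lr_polydisc_cmult)
    qed
    show "Lr_polydisc r \<rho>' (\<omega>' I)" if "card I = q" for I
    proof (cases "j \<in> I")
      case True
      from Lr_polydisc_cauchy_T[OF g[OF that] r _ C1_on_continuous_on[OF \<theta>(2)] \<theta>(6), where j=j]
      have "Lr_polydisc r \<rho>' (\<lambda>z. - 1 * (\<Lambda> z * cauchy_T j (\<omega> I) z))" using \<rho> unfolding \<Lambda>_def by (intro Lr_polydisc_cmult) auto
      then show ?thesis using True by (simp add: \<omega>'_def)
    qed (simp add: \<omega>'_def Lr_polydisc_zero)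
    \<comment> \<open>Components that are already zero remain zero, which lets the gains of
      successive variables add up.\<close>
    show "\<omega>' I = (\<lambda>z. 0)" if "j \<notin> I \<or> \<omega> I = (\<lambda>z. 0)" for I
      using that by (auto simp: \<omega>'_def T0)
    show "closed_form q \<omega>'"
      unfolding closed_form_def
    proof (intro allI impI)
      fix K :: "'n set" and \<phi> :: "(complex, 'n) vec \<Rightarrow> complex"
      assume K: "card K = q + 1" and \<phi>: "C1c \<phi>"
      let ?\<psi> = "cauchy_T j (\<lambda>z. \<Lambda> z * \<phi> z)"
      show "(\<Sum>i\<in>K. sg i K * (LBINT z. \<omega>' (K - {i}) z * dzbar i \<phi> z)) = 0"
      proof (cases "j \<in> K")
        case False
        then show ?thesis by (simp add: \<omega>'_def)
      next
        case True
        \<comment> \<open>The term \<open>i = j\<close> drops out, since \<open>\<omega>'\<close> is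
          zero on index sets without \<open>j\<close>; in the others the cut off transform is
          transposed.\<close>
        have "(\<Sum>i\<in>K. sg i K * (LBINT z. \<omega>' (K - {i}) z * dzbar i \<phi> z)) =
          (\<Sum>i\<in>K - {j}. sg i K * (LBINT z. \<omega>' (K - {i}) z * dzbar i \<phi> z))"
          using True by (subst sum.remove[OF _ True]) (auto simp: \<omega>'_def)
        also have "\<dots> = (\<Sum>i\<in>K - {j}. sg i K * (LBINT z. \<omega> (K - {i}) z * dzbar i ?\<psi> z))"
        proof (rule sum.cong[OF refl])
          fix i assume i: "i \<in> K - {j}"
          have "card (K - {i}) = q" using K i by simp
          then have "(LBINT z. \<Lambda> z * cauchy_T j (\<omega> (K - {i})) z * dzbar i \<phi> z) = - (LBINT z. \<omega> (K - {i}) z * dzbar i ?\<psi> z)"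
            using \<Lambda>T(2)[OF \<phi> int] i by auto
          moreover have "\<omega>' (K - {i}) = (\<lambda>z. - (\<Lambda> z * cauchy_T j (\<omega> (K - {i})) z))"
            using i True by (auto simp: \<omega>'_def)
          ultimately show "sg i K * (LBINT z. \<omega>' (K - {i}) z * dzbar i \<phi> z) = sg i K * (LBINT z. \<omega> (K - {i}) z * dzbar i ?\<psi> z)"
            by simp
        qed
        \<comment> \<open>Closedness of \<open>\<omega>\<close>, tested against
          \<open>?\<psi>\<close>, trades these terms for the term with \<open>i = j\<close>.\<close>
        also have "\<dots> = - (sg j K * (LBINT z. \<omega> (K - {j}) z * dzbar j ?\<psi> z))"
        proof -
          have "(\<Sum>i\<in>K. sg i K * (LBINT z. \<omega> (K - {i}) z * dzbar i ?\<psi> z)) = 0"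
            using cl K \<Lambda>T(1)[OF \<phi>] unfolding closed_form_def by blast
          then show ?thesis
            by (subst (asm) sum.remove[OF _ True]) (auto simp: eq_neg_iff_add_eq_0 add.commute)
        qed
        \<comment> \<open>The inversion formula gives
          \<open>dzbar j ?\<psi> z = \<Lambda> z * \<phi> z\<close> on the unit disc in
          \<open>z_j\<close>, and \<open>\<Lambda>\<close> vanishes on the support of
          \<open>\<omega>\<close>.\<close>
        also have "(LBINT z. \<omega> (K - {j}) z * dzbar j ?\<psi> z) = (\<integral>z. 0 \<partial>(lborel :: ((complex, 'n) vec) measure))"
        proof (rule Bochner_Integration.integral_cong[OF refl])
          fix z
          have "card (K - {j}) = q" using K True by simp
          from supp[OF this, of z] show "\<omega> (K - {j}) z * dzbar j ?\<psi> z = 0"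
            using \<Lambda>T(3)[OF \<phi>, of z] \<theta>(4)[of "z $ j"] \<rho> by (cases "\<omega> (K - {j}) z = 0") (auto simp: \<Lambda>_def)
        qed
        finally show ?thesis by simp
      qed
    qed
    show "dbar_pair \<beta> I \<phi> = (LBINT z. \<omega> I z * \<phi> z) - (LBINT z. \<omega>' I z * \<phi> z)"
      if I: "card I = q" and \<phi>: "C1c \<phi>" for I \<phi>
    proof (cases "j \<in> I")
      case True
      let ?\<psi> = "cauchy_T j (\<lambda>z. \<Lambda> z * \<phi> z)"
      have X\<phi>: "C1c (\<lambda>z. X z * \<phi> z)" and \<Lambda>\<phi>: "C1c (\<lambda>z. \<Lambda> z * \<phi> z)"
        using C1c_mult[OF \<phi>] X1 \<Lambda>1 by auto
      \<comment> \<open>By the product rule \<open>X * dzbar j \<phi>\<close> is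
        \<open>dzbar j\<close> of \<open>X * \<phi>\<close> minus \<open>\<Lambda> * \<phi>\<close>.
        Inversion applies to the first part, and the second produces the error term.\<close>
      have T: "cauchy_T j (\<lambda>z. X z * dzbar j \<phi> z) z = X z * \<phi> z - ?\<psi> z" if "norm (z $ j) < 1" for z
      proof -
        have "X differentiable (at z)" "\<phi> differentiable (at z)" for z
          using X1 \<phi> by (auto simp: C1_on_def C1c_def)
        from dzbar_mult[OF this, of j] have eq: "(\<lambda>z. X z * dzbar j \<phi> z) = (\<lambda>z. dzbar j (\<lambda>z. X z * \<phi> z) z - \<Lambda> z * \<phi> z)"
          by (simp add: fun_eq_iff dXj)
        have "cauchy_T j (\<lambda>z. X z * dzbar j \<phi> z) z = cauchy_T j (dzbar j (\<lambda>z. X z * \<phi> z)) z - ?\<psi> z"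
          unfolding eq unfolding cauchy_T_def conv_def right_diff_distrib
        proof (rule Bochner_Integration.integral_diff)
          show "integrable lborel (\<lambda>w. cauchy_ker w * dzbar j (\<lambda>z. X z * \<phi> z) (z - axis j w))"
            by (rule conv_integrable[OF cauchy_ker_integrable linear_axis dzbar_continuous[OF X\<phi>] dzbar_support[OF X\<phi>]])
          show "integrable lborel (\<lambda>w. cauchy_ker w * (\<Lambda> (z - axis j w) * \<phi> (z - axis j w)))"
            by (rule conv_integrable[OF cauchy_ker_integrable linear_axis C1c_continuous[OF \<Lambda>\<phi>]]) (use \<Lambda>\<phi> in \<open>simp add: C1c_def\<close>)
        qed
        also have "cauchy_T j (dzbar j (\<lambda>z. X z * \<phi> z)) z = X z * \<phi> z"
          by (rule cauchy_T_dzbar[OF X\<phi> _ that]) (use X0 in \<open>force simp: not_le[symmetric]\<close>)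
        finally show ?thesis .
      qed
      \<comment> \<open>Only \<open>i = j\<close> contributes: every other \<open>I - {i}\<close>
        still contains \<open>j\<close>, where \<open>\<beta>\<close> is zero.\<close>
      have "\<beta> (I - {i}) = (\<lambda>z. 0)" if "i \<noteq> j" for i using that True by (auto simp: \<beta>_def)
      then have "(\<Sum>i\<in>I - {j}. sg i I * (LBINT z. \<beta> (I - {i}) z * dzbar i \<phi> z)) = 0"
        by (intro sum.neutral) simp
      then have "dbar_pair \<beta> I \<phi> = - (sg j I * (LBINT z. \<beta> (I - {j}) z * dzbar j \<phi> z))"
        unfolding dbar_pair_def by (subst sum.remove[OF _ True]) simp_all
      also have "\<beta> (I - {j}) = (\<lambda>z. sg j I * (X z * cauchy_T j (\<omega> I) z))"
        using True by (simp add: \<beta>_def insert_absorb)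
      also have "- (sg j I * (LBINT z. sg j I * (X z * cauchy_T j (\<omega> I) z) * dzbar j \<phi> z))
          = - (LBINT z. X z * cauchy_T j (\<omega> I) z * dzbar j \<phi> z)"
        using sg_square[where i=j and K=I]
        by (subst mult.assoc, subst integral_mult_right_zero, subst mult.assoc[symmetric]) simp
      also have "\<dots> = (LBINT z. \<omega> I z * cauchy_T j (\<lambda>z. X z * dzbar j \<phi> z) z)"
        by (subst cauchy_T_pairing[OF int[OF I] C1_on_continuous_on[OF X1] dzbar_continuous[OF \<phi>] dzbar_support[OF \<phi>]]) simp
      also have "\<dots> = (LBINT z. \<omega> I z * \<phi> z - \<omega> I z * ?\<psi> z)"
      proof (rule Bochner_Integration.integral_cong[OF refl])
        fix z
        show "\<omega> I z * cauchy_T j (\<lambda>z. X z * dzbar j \<phi> z) z = \<omega> I z * \<phi> z - \<omega> I z * ?\<psi> z"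
        proof (cases "\<omega> I z = 0")
          case False
          then have "norm (z $ j) \<le> \<rho>" using supp[OF I] by blast
          then have "X z = 1" "cauchy_T j (\<lambda>z. X z * dzbar j \<phi> z) z = X z * \<phi> z - ?\<psi> z"
            using \<theta>(3) T[of z] \<rho> by (auto simp: X_def)
          then show ?thesis by (simp add: right_diff_distrib)
        qed simp
      qed
      also have "\<dots> = (LBINT z. \<omega> I z * \<phi> z) - (LBINT z. \<omega> I z * ?\<psi> z)"
        by (rule Bochner_Integration.integral_diff) (intro integrable_mult_C1c int I \<phi> \<Lambda>T(1))+
      also have "(LBINT z. \<omega> I z * ?\<psi> z) = (LBINT z. \<omega>' I z * \<phi> z)"
        using cauchy_T_pairing[OF int[OF I] C1_on_continuous_on[OF \<Lambda>1] C1c_continuous[OF \<phi>], where j=j] \<phi> True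
        by (simp add: \<omega>'_def C1c_def)
      finally show ?thesis .
    next
      case False
      let ?\<psi> = "cauchy_T j (\<lambda>z. X z * \<phi> z)" and ?K = "insert j I"
      have K: "card ?K = q + 1" using False I by simp
      \<comment> \<open>Up to signs, the terms are those of the closedness relation of
        \<open>\<omega>\<close> for \<open>insert j I\<close>, tested against
        \<open>?\<psi>\<close>, with the term for \<open>j\<close> missing. That missing term is the
        desired right side.\<close>
      have "dbar_pair \<beta> I \<phi> = (\<Sum>i\<in>I. - (sg i I * (LBINT z. \<beta> (I - {i}) z * dzbar i \<phi> z)))"
        unfolding dbar_pair_def by (simp add: sum_negf)
      also have "\<dots> = (\<Sum>i\<in>I. - sg j ?K * (sg i ?K * (LBINT z. \<omega> (?K - {i}) z * dzbar i ?\<psi> z)))"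
      proof (rule sum.cong[OF refl])
        fix i assume i: "i \<in> I"
        then have ij: "i \<noteq> j" using False by auto
        have eq: "insert j (I - {i}) = ?K - {i}" using ij by auto
        have "card (?K - {i}) = q" using K i by simp
        from XT(2)[OF \<phi> int[OF this] ij]
        have "sg j (insert j (I - {i})) * (LBINT z. X z * cauchy_T j (\<omega> (?K - {i})) z * dzbar i \<phi> z)
          = sg j (insert j (I - {i})) * - (LBINT z. \<omega> (?K - {i}) z * dzbar i ?\<psi> z)" by simp
        moreover have "\<beta> (I - {i}) = (\<lambda>z. sg j (insert j (I - {i})) * (X z * cauchy_T j (\<omega> (?K - {i})) z))"
          using False unfolding \<beta>_def eq by auto
        ultimately have "(LBINT z. \<beta> (I - {i}) z * dzbar i \<phi> z) = sg j (insert j (I - {i})) * - (LBINT z. \<omega> (?K - {i}) z * dzbar i ?\<psi> z)"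
          by (simp add: mult.assoc)
        then have "- (sg i I * (LBINT z. \<beta> (I - {i}) z * dzbar i \<phi> z))
          = (sg i I * sg j (insert j (I - {i}))) * (LBINT z. \<omega> (?K - {i}) z * dzbar i ?\<psi> z)" by simp
        then show "- (sg i I * (LBINT z. \<beta> (I - {i}) z * dzbar i \<phi> z))
          = - sg j ?K * (sg i ?K * (LBINT z. \<omega> (?K - {i}) z * dzbar i ?\<psi> z))"
          unfolding sg_swap[OF i False] by simp
      qed
      also have "\<dots> = - sg j ?K * (\<Sum>i\<in>I. sg i ?K * (LBINT z. \<omega> (?K - {i}) z * dzbar i ?\<psi> z))"
        by (rule sum_distrib_left[symmetric])
      also have "(\<Sum>i\<in>I. sg i ?K * (LBINT z. \<omega> (?K - {i}) z * dzbar i ?\<psi> z)) = - (sg j ?K * (LBINT z. \<omega> I z * dzbar j ?\<psi> z))"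
      proof -
        have "(\<Sum>i\<in>?K. sg i ?K * (LBINT z. \<omega> (?K - {i}) z * dzbar i ?\<psi> z)) = 0"
          using cl K XT(1)[OF \<phi>] unfolding closed_form_def by blast
        then show ?thesis
          using False by (subst (asm) sum.insert) (auto simp: eq_neg_iff_add_eq_0 add.commute)
      qed
      also have "- sg j ?K * - (sg j ?K * (LBINT z. \<omega> I z * dzbar j ?\<psi> z)) = (LBINT z. \<omega> I z * dzbar j ?\<psi> z)"
        using sg_square[where i=j and K="?K"] by (simp flip: mult.assoc)
      \<comment> \<open>On the support of \<open>\<omega>\<close> the cutoff \<open>X\<close> is 1,
        so there \<open>dzbar j ?\<psi>\<close> is just \<open>\<phi>\<close>.\<close>
      also have "\<dots> = (LBINT z. \<omega> I z * \<phi> z)"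
      proof (rule Bochner_Integration.integral_cong[OF refl])
        fix z
        show "\<omega> I z * dzbar j ?\<psi> z = \<omega> I z * \<phi> z"
          using supp[OF I, of z] XT(3)[OF \<phi>, of z] \<theta>(3)[of "z $ j"] \<rho> by (cases "\<omega> I z = 0") (auto simp: X_def)
      qed
      finally show ?thesis using False by (simp add: \<omega>'_def)
    qed
  qed
qed

lemma dbar_pair_add:
  fixes \<beta> \<beta>' :: "'n::{finite,linorder} form"
  assumes "\<And>J. card J = q - 1 \<Longrightarrow> integrable lborel (\<beta> J)" "\<And>J. card J = q - 1 \<Longrightarrow> integrable lborel (\<beta>' J)"
    and "card I = q" "C1c \<phi>"
  shows "dbar_pair (\<lambda>J z. \<beta> J z + \<beta>' J z) I \<phi> = dbar_pair \<beta> I \<phi> + dbar_pair \<beta>' I \<phi>"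
proof -
  have "(LBINT z. (\<beta> (I - {i}) z + \<beta>' (I - {i}) z) * dzbar i \<phi> z) =
     (LBINT z. \<beta> (I - {i}) z * dzbar i \<phi> z) + (LBINT z. \<beta>' (I - {i}) z * dzbar i \<phi> z)" if "i \<in> I" for i
  proof -
    have "card (I - {i}) = q - 1" using assms(3) that by simp
    then show ?thesis
      unfolding distrib_right using assms(1,2)
      by (intro Bochner_Integration.integral_add integrable_mult_continuous dzbar_continuous dzbar_support assms(4))
  qed
  then show ?thesis
    by (simp add: dbar_pair_def distrib_left sum.distrib)
qed

text \<open>Induction over the variables already treated: components that miss one of them are zero
  and remain so. The radius is existential because each step enlarges it.\<close>

lemma dbar_homotopy:
  fixes \<omega> :: "'n::{finite,linorder} form"
  assumes r: "1 \<le> r" and \<rho>: "0 \<le> \<rho>" "\<rho> < 1" and q: "1 \<le> q"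
    and g: "\<And>I. card I = q \<Longrightarrow> Lr_polydisc r \<rho> (\<omega> I)" and cl: "closed_form q \<omega>"
    and "finite S"
  shows "\<exists>\<rho>' \<beta> \<omega>'. 0 \<le> \<rho>' \<and> \<rho>' < 1 \<and> (\<forall>I. card I = q - 1 \<longrightarrow> Lr_polydisc r \<rho>' (\<beta> I)) \<and>
    (\<forall>I. card I = q \<longrightarrow> Lr_polydisc r \<rho>' (\<omega>' I)) \<and> closed_form q \<omega>' \<and>
    (\<forall>I. \<not> S \<subseteq> I \<longrightarrow> \<omega>' I = (\<lambda>z. 0)) \<and>
    (\<forall>I \<phi>. card I = q \<longrightarrow> C1c \<phi> \<longrightarrow>
       dbar_pair \<beta> I \<phi> = (LBINT z. \<omega> I z * \<phi> z) - (LBINT z. \<omega>' I z * \<phi> z))"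
  using \<open>finite S\<close>
proof (induction S)
  case empty
  show ?case
    by (rule exI[of _ \<rho>], rule exI[of _ "\<lambda>I z. 0"], rule exI[of _ \<omega>])
      (use \<rho> g cl in \<open>auto simp: Lr_polydisc_zero dbar_pair_def\<close>)
next
  case (insert j S)
  then obtain \<rho>1 \<beta>1 \<omega>1 where "0 \<le> \<rho>1" "\<rho>1 < 1" "\<forall>I. card I = q - 1 \<longrightarrow> Lr_polydisc r \<rho>1 (\<beta>1 I)"
    "\<forall>I. card I = q \<longrightarrow> Lr_polydisc r \<rho>1 (\<omega>1 I)" "closed_form q \<omega>1"
    "\<forall>I. \<not> S \<subseteq> I \<longrightarrow> \<omega>1 I = (\<lambda>z. 0)"
    "\<forall>I \<phi>. card I = q \<longrightarrow> C1c \<phi> \<longrightarrow> dbar_pair \<beta>1 I \<phi> = (LBINT z. \<omega> I z * \<phi> z) - (LBINT z. \<omega>1 I z * \<phi> z)"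
    by blast
  note 1 = this[rule_format]
  \<comment> \<open>The new cutoff uses up half of the remaining gap to 1.\<close>
  define \<rho>2 where "\<rho>2 = (\<rho>1 + 1) / 2"
  have \<rho>2: "\<rho>1 < \<rho>2" "\<rho>2 < 1" using 1(2) by (auto simp: \<rho>2_def)
  obtain \<beta>2 \<omega>2 where "\<forall>I. card I = q - 1 \<longrightarrow> Lr_polydisc r \<rho>2 (\<beta>2 I)"
    "\<forall>I. card I = q \<longrightarrow> Lr_polydisc r \<rho>2 (\<omega>2 I)" "closed_form q \<omega>2"
    "\<forall>I. j \<notin> I \<or> \<omega>1 I = (\<lambda>z. 0) \<longrightarrow> \<omega>2 I = (\<lambda>z. 0)"
    "\<forall>I \<phi>. card I = q \<longrightarrow> C1c \<phi> \<longrightarrow> dbar_pair \<beta>2 I \<phi> = (LBINT z. \<omega>1 I z * \<phi> z) - (LBINT z. \<omega>2 I z * \<phi> z)"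
    using dbar_homotopy_step[where j=j, OF r 1(1) \<rho>2 q 1(4) 1(5)] by blast
  note 2 = this[rule_format]
  have g1: "Lr_polydisc r \<rho>2 (\<beta>1 I)" if "card I = q - 1" for I
    using Lr_polydisc_mono[OF 1(3)[OF that]] \<rho>2 by simp
  show ?case
  proof (rule exI[of _ \<rho>2], rule exI[of _ "\<lambda>I z. \<beta>1 I z + \<beta>2 I z"], rule exI[of _ \<omega>2], intro conjI allI impI)
    show "0 \<le> \<rho>2" "\<rho>2 < 1" using \<rho>2 1(1) by auto
    show "Lr_polydisc r \<rho>2 (\<lambda>z. \<beta>1 I z + \<beta>2 I z)" if "card I = q - 1" for I
      using g1[OF that] 2(1)[OF that] by (rule Lr_polydisc_add)
    show "\<omega>2 I = (\<lambda>z. 0)" if "\<not> insert j S \<subseteq> I" for I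
      using that 1(6)[of I] 2(4)[of I] by auto
    fix I :: "'n set" and \<phi> :: "(complex, 'n) vec \<Rightarrow> complex" assume I: "card I = q" and \<phi>: "C1c \<phi>"
    show "dbar_pair (\<lambda>I z. \<beta>1 I z + \<beta>2 I z) I \<phi> = (LBINT z. \<omega> I z * \<phi> z) - (LBINT z. \<omega>2 I z * \<phi> z)"
      by (subst dbar_pair_add[OF Lr_polydisc_integrable[OF g1 r] Lr_polydisc_integrable[OF 2(1) r] I \<phi>])
        (use 1(7)[OF I \<phi>] 2(5)[OF I \<phi>] in auto)
  qed (use 2(2,3) in auto)
qed

theorem dbar_solvable_compact_support:
  fixes \<omega> :: "'n::{finite,linorder} form"
  assumes r: "1 \<le> r" and \<rho>: "0 \<le> \<rho>" "\<rho> < 1" and q: "1 \<le> q" "q < CARD('n)"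
    and g: "\<And>I. card I = q \<Longrightarrow> Lr_polydisc r \<rho> (\<omega> I)" and cl: "closed_form q \<omega>"
  obtains \<rho>' \<beta> where "0 \<le> \<rho>'" "\<rho>' < 1" "\<And>I. card I = q - 1 \<Longrightarrow> Lr_polydisc r \<rho>' (\<beta> I)"
    "\<And>I \<phi>. card I = q \<Longrightarrow> C1c \<phi> \<Longrightarrow> dbar_pair \<beta> I \<phi> = (LBINT z. \<omega> I z * \<phi> z)"
proof -
  obtain \<rho>' \<beta> \<omega>' where "0 \<le> \<rho>'" "\<rho>' < 1" "\<forall>I. card I = q - 1 \<longrightarrow> Lr_polydisc r \<rho>' (\<beta> I)"
    "\<forall>I. \<not> UNIV \<subseteq> I \<longrightarrow> \<omega>' I = (\<lambda>z. 0)"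
    "\<forall>I \<phi>. card I = q \<longrightarrow> C1c \<phi> \<longrightarrow> dbar_pair \<beta> I \<phi> = (LBINT z. \<omega> I z * \<phi> z) - (LBINT z. \<omega>' I z * \<phi> z)"
    using dbar_homotopy[OF r \<rho> q(1) g cl finite[of UNIV]] by blast
  note * = this[rule_format]
  have "\<omega>' I = (\<lambda>z. 0)" if "card I = q" for I
    using *(4)[of I] that q(2) by (cases "I = UNIV") auto
  then show thesis using that[of \<rho>' \<beta>] * by auto
qed

subsection \<open>Mollification\<close>

text \<open>The factor \<open>1 / x ^ n\<close> makes the linear span of the family closed under
  differentiation; \<open>n = 0\<close> is the classical smooth function that is flat at 0.\<close>

definition exp_bump :: "nat \<Rightarrow> real \<Rightarrow> real" where
  "exp_bump n x = (if x > 0 then exp (- (1 / x)) / x ^ n else 0)"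

lemma power_le_fact_exp: "0 \<le> t \<Longrightarrow> t ^ m \<le> fact m * exp (t::real)"
proof -
  assume t: "0 \<le> t"
  have "(\<Sum>k\<in>{m}. inverse (fact k) *\<^sub>R t ^ k) \<le> (\<Sum>k. inverse (fact k) *\<^sub>R t ^ k)"
    by (rule sum_le_suminf) (use t summable_exp_generic[of t] in auto)
  then show ?thesis by (simp add: exp_def field_simps)
qed

text \<open>A single term of the exponential series bounds \<open>(1 / x) ^ (n + 2)\<close> by
  \<open>fact (n + 2) * exp (1 / x)\<close>. The two spare powers leave a quadratic bound, which is
  enough for derivative 0 at the origin.\<close>

lemma exp_bump_bound: "\<bar>exp_bump n x\<bar> \<le> fact (n + 2) * x\<^sup>2"
proof (cases "x > 0")
  case True
  have "(1 / x) ^ (n + 2) \<le> fact (n + 2) * exp (1 / x)"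
    using power_le_fact_exp[of "1 / x" "n + 2"] True by simp
  then have "exp (- (1 / x)) * (1 / x) ^ (n + 2) \<le> exp (- (1 / x)) * (fact (n + 2) * exp (1 / x))"
    by (intro mult_left_mono) auto
  also have "\<dots> = fact (n + 2)" by (simp add: exp_minus)
  finally have "exp (- (1 / x)) / x ^ n \<le> fact (n + 2) * x\<^sup>2"
    using True by (simp add: power_add power_divide field_simps power2_eq_square)
  then show ?thesis using True by (simp add: exp_bump_def)
qed (simp add: exp_bump_def)

lemma DERIV_exp_bump:
  "(exp_bump n has_real_derivative exp_bump (n + 2) x - real n * exp_bump (n + 1) x) (at x)"
proof -
  consider "x < 0" | "x > 0" | "x = 0" by linarith
  then show ?thesis
  proof cases
    case 1
    have "((\<lambda>x. 0) has_real_derivative 0) (at x)" by simp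
    then have "(exp_bump n has_real_derivative 0) (at x)"
      by (rule has_field_derivative_transform_within_open[of _ _ _ "{..<0}"]) (use 1 in \<open>auto simp: exp_bump_def\<close>)
    then show ?thesis using 1 by (simp add: exp_bump_def)
  next
    case 2
    have "((\<lambda>x. exp (- (1 / x)) * inverse (x ^ n)) has_real_derivative
        exp (- (1 / x)) / x ^ (n + 2) - real n * (exp (- (1 / x)) / x ^ (n + 1))) (at x)"
    proof -
      have a: "((\<lambda>x::real. exp (- (1 / x))) has_real_derivative exp (- (1 / x)) * (1 / x\<^sup>2)) (at x)"
        using 2 by (auto intro!: derivative_eq_intros simp: power2_eq_square)
      have b: "((\<lambda>x::real. inverse (x ^ n)) has_real_derivative - (real n / x ^ (n + 1))) (at x)"
        by (rule DERIV_cong[OF DERIV_inverse_fun[OF DERIV_pow]]) (use 2 in \<open>cases n; simp add: field_simps\<close>)+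
      show ?thesis
        by (rule DERIV_cong[OF DERIV_mult[OF a b]]) (use 2 in \<open>simp add: field_simps power2_eq_square\<close>)
    qed
    then have "(exp_bump n has_real_derivative
        exp (- (1 / x)) / x ^ (n + 2) - real n * (exp (- (1 / x)) / x ^ (n + 1))) (at x)"
      by (rule has_field_derivative_transform_within_open[of _ _ _ "{0<..}"])
        (use 2 in \<open>auto simp: exp_bump_def divide_inverse\<close>)
    then show ?thesis using 2 by (simp add: exp_bump_def)
  next
    case 3
    have "((\<lambda>h. exp_bump n h / h) \<longlongrightarrow> 0) (at 0)"
    proof (rule tendsto_0_le[where f="\<lambda>h::real. h" and K="fact (n + 2)"])
      have "norm (exp_bump n h / h) \<le> norm h * fact (n + 2)" for h
      proof -
        have "\<bar>exp_bump n h\<bar> / \<bar>h\<bar> \<le> fact (n + 2) * \<bar>h\<bar>\<^sup>2 / \<bar>h\<bar>"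
          using exp_bump_bound[of n h] by (intro divide_right_mono) auto
        also have "\<dots> = \<bar>h\<bar> * fact (n + 2)"
          unfolding power2_eq_square by (cases "h = 0") (simp_all del: abs_mult_self_eq fact_Suc)
        finally show ?thesis by simp
      qed
      then show "\<forall>\<^sub>F h in at 0. norm (exp_bump n h / h) \<le> norm h * fact (n + 2)" by simp
    qed simp
    then show ?thesis using 3 by (simp add: DERIV_def exp_bump_def)
  qed
qed

text \<open>An algebra of functions that is closed under directional derivatives and contains a bump.\<close>

inductive bump_alg :: "real \<Rightarrow> ('a::euclidean_space \<Rightarrow> complex) \<Rightarrow> bool" for s where
  const: "bump_alg s (\<lambda>x. c)"
| inner: "bump_alg s (\<lambda>x. of_real (x \<bullet> b))"
| bump: "bump_alg s (\<lambda>x. of_real (exp_bump n (s - x \<bullet> x)))"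
| add: "bump_alg s F \<Longrightarrow> bump_alg s G \<Longrightarrow> bump_alg s (\<lambda>x. F x + G x)"
| mult: "bump_alg s F \<Longrightarrow> bump_alg s G \<Longrightarrow> bump_alg s (\<lambda>x. F x * G x)"

lemma bump_alg_has_derivative:
  fixes F :: "'a::euclidean_space \<Rightarrow> complex"
  shows
  "bump_alg s F \<Longrightarrow> \<exists>D. (\<forall>x. (F has_derivative D x) (at x)) \<and> (\<forall>v. bump_alg s (\<lambda>x. D x v))"
proof (induction rule: bump_alg.induct)
  case (const c)
  show ?case by (rule exI[of _ "\<lambda>x v. 0"]) (auto intro: bump_alg.intros)
next
  case (inner b)
  show ?case by (rule exI[of _ "\<lambda>x v. of_real (v \<bullet> b)"]) (auto intro!: derivative_eq_intros bump_alg.intros)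
next
  case (bump n)
  let ?D = "\<lambda>x v::'a. complex_of_real ((exp_bump (n + 2) (s - x \<bullet> x) - real n * exp_bump (n + 1) (s - x \<bullet> x)) * (- 2 * (x \<bullet> v)))"
  show ?case
  proof (rule exI[of _ ?D], intro conjI allI)
    fix x :: 'a
    have "((\<lambda>x. s - x \<bullet> x) has_derivative (\<lambda>v. - 2 * (x \<bullet> v))) (at x)"
      by (auto intro!: derivative_eq_intros simp: inner_commute)
    from diff_chain_at[OF this DERIV_exp_bump[unfolded has_field_derivative_def]]
    have "((\<lambda>x. exp_bump n (s - x \<bullet> x)) has_derivative
       (\<lambda>v. (exp_bump (n + 2) (s - x \<bullet> x) - real n * exp_bump (n + 1) (s - x \<bullet> x)) * (- 2 * (x \<bullet> v)))) (at x)"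
      by (simp add: o_def)
    then show "((\<lambda>x. of_real (exp_bump n (s - x \<bullet> x))) has_derivative ?D x) (at x)"
      by (rule bounded_linear.has_derivative[OF bounded_linear_of_real])
  next
    fix v :: 'a
    have "bump_alg s (\<lambda>x. (of_real (exp_bump (n + 2) (s - x \<bullet> x)) + (- of_nat n) * of_real (exp_bump (n + 1) (s - x \<bullet> x))) * (- 2 * of_real (x \<bullet> v)))"
      by (intro bump_alg.intros)
    then show "bump_alg s (\<lambda>x. ?D x v)" by simp
  qed
next
  case (add F G)
  then obtain D E where "\<forall>x. (F has_derivative D x) (at x)" "\<forall>v. bump_alg s (\<lambda>x. D x v)"
    "\<forall>x. (G has_derivative E x) (at x)" "\<forall>v. bump_alg s (\<lambda>x. E x v)" by auto
  then show ?case
    by (intro exI[of _ "\<lambda>x v. D x v + E x v"]) (auto intro!: has_derivative_add bump_alg.add)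
next
  case (mult F G)
  then obtain D E where "\<forall>x. (F has_derivative D x) (at x)" "\<forall>v. bump_alg s (\<lambda>x. D x v)"
    "\<forall>x. (G has_derivative E x) (at x)" "\<forall>v. bump_alg s (\<lambda>x. E x v)" by auto
  with mult show ?case
    by (intro exI[of _ "\<lambda>x v. F x * E x v + D x v * G x"]) (auto intro!: has_derivative_mult bump_alg.add bump_alg.mult)
qed

lemma bump_alg_frechet:
  assumes "bump_alg s F"
  shows "F differentiable (at x)" and "bump_alg s (\<lambda>x. frechet_derivative F (at x) v)"
proof -
  obtain D where D: "\<And>x. (F has_derivative D x) (at x)" "\<And>v. bump_alg s (\<lambda>x. D x v)"
    using bump_alg_has_derivative[OF assms] by auto
  show "F differentiable (at x)" using D(1) by (auto simp: differentiable_def)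
  have "frechet_derivative F (at x) = D x" for x using frechet_derivative_at[OF D(1)] by simp
  then show "bump_alg s (\<lambda>x. frechet_derivative F (at x) v)" using D(2) by simp
qed

lemma bump_alg_smooth: "bump_alg s F \<Longrightarrow> smooth_fun F"
proof -
  assume F: "bump_alg s F"
  have "bump_alg s (iter_deriv vs F)" for vs
    by (induction vs) (use F bump_alg_frechet(2) in auto)
  then show ?thesis using bump_alg_frechet(1) by (auto simp: smooth_fun_def)
qed

section \<open>Test functions and approximation by them\<close>

lemma test_fun_iff: "test_fun \<phi> \<longleftrightarrow> smooth_fun \<phi> \<and> bounded {x. \<phi> x \<noteq> 0}"
  by (simp add: test_fun_def)

lemma iter_deriv_append: "iter_deriv vs (iter_deriv us F) = iter_deriv (vs @ us) F"
  by (induction vs) auto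

lemma smooth_fun_C1_on: "smooth_fun F \<Longrightarrow> C1_on UNIV F"
  unfolding C1_on_def
proof (intro conjI ballI allI)
  assume F: "smooth_fun F"
  show "F differentiable (at x)" for x using F[unfolded smooth_fun_def, rule_format, of "[]"] by simp
  show "continuous_on UNIV (\<lambda>x. frechet_derivative F (at x) v)" for v
    using F[unfolded smooth_fun_def, rule_format, of "[v]"]
    by (simp add: continuous_at_imp_continuous_on differentiable_imp_continuous_within)
qed

lemma test_fun_C1c: "test_fun \<phi> \<Longrightarrow> C1c \<phi>"
  by (auto simp: test_fun_iff C1c_def smooth_fun_C1_on)

lemma test_fun_frechet: "test_fun \<phi> \<Longrightarrow> test_fun (\<lambda>x. frechet_derivative \<phi> (at x) v)"
  unfolding test_fun_iff
proof
  assume \<phi>: "smooth_fun \<phi> \<and> bounded {x. \<phi> x \<noteq> 0}"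
  show "smooth_fun (\<lambda>x. frechet_derivative \<phi> (at x) v)"
    using \<phi> iter_deriv_append[of _ "[v]" \<phi>] unfolding smooth_fun_def by simp
  show "bounded {x. frechet_derivative \<phi> (at x) v \<noteq> 0}"
    using \<phi> by (intro C1c_bounded_frechet_support test_fun_C1c) (simp add: test_fun_iff)
qed

lemma mollifier_exists:
  assumes "\<epsilon> > 0"
  obtains b :: "'a::euclidean_space \<Rightarrow> real" where "test_fun (\<lambda>x. complex_of_real (b x))"
    "\<And>x. b x \<ge> 0" "\<And>x. norm x \<ge> \<epsilon> \<Longrightarrow> b x = 0" "(LBINT x. b x) = 1" "integrable lborel b"
proof -
  \<comment> \<open>\<open>x \<bullet> x\<close> in place of the norm keeps the bump inside
    \<open>bump_alg\<close>; the argument is positive exactly on the open ball of radius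
    \<open>\<epsilon>\<close>.\<close>
  define c where "c x = exp_bump 0 (\<epsilon>\<^sup>2 - x \<bullet> x)" for x :: 'a
  have c0: "c x \<ge> 0" for x by (simp add: c_def exp_bump_def)
  have csupp: "c x = 0" if "norm x \<ge> \<epsilon>" for x
  proof -
    have "\<epsilon>\<^sup>2 \<le> (norm x)\<^sup>2" using that assms by (intro power_mono) auto
    then show ?thesis by (simp add: c_def exp_bump_def power2_norm_eq_inner)
  qed
  have cpos: "c x > 0" if "norm x < \<epsilon>" for x
  proof -
    have "(norm x)\<^sup>2 < \<epsilon>\<^sup>2" using that assms by (intro power_strict_mono) auto
    then show ?thesis by (simp add: c_def exp_bump_def power2_norm_eq_inner)
  qed
  have bd: "bounded {x. complex_of_real (c x * k) \<noteq> 0}" for k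
  proof (rule boundedI[of _ \<epsilon>])
    fix x assume "x \<in> {x. complex_of_real (c x * k) \<noteq> 0}"
    then have "c x \<noteq> 0" by auto
    then show "norm x \<le> \<epsilon>" using csupp[of x] by linarith
  qed
  have alg: "bump_alg (\<epsilon>\<^sup>2) (\<lambda>x. complex_of_real (c x) * complex_of_real k)" for k
    unfolding c_def by (intro bump_alg.intros)
  have test: "test_fun (\<lambda>x. complex_of_real (c x * k))" for k
    unfolding test_fun_iff using bd[of k] bump_alg_smooth[OF alg[of k]] by simp
  have intc: "integrable lborel c"
    using integrable_Re[OF C1c_integrable[OF test_fun_C1c[OF test[of 1]]]] by simp
  define M where "M = (LBINT x. c x)"
  have "M \<ge> 0" unfolding M_def by (simp add: c0)
  moreover have "M \<noteq> 0"
  proof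
    assume "M = 0"
    then have AE: "AE x in lborel. c x = 0"
      unfolding M_def by (subst (asm) integral_nonneg_eq_0_iff_AE[OF intc]) (auto simp: c0)
    have "AE x in lborel. x \<notin> ball (0::'a) \<epsilon>"
      using AE by eventually_elim (use cpos in force)
    then have "emeasure lborel (ball (0::'a) \<epsilon>) = 0"
      by (subst (asm) AE_iff_null_sets[symmetric]) auto
    then show False using assms content_ball_pos[of \<epsilon> "0::'a"] by (simp add: measure_def)
  qed
  ultimately have M: "M > 0" by simp
  show thesis
  proof (rule that[of "\<lambda>x. c x * (1 / M)"])
    show "(LBINT x. c x * (1 / M)) = 1" using M by (simp add: M_def)
  qed (use test[of "1 / M"] c0 csupp M intc in auto)
qed

text \<open>Derivatives of a mollification can be put on either factor: on \<open>b\<close> to see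
  that it is a test function, on \<open>\<phi>\<close> to see that its first derivatives are close
  to those of \<open>\<phi>\<close>.\<close>

lemma conv_id_commute:
  fixes \<phi> b :: "'a::euclidean_space \<Rightarrow> complex"
  assumes "\<phi> \<in> borel_measurable borel" "b \<in> borel_measurable borel"
  shows "conv \<phi> (\<lambda>w. w) b x = conv b (\<lambda>w. w) \<phi> x"
proof -
  have m: "(\<lambda>w. \<phi> w * b (x - w)) \<in> borel_measurable borel" using assms by measurable
  have m2: "(\<lambda>w. \<phi> (x + w) * b (- w)) \<in> borel_measurable borel" using assms by measurable
  have "conv \<phi> (\<lambda>w. w) b x = (LBINT w. \<phi> (x + w) * b (x - (x + w)))"
    unfolding conv_def using lborel_integral_translate[OF m, of x] by simp
  also have "\<dots> = (LBINT w. \<phi> (x + w) * b (- w))" by simp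
  also have "\<dots> = (LBINT w. \<phi> (x - w) * b w)"
    using lborel_integral_scale[OF m2, of "-1"] by simp
  finally show ?thesis by (simp add: conv_def mult.commute)
qed

text \<open>\<open>\<phi>\<close> takes the place of the kernel, so iterated derivatives fall on
  \<open>b\<close> and produce convolutions of the same kind.\<close>

lemma conv_test_fun:
  fixes \<phi> b :: "'a::euclidean_space \<Rightarrow> complex"
  assumes \<phi>: "integrable lborel \<phi>" "bounded {x. \<phi> x \<noteq> 0}" and b: "test_fun b"
  shows "test_fun (conv \<phi> (\<lambda>w. w) b)"
proof -
  have id: "linear (\<lambda>w::'a. w)" by (rule linear_id[unfolded id_def])
  have tb: "test_fun (iter_deriv vs b)" for vs
    by (induction vs) (use b test_fun_frechet in auto)
  have it: "iter_deriv vs (conv \<phi> (\<lambda>w. w) b) = conv \<phi> (\<lambda>w. w) (iter_deriv vs b)" for vs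
  proof (induction vs)
    case (Cons v vs)
    show ?case by (simp add: Cons conv_C1c(2)[OF \<phi> id test_fun_C1c[OF tb]])
  qed simp
  have "C1c (conv \<phi> (\<lambda>w. w) (iter_deriv vs b))" for vs
    by (rule conv_C1c(1)[OF \<phi> id test_fun_C1c[OF tb]])
  note C = this
  have "smooth_fun (conv \<phi> (\<lambda>w. w) b)"
    unfolding smooth_fun_def it using C by (auto simp: C1c_def C1_on_def)
  then show ?thesis using C[of "[]"] by (simp add: test_fun_iff C1c_def)
qed

lemma mollify_uniform:
  fixes g :: "'a::euclidean_space \<Rightarrow> complex" and b :: "'a \<Rightarrow> real"
  assumes g: "continuous_on UNIV g" "bounded {x. g x \<noteq> 0}"
    and d: "\<And>x y. dist x y < d \<Longrightarrow> norm (g x - g y) < e"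
    and b: "\<And>x. b x \<ge> 0" "\<And>x. norm x \<ge> d \<Longrightarrow> b x = 0" "(LBINT x. b x) = 1" "integrable lborel b"
  shows "norm (conv (\<lambda>x. of_real (b x)) (\<lambda>w. w) g x - g x) \<le> e"
proof -
  have id: "linear (\<lambda>w::'a. w)" by (rule linear_id[unfolded id_def])
  have bc: "integrable lborel (\<lambda>x. complex_of_real (b x))" using b(4) by simp
  have i: "integrable lborel (\<lambda>w. complex_of_real (b w) * g (x - w))"
    by (rule conv_integrable[OF bc id g])
  have "g x = (LBINT w. complex_of_real (b w) * g x)" using b(3) by simp
  then have "conv (\<lambda>x. of_real (b x)) (\<lambda>w. w) g x - g x = (LBINT w. complex_of_real (b w) * (g (x - w) - g x))"
    unfolding conv_def right_diff_distrib using i bc by (subst Bochner_Integration.integral_diff) auto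
  also have "norm \<dots> \<le> (LBINT w. b w * e)"
  proof (rule Bochner_Integration.integral_norm_bound_integral)
    show "integrable lborel (\<lambda>w. complex_of_real (b w) * (g (x - w) - g x))"
      unfolding right_diff_distrib using i bc by auto
    show "integrable lborel (\<lambda>w. b w * e)" using b(4) by auto
    show "norm (complex_of_real (b w) * (g (x - w) - g x)) \<le> b w * e" for w
    proof (cases "norm w \<ge> d")
      case False
      then have "norm (g (x - w) - g x) \<le> e" by (intro less_imp_le d) (simp add: dist_norm)
      then show ?thesis using b(1)[of w] by (simp add: norm_mult mult_left_mono)
    qed (use b(2) in simp)
  qed
  also have "\<dots> = e" using b(3) by simp
  finally show ?thesis .
qed

text \<open>Mollification changes each \<open>dzbar i \<phi>\<close> by at most \<open>e\<close>
  uniformly, so the sum for \<open>\<phi>\<close> differs from the one for a smooth test function by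
  at most \<open>e\<close> times the total L^1 norm of the coefficients.\<close>

lemma closed_form_if_test_fun:
  fixes \<omega> :: "'n::{finite,linorder} form"
  assumes int: "\<And>I. card I = q \<Longrightarrow> integrable lborel (\<omega> I)"
    and cl: "\<And>K \<phi>. card K = q + 1 \<Longrightarrow> test_fun \<phi> \<Longrightarrow>
      (\<Sum>i\<in>K. sg i K * (LBINT z. \<omega> (K - {i}) z * dzbar i \<phi> z)) = 0"
  shows "closed_form q \<omega>"
  unfolding closed_form_def
proof (intro allI impI)
  fix K :: "'n set" and \<phi> :: "(complex, 'n) vec \<Rightarrow> complex"
  assume K: "card K = q + 1" and \<phi>: "C1c \<phi>"
  let ?S = "\<lambda>\<phi>. \<Sum>i\<in>K. sg i K * (LBINT z. \<omega> (K - {i}) z * dzbar i \<phi> z)"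
  define M where "M = (\<Sum>i\<in>K. LBINT z. norm (\<omega> (K - {i}) z))"
  have M: "M \<ge> 0" unfolding M_def by (intro sum_nonneg) simp
  have bound: "norm (?S \<phi>) \<le> M * e" if e: "e > 0" for e
  proof -
    have "\<exists>d>0. \<forall>x y. dist x y < d \<longrightarrow> norm (dzbar i \<phi> x - dzbar i \<phi> y) < e" for i
      using continuous_bounded_support_uniform[where g="dzbar i \<phi>", OF dzbar_continuous[OF \<phi>] dzbar_support[OF \<phi>] e] by metis
    then obtain D where D: "\<And>i. D i > 0" "\<And>i x y. dist x y < D i \<Longrightarrow> norm (dzbar i \<phi> x - dzbar i \<phi> y) < e"
      by metis
    \<comment> \<open>One mollifier has to serve all indices, so the smallest threshold is
      taken.\<close>
    define d where "d = Min (range D)"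
    have d: "d > 0" unfolding d_def using D(1) by (subst Min_gr_iff) auto
    have dD: "d \<le> D i" for i unfolding d_def by (rule Min_le) auto
    obtain b :: "(complex, 'n) vec \<Rightarrow> real" where b: "test_fun (\<lambda>x. complex_of_real (b x))"
      "\<And>x. b x \<ge> 0" "\<And>x. norm x \<ge> d \<Longrightarrow> b x = 0" "(LBINT x. b x) = 1" "integrable lborel b"
      using mollifier_exists[OF d] by blast
    let ?b = "\<lambda>x. complex_of_real (b x)"
    let ?m = "conv \<phi> (\<lambda>w. w) ?b"
    have id: "linear (\<lambda>w::(complex, 'n) vec. w)" by (rule linear_id[unfolded id_def])
    have \<phi>b: "bounded {x. \<phi> x \<noteq> 0}" using \<phi> by (simp add: C1c_def)
    have bC: "C1c ?b" by (rule test_fun_C1c[OF b(1)])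
    have bb: "integrable lborel ?b" "bounded {x. ?b x \<noteq> 0}" using C1c_integrable[OF bC] bC by (simp_all add: C1c_def)
    have mt: "test_fun ?m" by (rule conv_test_fun[OF C1c_integrable[OF \<phi>] \<phi>b b(1)])
    have m_eq: "?m = conv ?b (\<lambda>w. w) \<phi>"
      by (rule ext, rule conv_id_commute) (use C1c_integrable[OF \<phi>] bb in auto)
    have near: "norm (dzbar i ?m z - dzbar i \<phi> z) \<le> e" for i z
      unfolding m_eq dzbar_conv[OF \<phi> bb id]
      by (rule mollify_uniform[OF dzbar_continuous[OF \<phi>] dzbar_support[OF \<phi>] D(2) b(2) b(3) b(4) b(5)])
        (use dD[of i] in auto)
    have "?S \<phi> = ?S \<phi> - ?S ?m" using cl[OF K mt] by simp
    also have "\<dots> = (\<Sum>i\<in>K. sg i K * ((LBINT z. \<omega> (K - {i}) z * dzbar i \<phi> z) - (LBINT z. \<omega> (K - {i}) z * dzbar i ?m z)))"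
      by (simp add: sum_subtractf right_diff_distrib)
    also have "norm \<dots> \<le> (\<Sum>i\<in>K. (LBINT z. norm (\<omega> (K - {i}) z)) * e)"
    proof (rule sum_norm_le)
      fix i assume i: "i \<in> K"
      then have "card (K - {i}) = q" using K by simp
      note \<omega>i = int[OF this]
      have i1: "integrable lborel (\<lambda>z. \<omega> (K - {i}) z * dzbar i \<psi> z)" if "C1c \<psi>" for \<psi>
        by (rule integrable_mult_continuous[OF \<omega>i dzbar_continuous[OF that] dzbar_support[OF that]])
      have "norm (sg i K * ((LBINT z. \<omega> (K - {i}) z * dzbar i \<phi> z) - (LBINT z. \<omega> (K - {i}) z * dzbar i ?m z)))
        = norm (LBINT z. \<omega> (K - {i}) z * dzbar i \<phi> z - \<omega> (K - {i}) z * dzbar i ?m z)"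
        using i1[OF \<phi>] i1[OF test_fun_C1c[OF mt]] by (simp add: norm_mult norm_power)
      also have "\<dots> \<le> (LBINT z. norm (\<omega> (K - {i}) z) * e)"
      proof (rule Bochner_Integration.integral_norm_bound_integral)
        show "integrable lborel (\<lambda>z. \<omega> (K - {i}) z * dzbar i \<phi> z - \<omega> (K - {i}) z * dzbar i ?m z)"
          using i1[OF \<phi>] i1[OF test_fun_C1c[OF mt]] by (rule Bochner_Integration.integrable_diff)
        show "integrable lborel (\<lambda>z. norm (\<omega> (K - {i}) z) * e)" using \<omega>i by auto
        show "norm (\<omega> (K - {i}) z * dzbar i \<phi> z - \<omega> (K - {i}) z * dzbar i ?m z) \<le> norm (\<omega> (K - {i}) z) * e" for z
          using near[of i z] by (simp add: right_diff_distrib[symmetric] norm_mult mult_left_mono norm_minus_commute)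
      qed
      also have "\<dots> = (LBINT z. norm (\<omega> (K - {i}) z)) * e" by simp
      finally show "norm (sg i K * ((LBINT z. \<omega> (K - {i}) z * dzbar i \<phi> z) - (LBINT z. \<omega> (K - {i}) z * dzbar i ?m z)))
        \<le> (LBINT z. norm (\<omega> (K - {i}) z)) * e" .
    qed
    also have "\<dots> = M * e" by (simp add: M_def sum_distrib_right)
    finally show ?thesis .
  qed
  have "norm (?S \<phi>) \<le> 0 + e" if "e > 0" for e
  proof -
    have "norm (?S \<phi>) \<le> M * (e / (M + 1))" using bound[of "e / (M + 1)"] that M by simp
    also have "\<dots> = e * (M / (M + 1))" by simp
    also have "\<dots> \<le> e * 1" using that M by (intro mult_left_mono) auto
    finally show ?thesis by simp
  qed
  then have "norm (?S \<phi>) \<le> 0" by (rule field_le_epsilon)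
  then show "?S \<phi> = 0" by simp
qed

subsection \<open>Holomorphic functions of several variables\<close>

lemma holomorphic_Cn_frechet:
  assumes "holomorphic_Cn_on f U" "z \<in> U"
  shows "(f has_derivative frechet_derivative f (at z)) (at z)"
    and "frechet_derivative f (at z) (a *s h) = a * frechet_derivative f (at z) h"
proof -
  obtain D where D: "(f has_derivative D) (at z)" "\<forall>a h. D (a *s h) = a * D h"
    using assms unfolding holomorphic_Cn_on_def by blast
  from frechet_derivative_at[OF D(1)] D
  show "(f has_derivative frechet_derivative f (at z)) (at z)"
    and "frechet_derivative f (at z) (a *s h) = a * frechet_derivative f (at z) h" by auto
qed

lemma axis_eq_smult: "axis j v = v *s axis j (1::complex)"
  by (simp add: vec_eq_iff axis_def)

lemma norm_axis_le: "norm (axis j v :: complex ^ 'n::finite) \<le> norm v"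
proof -
  have "norm (axis j v :: complex ^ 'n) \<le> (\<Sum>i\<in>UNIV. norm ((axis j v :: complex ^ 'n) $ i))"
    unfolding norm_vec_def by (rule L2_set_le_sum) auto
  also have "\<dots> = (\<Sum>i\<in>UNIV. if i = j then norm v else 0)"
    by (intro sum.cong) (auto simp: axis_def)
  finally show ?thesis by simp
qed

lemma holomorphic_Cn_axis_derivative:
  assumes "holomorphic_Cn_on f U" "z + axis j \<zeta> \<in> U"
  shows "((\<lambda>\<zeta>. f (z + axis j \<zeta>)) has_field_derivative frechet_derivative f (at (z + axis j \<zeta>)) (axis j 1)) (at \<zeta>)"
proof -
  have bl: "bounded_linear (axis j :: complex \<Rightarrow> complex ^ 'a)" using linear_axis linear_conv_bounded_linear by blast
  have aff: "((\<lambda>\<zeta>. z + axis j \<zeta>) has_derivative axis j) (at \<zeta>)"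
    by (auto intro!: derivative_eq_intros bounded_linear_imp_has_derivative bl)
  have "((\<lambda>\<zeta>. f (z + axis j \<zeta>)) has_derivative (\<lambda>v. frechet_derivative f (at (z + axis j \<zeta>)) (axis j v))) (at \<zeta>)"
    using diff_chain_at[OF aff holomorphic_Cn_frechet(1)[OF assms]] by (simp add: o_def)
  moreover have "(\<lambda>v. frechet_derivative f (at (z + axis j \<zeta>)) (axis j v)) = (*) (frechet_derivative f (at (z + axis j \<zeta>)) (axis j 1))"
    by (rule ext) (subst axis_eq_smult, simp add: holomorphic_Cn_frechet(2)[OF assms] mult.commute)
  ultimately show ?thesis by (simp add: has_field_derivative_def)
qed

text \<open>\<open>holomorphic_Cn_on\<close> asks only for a complex linear derivative at each
  point, so continuity of the partial derivatives has to be proved. Cauchy's inequality is applied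
  to the difference of \<open>f\<close> on two parallel discs in direction \<open>j\<close>, which
  is uniformly small.\<close>

lemma holomorphic_Cn_partial_continuous:
  fixes f :: "complex ^ 'n::finite \<Rightarrow> complex"
  assumes f: "holomorphic_Cn_on f U"
  shows "continuous_on U (\<lambda>z. frechet_derivative f (at z) (axis j 1))"
proof (rule continuous_at_imp_continuous_on, rule ballI)
  fix z0 assume z0: "z0 \<in> U"
  have "open U" using f by (simp add: holomorphic_Cn_on_def)
  then obtain R' where R': "R' > 0" "cball z0 R' \<subseteq> U" using z0 open_contains_cball by blast
  \<comment> \<open>Discs of radius \<open>R\<close> centred within \<open>R\<close> of
    \<open>z0\<close> stay inside \<open>cball z0 R'\<close>.\<close>
  define R where "R = R' / 2"
  have R: "R > 0" "2 * R = R'" using R' by (auto simp: R_def)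
  have fc: "continuous_on U f"
    using holomorphic_Cn_frechet(1)[OF f] has_derivative_continuous continuous_at_imp_continuous_on by blast
  show "isCont (\<lambda>z. frechet_derivative f (at z) (axis j 1)) z0"
    unfolding continuous_at_eps_delta
  proof (intro allI impI)
    fix e :: real assume e: "e > 0"
    have "uniformly_continuous_on (cball z0 R') f"
      by (rule compact_uniformly_continuous[OF continuous_on_subset[OF fc R'(2)]]) simp
    \<comment> \<open>Cauchy's inequality divides by \<open>R\<close>; the factor 1/2 makes the
      final inequality strict.\<close>
    then obtain d where d: "d > 0" "\<And>x y. x \<in> cball z0 R' \<Longrightarrow> y \<in> cball z0 R' \<Longrightarrow> dist x y < d \<Longrightarrow> dist (f x) (f y) < e / 2 * R"
      unfolding uniformly_continuous_on_def using e R(1) by (metis dist_commute half_gt_zero mult_pos_pos)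
    show "\<exists>d>0. \<forall>z. dist z z0 < d \<longrightarrow>
      dist (frechet_derivative f (at z) (axis j 1)) (frechet_derivative f (at z0) (axis j 1)) < e"
    proof (intro exI[of _ "min d R"] conjI allI impI)
      show "min d R > 0" using d R by simp
      fix z assume z: "dist z z0 < min d R"
      define h where "h \<zeta> = f (z + axis j \<zeta>) - f (z0 + axis j \<zeta>)" for \<zeta>
      have inb: "z + axis j \<zeta> \<in> cball z0 R'" "z0 + axis j \<zeta> \<in> cball z0 R'" if "norm \<zeta> \<le> R" for \<zeta>
      proof -
        have "norm (axis j \<zeta> :: complex ^ 'n) \<le> R" using norm_axis_le[of j \<zeta>] that by (rule order_trans)
        moreover have "norm (z - z0 + axis j \<zeta>) \<le> norm (z - z0) + norm (axis j \<zeta> :: complex ^ 'n)" by (rule norm_triangle_ineq)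
        moreover have "norm (z - z0) < R" using z by (simp add: dist_norm)
        ultimately have "norm (z - z0 + axis j \<zeta>) \<le> R'" using R(2) by linarith
        moreover have "dist z0 (z + axis j \<zeta>) = norm (z - z0 + axis j \<zeta>)"
          by (subst dist_commute) (simp add: dist_norm algebra_simps)
        ultimately show "z + axis j \<zeta> \<in> cball z0 R'" by simp
        show "z0 + axis j \<zeta> \<in> cball z0 R'" using \<open>norm (axis j \<zeta> :: complex ^ 'n) \<le> R\<close> R by (simp add: dist_norm)
      qed
      have der: "(h has_field_derivative frechet_derivative f (at (z + axis j \<zeta>)) (axis j 1)
           - frechet_derivative f (at (z0 + axis j \<zeta>)) (axis j 1)) (at \<zeta>)" if "norm \<zeta> \<le> R" for \<zeta>
        unfolding h_def using inb[OF that] R'(2)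
        by (intro DERIV_diff holomorphic_Cn_axis_derivative[OF f]) auto
      have hol: "h holomorphic_on ball 0 R"
        unfolding holomorphic_on_def field_differentiable_def
        using der has_field_derivative_at_within by (metis less_imp_le mem_ball_0)
      have cont: "continuous_on (cball 0 R) h"
        by (intro continuous_at_imp_continuous_on ballI DERIV_isCont[OF der]) simp
      have bd: "norm (h \<zeta>) \<le> e / 2 * R" if "norm (0 - \<zeta>) = R" for \<zeta>
      proof -
        have "norm \<zeta> \<le> R" using that by simp
        from d(2)[OF inb[OF this]] show ?thesis using z by (simp add: h_def dist_norm)
      qed
      have "norm ((deriv ^^ 1) h 0) \<le> fact 1 * (e / 2 * R) / R ^ 1"
        by (rule Cauchy_inequality[OF hol cont R(1) bd])
      then have "norm (deriv h 0) \<le> e / 2" using R(1) by simp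
      moreover have "axis j 0 = (0 :: complex ^ 'n)" by simp
      moreover have "deriv h 0 = frechet_derivative f (at (z + axis j 0)) (axis j 1)
           - frechet_derivative f (at (z0 + axis j 0)) (axis j 1)"
        using R by (intro DERIV_imp_deriv der) simp
      ultimately have "norm (frechet_derivative f (at z) (axis j 1) - frechet_derivative f (at z0) (axis j 1)) \<le> e / 2"
        by (metis add.right_neutral)
      then show "dist (frechet_derivative f (at z) (axis j 1)) (frechet_derivative f (at z0) (axis j 1)) < e"
        using e by (simp add: dist_norm)
    qed
  qed
qed

text \<open>Complex linearity reduces every direction to the finitely many partial derivatives along
  \<open>axis j 1\<close>, and it makes the two terms of \<open>dzbar\<close> cancel.\<close>

lemma holomorphic_Cn_C1_on:
  fixes f :: "complex ^ 'n::finite \<Rightarrow> complex"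
  assumes f: "holomorphic_Cn_on f U"
  shows "C1_on U f" and "z \<in> U \<Longrightarrow> dzbar i f z = 0"
proof -
  have expand: "frechet_derivative f (at z) v = (\<Sum>j\<in>UNIV. v $ j * frechet_derivative f (at z) (axis j 1))"
    if "z \<in> U" for z v
  proof -
    have lin: "linear (frechet_derivative f (at z))"
      using holomorphic_Cn_frechet(1)[OF f that] has_derivative_linear by blast
    have "v = (\<Sum>j\<in>UNIV. v $ j *s axis j 1)"
      by (simp add: vec_eq_iff axis_def if_distrib[of "\<lambda>x. _ * x"] cong: if_cong)
    then have "frechet_derivative f (at z) v = frechet_derivative f (at z) (\<Sum>j\<in>UNIV. v $ j *s axis j 1)" by simp
    also have "\<dots> = (\<Sum>j\<in>UNIV. v $ j * frechet_derivative f (at z) (axis j 1))"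
      by (simp add: linear_sum[OF lin] holomorphic_Cn_frechet(2)[OF f that])
    finally show ?thesis .
  qed
  show "C1_on U f"
  proof (rule C1_onI[OF holomorphic_Cn_frechet(1)[OF f]])
    fix v
    have "continuous_on U (\<lambda>z. \<Sum>j\<in>UNIV. v $ j * frechet_derivative f (at z) (axis j 1))"
      by (intro continuous_intros holomorphic_Cn_partial_continuous[OF f])
    then show "continuous_on U (\<lambda>z. frechet_derivative f (at z) v)"
      by (rule continuous_on_eq) (use expand in auto)
  qed
  show "dzbar i f z = 0" if "z \<in> U"
    unfolding dzbar_def axis_eq_smult[of i \<i>] holomorphic_Cn_frechet(2)[OF f that]
    by (simp flip: mult.assoc)
qed

section \<open>Division and multiplication by powers of a holomorphic function\<close>

lemma dzbar_power_eq_0: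
  assumes "g differentiable (at z)" "dzbar i g z = 0"
  shows "dzbar i (\<lambda>z. g z ^ k) z = 0"
proof (induction k)
  case 0
  have "frechet_derivative (\<lambda>z::(complex, 'a) vec. 1::complex) (at z) = (\<lambda>v. 0)"
    using frechet_derivative_at[OF has_derivative_const[of "1::complex"]] by metis
  then show ?case by (simp add: dzbar_def)
next
  case (Suc k)
  have "(\<lambda>z. g z ^ k) differentiable (at z)" using assms(1) by (rule differentiable_power)
  from dzbar_mult[OF assms(1) this, of i] show ?case using Suc assms(2) by simp
qed

text \<open>Composed with \<open>f\<close>, the function \<open>G\<close> replaces \<open>1 / f\<close> without singularities along the zero set.\<close>

lemma regularized_inverse:
  assumes "\<delta> > 0"
  obtains G :: "complex \<Rightarrow> complex" where "C1_on UNIV G"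
    "\<And>w. norm w \<ge> \<delta> \<Longrightarrow> G w * w = 1" "\<And>w. norm w \<ge> \<delta> \<Longrightarrow> dbar1 G w = 0"
proof -
  define A where "A = \<delta>\<^sup>2"
  have A: "A > 0" using assms by (simp add: A_def)
  \<comment> \<open>\<open>m\<close> is a positive C1 function with \<open>m s = s\<close> for
    \<open>s \<ge> A\<close>. Hence \<open>cnj w / m ((norm w)\<^sup>2)\<close> equals
    \<open>1 / w\<close> once \<open>norm w \<ge> \<delta>\<close> and stays regular at 0.\<close>
  define m where "m s = s + (max 0 (A - s))\<^sup>2 / A" for s
  define m' where "m' s = 1 - 2 * max 0 (A - s) / A" for s
  \<comment> \<open>Negative \<open>s\<close> are included because \<open>C1_on_radial\<close> asks
    for a derivative of the reciprocal on the whole real line.\<close>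
  have mpos: "m s > 0" for s
  proof (cases "s \<ge> A")
    case True then show ?thesis using A by (simp add: m_def)
  next
    case False
    define t where "t = A - s"
    have "m s * A = A * A - t * A + t * t" using False A by (simp add: m_def t_def field_simps power2_eq_square)
    also have "\<dots> = (t - A / 2) * (t - A / 2) + 3 / 4 * (A * A)" by (simp add: algebra_simps)
    also have "\<dots> > 0" using A by (intro add_nonneg_pos) auto
    finally show ?thesis using A by (simp add: zero_less_mult_iff)
  qed
  have m2: "((\<lambda>x::real. (max 0 x)\<^sup>2) has_real_derivative 2 * max 0 x) (at x)" for x
    using DERIV_max_power[of 0 x] by (simp add: numeral_eq_Suc)
  have dX: "((\<lambda>s. A - s) has_real_derivative - 1) (at s)" for s
    by (auto intro!: derivative_eq_intros)
  have dm: "(m has_real_derivative m' s) (at s)" for s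
    unfolding m_def m'_def
    by (rule DERIV_cong[OF DERIV_add[OF DERIV_ident DERIV_cdivide[OF DERIV_chain2[OF m2 dX]]]]) simp
  have dp: "((\<lambda>s. inverse (m s)) has_real_derivative - (m' s / (m s)\<^sup>2)) (at s)" for s
    by (rule DERIV_cong[OF DERIV_inverse_fun[OF dm]]) (use mpos[of s] in \<open>auto simp: divide_inverse power2_eq_square\<close>)
  have mc: "continuous_on UNIV m" and m'c: "continuous_on UNIV m'"
    unfolding m_def m'_def by (intro continuous_intros, use A in auto)+
  have cp: "continuous_on UNIV (\<lambda>s. - (m' s / (m s)\<^sup>2))"
    using mpos by (intro continuous_intros mc m'c) (metis less_irrefl power_eq_0_iff)
  define P where "P = (\<lambda>w::complex. complex_of_real (inverse (m ((norm w)\<^sup>2))))"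
  have P1: "C1_on UNIV P" unfolding P_def by (rule C1_on_radial(1)[OF dp cp])
  have dP: "dbar1 P w = of_real (- (m' ((norm w)\<^sup>2) / (m ((norm w)\<^sup>2))\<^sup>2)) * w" for w
    unfolding P_def by (rule C1_on_radial(2)[OF dp cp])
  have cD: "(cnj has_derivative cnj) (at w)" for w
    by (rule bounded_linear_imp_has_derivative[OF bounded_linear_cnj])
  have c1: "C1_on UNIV cnj" by (rule C1_onI[OF cD]) auto
  have dc: "dbar1 cnj w = 1" for w
    unfolding dbar1_def frechet_derivative_at[OF cD, symmetric] by simp
  have nw: "cnj w * w = of_real ((norm w)\<^sup>2)" for w by (metis complex_norm_square mult.commute)
  show thesis
  proof (rule that[of "\<lambda>w. cnj w * P w"])
    show "C1_on UNIV (\<lambda>w. cnj w * P w)" by (rule C1_on_mult[OF c1 P1])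
    fix w :: complex assume w: "norm w \<ge> \<delta>"
    define s where "s = (norm w)\<^sup>2"
    have s: "s \<ge> A" "s > 0" using power_mono[OF w, of 2] assms A unfolding A_def s_def by auto
    have ms: "m s = s" "m' s = 1" using s by (auto simp: m_def m'_def)
    have Pw: "P w = of_real (1 / s)" unfolding P_def s_def[symmetric] ms by (simp add: divide_inverse)
    show "cnj w * P w * w = 1"
    proof -
      have "cnj w * P w * w = (cnj w * w) * P w" by (simp add: mult_ac)
      also have "\<dots> = of_real (s * (1 / s))" unfolding nw Pw s_def by simp
      finally show ?thesis using s by simp
    qed
    have "dbar1 (\<lambda>w. cnj w * P w) w = cnj w * dbar1 P w + P w"
      unfolding dbar1_mult[OF c1 P1] dc by simp
    also have "cnj w * dbar1 P w = (cnj w * w) * of_real (- (1 / s\<^sup>2))"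
      unfolding dP s_def[symmetric] ms by (simp add: mult_ac)
    also have "\<dots> = of_real (s * - (1 / s\<^sup>2))" unfolding nw s_def by simp
    also have "s * - (1 / s\<^sup>2) = - (1 / s)" using s by (simp add: power2_eq_square)
    finally show "dbar1 (\<lambda>w. cnj w * P w) w = 0" unfolding Pw by simp
  qed
qed

text \<open>Where \<open>dbar1 G\<close> vanishes, the real derivative of \<open>G\<close> is
  complex linear, so the chain rule composes two complex linear maps. The condition is imposed only
  at \<open>f z\<close>, since the intended \<open>G\<close> is not holomorphic near 0.\<close>

lemma dzbar_compose_holomorphic:
  fixes f :: "complex ^ 'n::finite \<Rightarrow> complex"
  assumes f: "holomorphic_Cn_on f U" "z \<in> U" and G: "C1_on UNIV G" "dbar1 G (f z) = 0"
  shows "dzbar i (\<lambda>z. G (f z)) z = 0"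
proof -
  let ?G = "frechet_derivative G (at (f z))" and ?f = "frechet_derivative f (at z)"
  have D: "((\<lambda>z. G (f z)) has_derivative (\<lambda>v. ?G (?f v))) (at z)"
    using diff_chain_at[OF holomorphic_Cn_frechet(1)[OF f] C1_on_has_derivative[OF G(1)]] by (simp add: o_def)
  have lin: "linear ?G" using C1_on_has_derivative[OF G(1)] has_derivative_linear by blast
  have "?G 1 + \<i> * ?G \<i> = 0" using G(2) by (simp add: dbar1_def)
  then have "\<i> * (?G 1 + \<i> * ?G \<i>) = 0" by simp
  then have Gi: "?G \<i> = \<i> * ?G 1" by (simp add: distrib_left flip: mult.assoc)
  have Gh: "?G h = h * ?G 1" for h
  proof -
    have "?G h = (of_real (Re h) + \<i> * of_real (Im h)) * ?G 1"
      unfolding linear_complex_decomp[OF lin, of h] Gi by (simp add: scaleR_conv_of_real algebra_simps)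
    then show ?thesis by (simp flip: complex_eq)
  qed
  show ?thesis
    unfolding dzbar_def frechet_derivative_at[OF D, symmetric] axis_eq_smult[of i \<i>] holomorphic_Cn_frechet(2)[OF f] Gh[of "?f _"] Gh[of "_ * _"]
    by (simp flip: mult.assoc)
qed

lemma polydisc_compact: "compact {z::complex ^ 'n::finite. \<forall>i. norm (z $ i) \<le> \<rho>}"
proof -
  have "closed {z::complex ^ 'n. norm (z $ i) \<le> \<rho>}" for i
    by (intro closed_Collect_le continuous_intros)
  then have "closed {z::complex ^ 'n. \<forall>i. norm (z $ i) \<le> \<rho>}" by (rule closed_Collect_all)
  then show ?thesis using polydisc_bounded compact_eq_bounded_closed by blast
qed

text \<open>Turns multiplication by a function known only near the closed polydisc into an operation
  on test functions. Agreement holds on an open neighbourhood of the polydisc of radius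
  \<open>\<rho>\<close>, hence for first derivatives as well.\<close>

lemma C1c_cutoff_product:
  fixes a \<phi> :: "complex ^ 'n::finite \<Rightarrow> complex"
  assumes U: "open U" "closed_polydisc \<subseteq> U" and a: "C1_on U a" and \<phi>: "C1c \<phi>" and \<rho>: "0 \<le> \<rho>" "\<rho> < 1"
  obtains \<psi> where "C1c \<psi>" "\<And>z. \<forall>j. norm (z $ j) \<le> \<rho> \<Longrightarrow> \<psi> z = a z * \<phi> z"
    "\<And>z i. \<forall>j. norm (z $ j) \<le> \<rho> \<Longrightarrow> dzbar i \<psi> z = a z * dzbar i \<phi> z + dzbar i a z * \<phi> z"
proof -
  \<comment> \<open>Equally spaced between \<open>\<rho>\<close> and 1, so that the cutoff is 1
    slightly beyond \<open>\<rho>\<close> and its support stays inside the closed polydisc and thus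
    inside \<open>U\<close>.\<close>
  define \<rho>1 \<rho>2 where "\<rho>1 = (2 * \<rho> + 1) / 3" and "\<rho>2 = (\<rho> + 2) / 3"
  have r: "\<rho> < \<rho>1" "0 \<le> \<rho>1" "\<rho>1 < \<rho>2" "\<rho>2 < 1" using \<rho> by (auto simp: \<rho>1_def \<rho>2_def)
  obtain \<theta> :: "complex \<Rightarrow> complex" where \<theta>: "C1_on UNIV \<theta>" "\<And>w. norm w \<le> \<rho>1 \<Longrightarrow> \<theta> w = 1" "\<And>w. norm w \<ge> \<rho>2 \<Longrightarrow> \<theta> w = 0"
    using C2_cutoff_exists[OF r(2,3)] by metis
  define \<Theta> where "\<Theta> z = (\<Prod>j\<in>UNIV. \<theta> (z $ j))" for z :: "complex ^ 'n"
  have \<Theta>1: "C1_on UNIV \<Theta>" unfolding \<Theta>_def by (intro C1_on_prod C1_on_component \<theta>) auto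
  define \<psi> where "\<psi> z = \<Theta> z * (a z * \<phi> z)" for z
  let ?A = "{z::complex ^ 'n. \<forall>i. norm (z $ i) \<le> \<rho>2}"
  have AU: "?A \<subseteq> U" using U(2) r(4) unfolding closed_polydisc_def by (smt (verit) mem_Collect_eq subset_iff)
  have out: "\<psi> z = 0" if "z \<notin> ?A" for z
  proof -
    obtain i where "norm (z $ i) > \<rho>2" using \<open>z \<notin> ?A\<close> by (auto simp: not_le)
    then have "\<theta> (z $ i) = 0" using \<theta>(3) by simp
    then have "\<Theta> z = 0" unfolding \<Theta>_def by (intro prod_zero) auto
    then show ?thesis by (simp add: \<psi>_def)
  qed
  have \<phi>1: "C1_on UNIV \<phi>" using \<phi> by (simp add: C1c_def)
  have "C1_on U \<psi>" unfolding \<psi>_def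
    by (intro C1_on_mult a C1_on_subset[OF \<phi>1] C1_on_subset[OF \<Theta>1]) auto
  then have "C1_on UNIV \<psi>"
    by (rule C1_on_zero_outside[OF _ compact_imp_closed[OF polydisc_compact] AU out U(1)])
  moreover have "bounded {z. \<psi> z \<noteq> 0}"
    by (rule bounded_subset[OF polydisc_bounded[of \<rho>2]]) (use out in blast)
  ultimately have 1: "C1c \<psi>" by (simp add: C1c_def)
  let ?B = "{z::complex ^ 'n. \<forall>i. norm (z $ i) < \<rho>1}"
  have oB: "open ?B"
  proof -
    have "?B = (\<Inter>i. {z. norm (z $ i) < \<rho>1})" by auto
    moreover have "open {z::complex ^ 'n. norm (z $ i) < \<rho>1}" for i
      by (intro open_Collect_less continuous_intros)
    ultimately show ?thesis by auto
  qed
  have eq: "\<psi> z = a z * \<phi> z" if "z \<in> ?B" for z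
  proof -
    have "\<theta> (z $ j) = 1" for j using \<theta>(2) that by (simp add: less_imp_le)
    then have "\<Theta> z = 1" unfolding \<Theta>_def by (intro prod.neutral) auto
    then show ?thesis by (simp add: \<psi>_def)
  qed
  show thesis
  proof (rule that[OF 1])
    fix z :: "complex ^ 'n" assume z: "\<forall>j. norm (z $ j) \<le> \<rho>"
    have zj: "norm (z $ j) < \<rho>1" for j using spec[OF z, of j] r(1) by linarith
    then have zB: "z \<in> ?B" by simp
    show "\<psi> z = a z * \<phi> z" by (rule eq[OF zB])
    have "norm (z $ j) \<le> \<rho>2" for j using zj[of j] r(3) by linarith
    then have zU: "z \<in> U" using AU by auto
    have "(\<psi> has_derivative frechet_derivative \<psi> (at z)) (at z)" by (rule C1c_has_derivative[OF 1])
    then have "((\<lambda>z. a z * \<phi> z) has_derivative frechet_derivative \<psi> (at z)) (at z)"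
      by (rule has_derivative_transform_within_open[OF _ oB zB eq])
    then have fr: "frechet_derivative \<psi> (at z) = frechet_derivative (\<lambda>z. a z * \<phi> z) (at z)"
      by (rule frechet_derivative_at)
    have "a differentiable (at z)" "\<phi> differentiable (at z)"
      using a \<phi>1 zU by (auto simp: C1_on_def)
    then have "dzbar i (\<lambda>z. a z * \<phi> z) z = a z * dzbar i \<phi> z + dzbar i a z * \<phi> z" for i by (rule dzbar_mult)
    moreover have "dzbar i \<psi> z = dzbar i (\<lambda>z. a z * \<phi> z) z" for i unfolding dzbar_def fr ..
    ultimately show "dzbar i \<psi> z = a z * dzbar i \<phi> z + dzbar i a z * \<phi> z" for i by simp
  qed
qed

section \<open>Borel representatives and radii of supports\<close>

lemma lebesgue_borel_representative:
  fixes u :: "'a::euclidean_space \<Rightarrow> complex"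
  assumes "u \<in> borel_measurable lebesgue"
  obtains v where "v \<in> borel_measurable borel" "AE x in lebesgue. u x = v x"
proof -
  have "(\<lambda>x. Re (u x)) \<in> borel_measurable lebesgue" "(\<lambda>x. Im (u x)) \<in> borel_measurable lebesgue"
    using assms by auto
  then obtain a b where ab: "a \<in> borel_measurable lborel" "AE x in lborel. Re (u x) = a x"
    "b \<in> borel_measurable lborel" "AE x in lborel. Im (u x) = b x"
    using completion_ex_borel_measurable_real by metis
  show thesis
  proof (rule that[of "\<lambda>x. Complex (a x) (b x)"])
    show "(\<lambda>x. Complex (a x) (b x)) \<in> borel_measurable borel"
      using ab(1,3) by (simp add: Complex_eq)
    have "AE x in lborel. u x = Complex (a x) (b x)"
      using ab(2,4) by eventually_elim (simp add: complex_eq_iff)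
    then show "AE x in lebesgue. u x = Complex (a x) (b x)" by (rule AE_completion)
  qed
qed

text \<open>For a function that is merely Lebesgue measurable, \<open>u (x - L w)\<close> can fail
  to be measurable in \<open>w\<close>. Multiplying a Borel version by the indicator of
  \<open>K\<close> also turns vanishing almost everywhere off \<open>K\<close> into vanishing
  everywhere off \<open>K\<close>.\<close>

lemma Lr_comp_borel_representative:
  fixes u :: "'a::euclidean_space \<Rightarrow> complex"
  assumes "u \<in> Lr_comp r \<Omega>"
  shows "\<exists>v K. compact K \<and> K \<subseteq> \<Omega> \<and> v \<in> borel_measurable borel \<and> v \<in> Lr_fun r
    \<and> (\<forall>x. x \<notin> K \<longrightarrow> v x = 0) \<and> (AE x in lebesgue. u x = v x)"
proof -
  obtain K where K: "compact K" "K \<subseteq> \<Omega>" "AE x in lebesgue. x \<notin> K \<longrightarrow> u x = 0" and u: "u \<in> Lr_fun r"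
    using assms by (auto simp: Lr_comp_def)
  have um: "u \<in> borel_measurable lebesgue" using u by (auto simp: Lr_fun_def)
  obtain v0 where v0: "v0 \<in> borel_measurable borel" "AE x in lebesgue. u x = v0 x"
    using lebesgue_borel_representative[OF um] by blast
  define v where "v x = indicator K x *\<^sub>R v0 x" for x
  have Kb: "K \<in> sets borel" by (rule borel_compact[OF K(1)])
  have vm: "v \<in> borel_measurable borel"
    unfolding v_def by (rule borel_measurable_scaleR[OF borel_measurable_indicator[OF Kb] v0(1)])
  have eq: "AE x in lebesgue. u x = v x"
    using K(3) v0(2) by eventually_elim (auto simp: v_def indicator_def)
  have "v \<in> Lr_fun r"
  proof (cases "r = \<infinity>")
    case True
    then obtain C where "AE x in lebesgue. norm (u x) \<le> C" using u by (auto simp: Lr_fun_def)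
    with eq have "AE x in lebesgue. norm (v x) \<le> C" by eventually_elim simp
    then show ?thesis using True measurable_completion[of v lborel borel] vm by (auto simp: Lr_fun_def)
  next
    case False
    have "(\<integral>\<^sup>+x. ennreal (norm (v x) powr enn2real r) \<partial>lebesgue) = (\<integral>\<^sup>+x. ennreal (norm (u x) powr enn2real r) \<partial>lebesgue)"
      by (rule nn_integral_cong_AE) (use eq in eventually_elim, simp)
    then show ?thesis using False u measurable_completion[of v lborel borel] vm by (auto simp: Lr_fun_def)
  qed
  then show ?thesis using K(1,2) vm eq by (intro exI[of _ v] exI[of _ K]) (simp add: v_def)
qed

lemma compact_subset_polydisc:
  fixes K :: "(complex ^ 'n::finite) set"
  assumes "compact K" "K \<subseteq> open_polydisc"
  obtains \<rho> where "0 \<le> \<rho>" "\<rho> < 1" "\<And>z i. z \<in> K \<Longrightarrow> norm (z $ i) \<le> \<rho>"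
proof (cases "K = {}")
  case True then show thesis using that[of 0] by auto
next
  case False
  have "\<exists>m. 0 \<le> m \<and> m < 1 \<and> (\<forall>z\<in>K. norm (z $ i) \<le> m)" for i
  proof -
    have "continuous_on K (\<lambda>z. norm (z $ i))" by (intro continuous_intros)
    from continuous_attains_sup[OF assms(1) False this] obtain x where "x \<in> K" "\<forall>z\<in>K. norm (z $ i) \<le> norm (x $ i)" by blast
    then show ?thesis using assms(2) by (intro exI[of _ "norm (x $ i)"]) (auto simp: open_polydisc_def)
  qed
  then obtain m where m: "\<And>i. 0 \<le> m i" "\<And>i. m i < 1" "\<And>i z. z \<in> K \<Longrightarrow> norm (z $ i) \<le> m i" by metis
  show thesis
  proof (rule that[of "Max (range m)"])
    show "Max (range m) < 1" using m(2) by (subst Max_less_iff) auto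
    show "0 \<le> Max (range m)" using m(1) by (subst Max_ge_iff) auto
    show "norm (z $ i) \<le> Max (range m)" if "z \<in> K" for z :: "complex ^ 'n" and i
      using m(3)[OF that, of i] by (rule order_trans) (rule Max_ge, auto)
  qed
qed

lemma lebesgue_integral_cong_borel:
  fixes g :: "'a::euclidean_space \<Rightarrow> complex"
  assumes "AE x in lebesgue. u x = v x" "u \<in> borel_measurable lebesgue" "v \<in> borel_measurable borel" "g \<in> borel_measurable borel"
  shows "(\<integral>x. u x * g x \<partial>lebesgue) = (LBINT x. v x * g x)"
proof -
  have gm: "g \<in> borel_measurable lebesgue" and vm: "v \<in> borel_measurable lebesgue"
    using assms by (auto intro!: measurable_completion)
  have "(\<integral>x. u x * g x \<partial>lebesgue) = (\<integral>x. v x * g x \<partial>lebesgue)"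
    by (rule integral_cong_AE) (use assms(1,2) gm vm in auto)
  also have "\<dots> = (LBINT x. v x * g x)"
    by (rule integral_completion) (use assms in auto)
  finally show ?thesis .
qed

lemma Lr_polydisc_Lr_comp:
  fixes u :: "complex ^ 'n::finite \<Rightarrow> complex"
  assumes "Lr_polydisc r \<rho> u" "\<rho> < 1"
  shows "u \<in> Lr_comp r open_polydisc"
proof -
  have "{z::complex ^ 'n. \<forall>i. norm (z $ i) \<le> \<rho>} \<subseteq> open_polydisc"
    using assms(2) by (auto simp: open_polydisc_def intro: le_less_trans)
  moreover have "AE z in lebesgue. z \<notin> {z::complex ^ 'n. \<forall>i. norm (z $ i) \<le> \<rho>} \<longrightarrow> u z = 0"
    using assms(1) by (intro AE_I2) (auto simp: Lr_polydisc_def)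
  ultimately show ?thesis
    using assms(1) polydisc_compact[of \<rho>] unfolding Lr_comp_def Lr_polydisc_def by blast
qed

text \<open>\<open>a\<close> is controlled only on \<open>K\<close>; inserting the indicator of
  \<open>K\<close> makes the factor bounded and Borel without changing the product.\<close>

lemma Lr_polydisc_mult_continuous:
  fixes u a :: "complex ^ 'n::finite \<Rightarrow> complex"
  assumes u: "Lr_polydisc r \<rho> u" and K: "compact K" "\<And>z. u z \<noteq> 0 \<Longrightarrow> z \<in> K" and a: "continuous_on K a"
  shows "Lr_polydisc r \<rho> (\<lambda>z. a z * u z)"
proof -
  have "bounded (a ` K)" by (intro compact_imp_bounded compact_continuous_image a K(1))
  then obtain B where B: "\<And>z. z \<in> K \<Longrightarrow> norm (a z) \<le> B" by (auto simp: bounded_iff)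
  have "Lr_polydisc r \<rho> (\<lambda>z. (indicator K z *\<^sub>R a z) * u z)"
  proof (rule Lr_polydisc_mult[OF u, where B=B])
    show "(\<lambda>z. indicator K z *\<^sub>R a z) \<in> borel_measurable borel"
      by (rule borel_measurable_continuous_on_indicator[OF borel_compact[OF K(1)] a])
    show "norm (indicator K z *\<^sub>R a z) \<le> B" if "u z \<noteq> 0" for z
      using B K(2)[OF that] by simp
  qed
  also have "(\<lambda>z. (indicator K z *\<^sub>R a z) * u z) = (\<lambda>z. a z * u z)"
    using K(2) by (auto simp: fun_eq_iff indicator_def)
  finally show ?thesis .
qed

theorem corollary8p4:
  fixes f :: "complex ^ 'n::{finite,linorder} \<Rightarrow> complex"
    and U :: "(complex ^ 'n::{finite,linorder}) set"
    and \<omega> :: "'n form"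
    and q k :: nat
    and r :: ennreal
  assumes "1 \<le> q" and "q < CARD('n)" and "1 \<le> r"
    and "closed_polydisc \<subseteq> U" and "holomorphic_Cn_on f U"
    and "\<omega> \<in> form_Lr_comp r (open_polydisc - {z \<in> U. f z = 0}) q"
    and "current_eq (q + 1) (dbar (current_of \<omega>)) (\<lambda>K \<phi>. 0)"
    and "\<And>J i. card J = CARD('n) - q \<Longrightarrow> i \<in> {1..CARD('n) - q} \<Longrightarrow>
           distribution_in_Lr r
             (fold distribution_dzbar (drop (i - 1) (sorted_list_of_set J))
               (distribution_of (\<omega> (- J))))"
  shows "(\<exists>\<beta> \<in> form_Lr_comp r open_polydisc (q - 1).
            current_eq q (dbar (current_of (form_mult (\<lambda>z. f z ^ k) \<beta>))) (current_of \<omega>)) \<and>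
         (\<exists>\<eta> \<in> form_Lr_comp r open_polydisc (q - 1).
            zero_up_to_order r (q - 1) f k \<eta> \<and>
            current_eq q (dbar (current_of \<eta>)) (current_of \<omega>))"
proof -
  note q = assms(1,2) and r = assms(3) and U = assms(4) and f = assms(5)
  have oU: "open U" using f by (simp add: holomorphic_Cn_on_def)
  have f1: "C1_on U f" by (rule holomorphic_Cn_C1_on(1)[OF f])
  let ?Z = "{z \<in> U. f z = 0}"
  \<comment> \<open>A single predicate, so that a representative and its compact set are chosen
    together for each \<open>I\<close>.\<close>
  define Q where "Q I v K \<longleftrightarrow> compact K \<and> K \<subseteq> open_polydisc - ?Z \<and> v \<in> borel_measurable borel
      \<and> v \<in> Lr_fun r \<and> (\<forall>z. z \<notin> K \<longrightarrow> v z = 0) \<and> (AE z in lebesgue. \<omega> I z = v z)" for I v K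
  have "\<exists>v K. Q I v K" if "card I = q" for I
    unfolding Q_def
    by (rule Lr_comp_borel_representative) (use assms(6) that in \<open>simp add: form_Lr_comp_def\<close>)
  then obtain u K where "\<And>I. card I = q \<Longrightarrow> Q I (u I) (K I)" by metis
  note uK = this[unfolded Q_def]
  \<comment> \<open>There are finitely many index sets, so one compact set serves all
    components.\<close>
  define KK where "KK = (\<Union>I\<in>{I. card I = q}. K I)"
  have KK: "compact KK" "KK \<subseteq> open_polydisc - ?Z" unfolding KK_def using uK by (auto intro!: compact_UN)
  have u0: "z \<in> KK" if "card I = q" "u I z \<noteq> 0" for I z
    using uK[OF that(1)] that unfolding KK_def by blast
  obtain \<rho> where \<rho>: "0 \<le> \<rho>" "\<rho> < 1" "\<And>z i. z \<in> KK \<Longrightarrow> norm (z $ i) \<le> \<rho>"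
    using compact_subset_polydisc[of KK] KK by blast
  have gu: "Lr_polydisc r \<rho> (u I)" if "card I = q" for I
    unfolding Lr_polydisc_def using uK[OF that] u0[OF that] \<rho>(3) by simp
  have KKU: "KK \<subseteq> U"
  proof
    fix z assume "z \<in> KK"
    then have "z \<in> closed_polydisc" using KK(2) by (auto simp: open_polydisc_def closed_polydisc_def less_imp_le)
    then show "z \<in> U" using U by blast
  qed
  have AE\<omega>: "AE z in lebesgue. \<omega> I z = u I z" and \<omega>m: "\<omega> I \<in> borel_measurable lebesgue"
    and um: "u I \<in> borel_measurable borel" if "card I = q" for I
    using uK[OF that] that assms(6) by (simp_all add: form_Lr_comp_def Lr_comp_def Lr_fun_def)
  \<comment> \<open>The assumption concerns smooth test functions and Lebesgue representatives;
    mollification and the choice of \<open>u\<close> convert it into the C1 form.\<close>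
  have clu: "closed_form q u"
  proof (rule closed_form_if_test_fun)
    show "integrable lborel (u I)" if "card I = q" for I by (rule Lr_polydisc_integrable[OF gu[OF that] r])
    fix K :: "'n set" and \<phi> :: "(complex, 'n) vec \<Rightarrow> complex"
    assume K: "card K = q + 1" and \<phi>: "test_fun \<phi>"
    have "dbar (current_of \<omega>) K \<phi> = 0"
      using assms(7) K \<phi> by (simp add: current_eq_def distribution_eq_def)
    moreover have "dbar (current_of \<omega>) K \<phi> = - (\<Sum>i\<in>K. sg i K * (LBINT z. u (K - {i}) z * dzbar i \<phi> z))"
      unfolding dbar_def distribution_dzbar_def current_of_def distribution_of_def sum_negf[symmetric]
    proof (rule sum.cong[OF refl])
      fix i assume "i \<in> K"
      then have I: "card (K - {i}) = q" using K by simp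
      have "(\<integral>z. \<omega> (K - {i}) z * dzbar i \<phi> z \<partial>lebesgue) = (LBINT z. u (K - {i}) z * dzbar i \<phi> z)"
        by (rule lebesgue_integral_cong_borel[OF AE\<omega>[OF I] \<omega>m[OF I] um[OF I] dzbar_measurable[OF test_fun_C1c[OF \<phi>]]])
      then show "sg i K * - (\<integral>z. \<omega> (K - {i}) z * dzbar i \<phi> z \<partial>lebesgue) = - (sg i K * (LBINT z. u (K - {i}) z * dzbar i \<phi> z))"
        by simp
    qed
    ultimately show "(\<Sum>i\<in>K. sg i K * (LBINT z. u (K - {i}) z * dzbar i \<phi> z)) = 0" by simp
  qed
  have fKK: "continuous_on KK (\<lambda>z. norm (f z))"
    by (intro continuous_on_norm continuous_on_subset[OF C1_on_continuous_on[OF f1] KKU])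
  \<comment> \<open>\<open>f\<close> has no zero on the compact set \<open>KK\<close>, so its
    modulus has a positive minimum there; for empty \<open>KK\<close> any positive value
    works.\<close>
  obtain \<delta> where \<delta>: "\<delta> > 0" "\<And>z. z \<in> KK \<Longrightarrow> norm (f z) \<ge> \<delta>"
  proof (cases "KK = {}")
    case True then show thesis using that[of 1] by auto
  next
    case False
    obtain x where x: "x \<in> KK" "\<forall>z\<in>KK. norm (f x) \<le> norm (f z)"
      using continuous_attains_inf[OF KK(1) False fKK] by blast
    have "f x \<noteq> 0" using x KK KKU by blast
    then show thesis using that[of "norm (f x)"] x by auto
  qed
  obtain G where G: "C1_on UNIV G" "\<And>w. norm w \<ge> \<delta> \<Longrightarrow> G w * w = 1" "\<And>w. norm w \<ge> \<delta> \<Longrightarrow> dbar1 G w = 0"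
    using regularized_inverse[OF \<delta>(1)] by metis
  \<comment> \<open>On \<open>KK\<close> this is the reciprocal of \<open>f z ^ k\<close>, but it is
    C1 on all of \<open>U\<close>, across the zeros of \<open>f\<close>.\<close>
  define F where "F z = G (f z) ^ k" for z
  have F0: "C1_on U (\<lambda>z. G (f z))" by (rule C1_on_compose[OF G(1) f1])
  have F1: "C1_on U F" unfolding F_def by (rule C1_on_power[OF F0])
  have dF: "dzbar i F z = 0" if "z \<in> KK" for i z
    unfolding F_def
  proof (rule dzbar_power_eq_0)
    have "z \<in> U" using that KKU by blast
    then show "(\<lambda>z. G (f z)) differentiable (at z)" using F0 by (simp add: C1_on_def)
    show "dzbar i (\<lambda>z. G (f z)) z = 0"
      by (rule dzbar_compose_holomorphic[OF f \<open>z \<in> U\<close> G(1) G(3)[OF \<delta>(2)[OF that]]])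
  qed
  have Ff: "F z * f z ^ k = 1" if "z \<in> KK" for z
    unfolding F_def power_mult_distrib[symmetric] G(2)[OF \<delta>(2)[OF that]] by simp
  define w where "w I = (\<lambda>z. F z * u I z)" for I
  have gw: "Lr_polydisc r \<rho> (w I)" if "card I = q" for I
    unfolding w_def
    by (rule Lr_polydisc_mult_continuous[OF gu[OF that] KK(1) u0[OF that] continuous_on_subset[OF C1_on_continuous_on[OF F1] KKU]])
  have clw: "closed_form q w"
    unfolding closed_form_def
  proof (intro allI impI)
    fix K :: "'n set" and \<phi> :: "(complex, 'n) vec \<Rightarrow> complex"
    assume K: "card K = q + 1" and \<phi>: "C1c \<phi>"
    \<comment> \<open>Pairing \<open>w\<close> with \<open>\<phi>\<close> amounts to pairing
      \<open>u\<close> with \<open>F z * \<phi> z\<close>, because \<open>dzbar i F\<close> vanishes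
      on \<open>KK\<close>; \<open>\<psi>\<close> is that product made into an admissible test
      function.\<close>
    obtain \<psi> where \<psi>: "C1c \<psi>" "\<And>z i. \<forall>j. norm (z $ j) \<le> \<rho> \<Longrightarrow> dzbar i \<psi> z = F z * dzbar i \<phi> z + dzbar i F z * \<phi> z"
      using C1c_cutoff_product[OF oU U F1 \<phi> \<rho>(1,2)] by metis
    have "(\<Sum>i\<in>K. sg i K * (LBINT z. w (K - {i}) z * dzbar i \<phi> z)) = (\<Sum>i\<in>K. sg i K * (LBINT z. u (K - {i}) z * dzbar i \<psi> z))"
    proof (rule sum.cong[OF refl])
      fix i assume "i \<in> K"
      then have I: "card (K - {i}) = q" using K by simp
      have "w (K - {i}) z * dzbar i \<phi> z = u (K - {i}) z * dzbar i \<psi> z" for z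
      proof (cases "u (K - {i}) z = 0")
        case False
        then have z: "z \<in> KK" by (rule u0[OF I])
        have "dzbar i \<psi> z = F z * dzbar i \<phi> z" using \<psi>(2)[of z i] \<rho>(3)[OF z] dF[OF z] by simp
        then show ?thesis by (simp add: w_def)
      qed (simp add: w_def)
      then show "sg i K * (LBINT z. w (K - {i}) z * dzbar i \<phi> z) = sg i K * (LBINT z. u (K - {i}) z * dzbar i \<psi> z)"
        by simp
    qed
    also have "\<dots> = 0" using clu K \<psi>(1) unfolding closed_form_def by blast
    finally show "(\<Sum>i\<in>K. sg i K * (LBINT z. w (K - {i}) z * dzbar i \<phi> z)) = 0" .
  qed
  obtain \<rho>' \<beta> where \<rho>': "0 \<le> \<rho>'" "\<rho>' < 1" and g\<beta>: "\<And>I. card I = q - 1 \<Longrightarrow> Lr_polydisc r \<rho>' (\<beta> I)"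
    and sol: "\<And>I \<phi>. card I = q \<Longrightarrow> C1c \<phi> \<Longrightarrow> dbar_pair \<beta> I \<phi> = (LBINT z. w I z * \<phi> z)"
    using dbar_solvable_compact_support[OF r \<rho>(1,2) q gw clw] by blast
  have \<beta>_in: "\<beta> \<in> form_Lr_comp r open_polydisc (q - 1)"
    using Lr_polydisc_Lr_comp[OF g\<beta> \<rho>'(2)] by (simp add: form_Lr_comp_def)
  have fk: "C1_on U (\<lambda>z. f z ^ k)" by (rule C1_on_power[OF f1])
  let ?P = "{z::(complex, 'n) vec. \<forall>i. norm (z $ i) \<le> \<rho>'}"
  have PU: "?P \<subseteq> U"
  proof
    fix z assume "z \<in> ?P"
    then have "norm (z $ i) \<le> 1" for i using \<rho>'(2) by (metis (mono_tags) less_imp_le mem_Collect_eq order_trans)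
    then have "z \<in> closed_polydisc" by (simp add: closed_polydisc_def)
    then show "z \<in> U" using U by blast
  qed
  define \<eta> where "\<eta> = form_mult (\<lambda>z. f z ^ k) \<beta>"
  have \<eta>: "\<eta> I = (\<lambda>z. f z ^ k * \<beta> I z)" for I by (simp add: \<eta>_def form_mult_def)
  have g\<eta>: "Lr_polydisc r \<rho>' (\<eta> I)" if "card I = q - 1" for I
    unfolding \<eta>
  proof (rule Lr_polydisc_mult_continuous[OF g\<beta>[OF that] polydisc_compact])
    show "z \<in> ?P" if "\<beta> I z \<noteq> 0" for z using g\<beta>[OF \<open>card I = q - 1\<close>] that by (auto simp: Lr_polydisc_def)
    show "continuous_on ?P (\<lambda>z. f z ^ k)" by (rule continuous_on_subset[OF C1_on_continuous_on[OF fk] PU])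
  qed
  have \<eta>_in: "\<eta> \<in> form_Lr_comp r open_polydisc (q - 1)"
    using Lr_polydisc_Lr_comp[OF g\<eta> \<rho>'(2)] by (simp add: form_Lr_comp_def)
  have eq: "current_eq q (dbar (current_of \<eta>)) (current_of \<omega>)"
    unfolding current_eq_def distribution_eq_def
  proof (intro allI impI)
    fix I :: "'n set" and \<phi> :: "(complex, 'n) vec \<Rightarrow> complex"
    assume I: "card I = q" and "test_fun \<phi>"
    then have \<phi>: "C1c \<phi>" by (simp add: test_fun_C1c)
    \<comment> \<open>The new test function has to agree with \<open>f z ^ k * \<phi> z\<close> on
      the supports of both \<open>\<beta>\<close> and \<open>u\<close>.\<close>
    define \<rho>m where "\<rho>m = max \<rho> \<rho>'"
    have \<rho>m: "0 \<le> \<rho>m" "\<rho>m < 1" "\<rho> \<le> \<rho>m" "\<rho>' \<le> \<rho>m" using \<rho> \<rho>' by (auto simp: \<rho>m_def)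
    obtain \<psi> where \<psi>: "C1c \<psi>" "\<And>z. \<forall>j. norm (z $ j) \<le> \<rho>m \<Longrightarrow> \<psi> z = f z ^ k * \<phi> z"
      "\<And>z i. \<forall>j. norm (z $ j) \<le> \<rho>m \<Longrightarrow> dzbar i \<psi> z = f z ^ k * dzbar i \<phi> z + dzbar i (\<lambda>z. f z ^ k) z * \<phi> z"
      using C1c_cutoff_product[OF oU U fk \<phi> \<rho>m(1,2)] by metis
    \<comment> \<open>\<open>f z ^ k\<close> is holomorphic, so it passes through
      \<open>dzbar\<close> to the test function.\<close>
    have "dbar (current_of \<eta>) I \<phi> = dbar_pair \<beta> I \<psi>"
      unfolding dbar_def distribution_dzbar_def current_of_def distribution_of_def dbar_pair_def sum_negf[symmetric]
    proof (rule sum.cong[OF refl])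
      fix i assume "i \<in> I"
      then have c: "card (I - {i}) = q - 1" using I by simp
      have pt: "\<eta> (I - {i}) z * dzbar i \<phi> z = \<beta> (I - {i}) z * dzbar i \<psi> z" for z
      proof (cases "\<beta> (I - {i}) z = 0")
        case False
        then have z: "norm (z $ j) \<le> \<rho>'" for j using g\<beta>[OF c] by (auto simp: Lr_polydisc_def)
        then have zU: "z \<in> U" using PU by blast
        have "dzbar i (\<lambda>z. f z ^ k) z = 0"
          by (rule dzbar_power_eq_0) (use zU f1 holomorphic_Cn_C1_on(2)[OF f zU] in \<open>auto simp: C1_on_def\<close>)
        moreover have "\<forall>j. norm (z $ j) \<le> \<rho>m" using z \<rho>m(4) order_trans by blast
        ultimately have "dzbar i \<psi> z = f z ^ k * dzbar i \<phi> z" using \<psi>(3) by simp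
        then show ?thesis by (simp add: \<eta>)
      qed (simp add: \<eta>)
      have "\<beta> (I - {i}) \<in> borel_measurable borel" using g\<beta>[OF c] by (simp add: Lr_polydisc_def)
      then have "(\<integral>z. \<beta> (I - {i}) z * dzbar i \<psi> z \<partial>lebesgue) = (LBINT z. \<beta> (I - {i}) z * dzbar i \<psi> z)"
        using dzbar_measurable[OF \<psi>(1)] by (intro integral_completion) simp
      then show "sg i I * - (\<integral>z. \<eta> (I - {i}) z * dzbar i \<phi> z \<partial>lebesgue) = - (sg i I * (LBINT z. \<beta> (I - {i}) z * dzbar i \<psi> z))"
        unfolding pt by simp
    qed
    also have "\<dots> = (LBINT z. w I z * \<psi> z)" by (rule sol[OF I \<psi>(1)])
    \<comment> \<open>On the support of \<open>u\<close> the factors \<open>F z\<close> and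
      \<open>f z ^ k\<close> cancel.\<close>
    also have "\<dots> = (LBINT z. u I z * \<phi> z)"
    proof (rule Bochner_Integration.integral_cong[OF refl])
      fix z
      show "w I z * \<psi> z = u I z * \<phi> z"
      proof (cases "u I z = 0")
        case False
        then have z: "z \<in> KK" by (rule u0[OF I])
        have "\<forall>j. norm (z $ j) \<le> \<rho>m" using \<rho>(3)[OF z] \<rho>m(3) order_trans by blast
        then have "w I z * \<psi> z = (F z * f z ^ k) * (u I z * \<phi> z)" using \<psi>(2) by (simp add: w_def mult_ac)
        then show ?thesis using Ff[OF z] by simp
      qed (simp add: w_def)
    qed
    also have "\<dots> = current_of \<omega> I \<phi>"
      unfolding current_of_def distribution_of_def
      by (rule lebesgue_integral_cong_borel[symmetric, OF AE\<omega>[OF I] \<omega>m[OF I] um[OF I] borel_measurable_continuous_onI[OF C1c_continuous[OF \<phi>]]])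
    finally show "dbar (current_of \<eta>) I \<phi> = current_of \<omega> I \<phi>" .
  qed
  have zero: "zero_up_to_order r (q - 1) f k \<eta>"
    unfolding zero_up_to_order_def using \<beta>_in by (intro bexI[of _ \<beta>]) (simp_all add: \<eta>_def)
  show ?thesis using \<beta>_in \<eta>_in zero eq unfolding \<eta>_def by blast
qed

end
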